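(* Let $A$ and $B$ be finitely generated virtually abelian groups, let $N$ be a common normal subgroup $N \lhd A$ and $N \lhd B$, and let $G = A *_N B$ be the amalgamated free product of $A$ and $B$ over $N$. Then $G$ has (LR) if and only if the natural images of $A$ and $B$ in $\mathrm{Out}(N)$ generate a finite subgroup. In particular, this is the case when one of $A$ or $B$ is abelian.
   Context: A subgroup $H$ of a group $G$ is a virtual retract of $G$ if there is a finite index subgroup $K$ of $G$ such that $H \subseteq K$ and there is a homomorphism $\rho: K \to H$ whose restriction to $H$ is the identity map. A group $G$ has property (LR) if every finitely generated subgroup of $G$ is a virtual retract of $G$. If $N$ is a normal subgroup of a group $A$, the natural homomorphism $A \to \mathrm{Out}(N) = \mathrm{Aut}(N)/\mathrm{Inn}(N)$ is the composition of the conjugation action $A \to \mathrm{Aut}(N)$ with the quotient map $\mathrm{Aut}(N) \to \mathrm{Out}(N)$; the natural image of $A$ is the image of this homomorphism. *)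

theory Defs
  imports "HOL-Algebra.Algebra"
begin

section \<open>Finitely generated and virtually abelian groups, virtual retracts, property (LR)\<close>

definition fg_subgroup :: "'a set \<Rightarrow> ('a, 'm) monoid_scheme \<Rightarrow> bool" where
  "fg_subgroup H G \<longleftrightarrow> (\<exists>S. finite S \<and> S \<subseteq> carrier G \<and> generate G S = H)"

definition fg_group :: "('a, 'm) monoid_scheme \<Rightarrow> bool" where
  "fg_group G \<longleftrightarrow> group G \<and> fg_subgroup (carrier G) G"

definition finite_index_subgroup :: "'a set \<Rightarrow> ('a, 'm) monoid_scheme \<Rightarrow> bool" where
  "finite_index_subgroup K G \<longleftrightarrow> subgroup K G \<and> finite (rcosets\<^bsub>G\<^esub> K)"

definition virtually_abelian :: "('a, 'm) monoid_scheme \<Rightarrow> bool" where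
  "virtually_abelian G \<longleftrightarrow>
     (\<exists>K. finite_index_subgroup K G \<and> comm_group (G\<lparr>carrier := K\<rparr>))"

definition virtual_retract :: "'a set \<Rightarrow> ('a, 'm) monoid_scheme \<Rightarrow> bool" where
  "virtual_retract H G \<longleftrightarrow>
     subgroup H G \<and>
     (\<exists>K. finite_index_subgroup K G \<and> H \<subseteq> K \<and>
        (\<exists>\<rho> \<in> hom (G\<lparr>carrier := K\<rparr>) (G\<lparr>carrier := H\<rparr>). \<forall>h\<in>H. \<rho> h = h))"

definition property_LR :: "('a, 'm) monoid_scheme \<Rightarrow> bool" where
  "property_LR G \<longleftrightarrow> (\<forall>H. fg_subgroup H G \<longrightarrow> virtual_retract H G)"


section \<open>Amalgamated free products\<close>

text \<open>
  The common subgroup is given as a group \<open>N\<close> with embeddings \<open>\<phi> : N \<rightarrow> A\<close> and \<open>\<psi> : N \<rightarrow> B\<close>.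
  The amalgamated free product is presented by all elements of \<open>A\<close> and \<open>B\<close> as generators, with the
  multiplication tables of \<open>A\<close> and \<open>B\<close> and the identifications \<open>\<phi> n = \<psi> n\<close> as relations. Its
  elements are classes of words in the letters \<open>Inl a\<close> and \<open>Inr b\<close>; no formal inverses
  are needed, because the inverse of a letter is again a letter.
\<close>

inductive amalg_rel ::
  "('n, 'k) monoid_scheme \<Rightarrow> ('a, 'm) monoid_scheme \<Rightarrow> ('b, 'l) monoid_scheme \<Rightarrow>
   ('n \<Rightarrow> 'a) \<Rightarrow> ('n \<Rightarrow> 'b) \<Rightarrow> ('a + 'b) list \<Rightarrow> ('a + 'b) list \<Rightarrow> bool"
  for N A B \<phi> \<psi> where
  oneA: "amalg_rel N A B \<phi> \<psi> [Inl \<one>\<^bsub>A\<^esub>] []"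
| oneB: "amalg_rel N A B \<phi> \<psi> [Inr \<one>\<^bsub>B\<^esub>] []"
| multA: "\<lbrakk>x \<in> carrier A; y \<in> carrier A\<rbrakk> \<Longrightarrow>
    amalg_rel N A B \<phi> \<psi> [Inl x, Inl y] [Inl (x \<otimes>\<^bsub>A\<^esub> y)]"
| multB: "\<lbrakk>x \<in> carrier B; y \<in> carrier B\<rbrakk> \<Longrightarrow>
    amalg_rel N A B \<phi> \<psi> [Inr x, Inr y] [Inr (x \<otimes>\<^bsub>B\<^esub> y)]"
| glue: "n \<in> carrier N \<Longrightarrow> amalg_rel N A B \<phi> \<psi> [Inl (\<phi> n)] [Inr (\<psi> n)]"

abbreviation amalg_words ::
  "('a, 'm) monoid_scheme \<Rightarrow> ('b, 'l) monoid_scheme \<Rightarrow> ('a + 'b) list set" where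
  "amalg_words A B \<equiv> lists (carrier A <+> carrier B)"

inductive_set amalg_cong ::
  "('n, 'k) monoid_scheme \<Rightarrow> ('a, 'm) monoid_scheme \<Rightarrow> ('b, 'l) monoid_scheme \<Rightarrow>
   ('n \<Rightarrow> 'a) \<Rightarrow> ('n \<Rightarrow> 'b) \<Rightarrow> (('a + 'b) list \<times> ('a + 'b) list) set"
  for N A B \<phi> \<psi> where
  rel: "\<lbrakk>amalg_rel N A B \<phi> \<psi> r s; u \<in> amalg_words A B; v \<in> amalg_words A B\<rbrakk> \<Longrightarrow>
    (u @ r @ v, u @ s @ v) \<in> amalg_cong N A B \<phi> \<psi>"
| refl: "w \<in> amalg_words A B \<Longrightarrow> (w, w) \<in> amalg_cong N A B \<phi> \<psi>"
| sym: "(u, v) \<in> amalg_cong N A B \<phi> \<psi> \<Longrightarrow> (v, u) \<in> amalg_cong N A B \<phi> \<psi>"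
| trans: "\<lbrakk>(u, v) \<in> amalg_cong N A B \<phi> \<psi>; (v, w) \<in> amalg_cong N A B \<phi> \<psi>\<rbrakk> \<Longrightarrow>
    (u, w) \<in> amalg_cong N A B \<phi> \<psi>"

definition amalg_product ::
  "('n, 'k) monoid_scheme \<Rightarrow> ('a, 'm) monoid_scheme \<Rightarrow> ('b, 'l) monoid_scheme \<Rightarrow>
   ('n \<Rightarrow> 'a) \<Rightarrow> ('n \<Rightarrow> 'b) \<Rightarrow> ('a + 'b) list set monoid" where
  "amalg_product N A B \<phi> \<psi> =
     \<lparr>carrier = amalg_words A B // amalg_cong N A B \<phi> \<psi>,
      monoid.mult = (\<lambda>U V. \<Union>u\<in>U. \<Union>v\<in>V. amalg_cong N A B \<phi> \<psi> `` {u @ v}),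
      one = amalg_cong N A B \<phi> \<psi> `` {[]}\<rparr>"


section \<open>Outer automorphisms\<close>

text \<open>
  The conjugation action of \<open>A\<close> on a normal subgroup, transported to \<open>N\<close> along the embedding
  \<open>\<phi> : N \<rightarrow> A\<close> of that subgroup. Elements of \<^const>\<open>AutoGroup\<close> are extensional functions, whence the
  restriction.
\<close>

definition conj_aut ::
  "('n, 'k) monoid_scheme \<Rightarrow> ('a, 'm) monoid_scheme \<Rightarrow> ('n \<Rightarrow> 'a) \<Rightarrow> 'a \<Rightarrow> 'n \<Rightarrow> 'n" where
  "conj_aut N A \<phi> a =
     (\<lambda>n\<in>carrier N. inv_into (carrier N) \<phi> (a \<otimes>\<^bsub>A\<^esub> \<phi> n \<otimes>\<^bsub>A\<^esub> inv\<^bsub>A\<^esub> a))"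

definition Inn :: "('n, 'k) monoid_scheme \<Rightarrow> ('n \<Rightarrow> 'n) set" where
  "Inn N = (\<lambda>g. \<lambda>n\<in>carrier N. g \<otimes>\<^bsub>N\<^esub> n \<otimes>\<^bsub>N\<^esub> inv\<^bsub>N\<^esub> g) ` carrier N"

definition Out :: "('n, 'k) monoid_scheme \<Rightarrow> ('n \<Rightarrow> 'n) set monoid" where
  "Out N = AutoGroup N Mod Inn N"

definition natural_hom_Out ::
  "('n, 'k) monoid_scheme \<Rightarrow> ('a, 'm) monoid_scheme \<Rightarrow> ('n \<Rightarrow> 'a) \<Rightarrow> 'a \<Rightarrow> ('n \<Rightarrow> 'n) set" where
  "natural_hom_Out N A \<phi> a = Inn N #>\<^bsub>AutoGroup N\<^esub> conj_aut N A \<phi> a"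

definition natural_image_Out ::
  "('n, 'k) monoid_scheme \<Rightarrow> ('a, 'm) monoid_scheme \<Rightarrow> ('n \<Rightarrow> 'a) \<Rightarrow> ('n \<Rightarrow> 'n) set set" where
  "natural_image_Out N A \<phi> = natural_hom_Out N A \<phi> ` carrier A"

end

theory Submission
  imports Defs
begin

text \<open>
  Let \<open>G\<close> be the amalgam. If \<open>N\<close> is a virtual retract of \<open>G\<close>, say \<open>\<rho> : K \<rightarrow> N\<close>, then every \<open>k \<in> K\<close> acts on
  \<open>N\<close> like \<open>\<rho> k\<close>, because commutators of \<open>ker \<rho>\<close> and \<open>N\<close> lie in \<open>N \<inter> ker \<rho>\<close>; so the image of \<open>G\<close> in
  \<open>Out N\<close> is finite.

  Conversely let \<open>G \<rightarrow> Out N\<close> have finite image, so that \<open>L = N C\<^sub>G(N)\<close> has finite index, and let \<open>H\<close> be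
  finitely generated. Averaging a projection gives a free abelian \<open>R \<le> N\<close> normalized by \<open>H\<close> with
  \<open>R \<inter> H = 1\<close> such that \<open>HR \<inter> N\<close> has finite index in \<open>N\<close>; as \<open>H\<close> is a retract of \<open>HR\<close>, we may assume that
  \<open>H \<inter> N\<close> has finite index in \<open>N\<close>. To retract a subgroup of finite index onto \<open>H\<close> it suffices to find an action of
  \<open>G\<close> on a set \<open>S\<close> that commutes with a free right action of \<open>H\<close> with finitely many orbits, and a point
  \<open>x\<^sub>0\<close> such that \<open>h x\<^sub>0 = x\<^sub>0 h\<close> for all \<open>h \<in> H\<close>: then \<open>K\<close> is the stabilizer of \<open>x\<^sub>0 H\<close> and
  \<open>k x\<^sub>0 = x\<^sub>0 (\<rho> k)\<close>. Left and right multiplication on \<open>G\<close> itself has all these properties except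
  that there are infinitely many orbits. An action of \<open>G\<close> is a pair of actions of \<open>A\<close> and \<open>B\<close> that agree on
  \<open>N\<close>, so we take finitely many double cosets \<open>A g H\<close>, \<open>B g H\<close> containing all suffixes of words for
  the generators of \<open>H\<close>, collapse each of them to finitely many \<open>H\<close>-orbits without collapsing \<open>N\<close>-orbits,
  and match the \<open>(N, H)\<close>-orbits on the two sides. Their isomorphism type depends only on the coset in
  \<open>L \ G / H\<close>, and every type occurs equally often on both sides after repeating the collapsed double cosets.
\<close>

text \<open>A double coset P x H of a factor P usually meets several types L y H, yet the number of
  copies must be constant on it for P to act. Left multiplication by P permutes the (N, H)-orbits
  and carries types to types, so the orbit count of a type is constant along P x H. Repeating each
  orbit d / count times, with d a common multiple of all counts on both sides, yields exactly d
  orbits of every type on each side.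

  The collapse replaces x by the coset R(x) x, where R(x) lies in a free abelian normal subgroup of
  finite index in P and complements the stabilizer of x H up to finite index. The stabilizer has to
  normalize R(x) for both actions to survive, whence the averaging. When H contains a subgroup of
  finite index of N, normal in G, the stabilizer has finite index in its product with N; as R(x) is
  torsion free and meets the stabilizer trivially, it meets this product trivially too, and N-orbits
  are not collapsed.

  Equal types give isomorphic orbits because an element of L is one of N times one centralizing N,
  and left multiplication by the latter commutes with N and H.\<close>

section \<open>Subgroups of finite index\<close>

text \<open>Only finitely many cosets of \<open>K\<close> meet \<open>V\<close>; the set \<open>K\<close> need not be contained in \<open>V\<close>.\<close>

definition fidx :: "('a, 'm) monoid_scheme \<Rightarrow> 'a set \<Rightarrow> 'a set \<Rightarrow> bool" where
  "fidx G K V \<longleftrightarrow> finite ((\<lambda>v. K #>\<^bsub>G\<^esub> v) ` V)"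

definition commuting :: "('a, 'm) monoid_scheme \<Rightarrow> 'a set \<Rightarrow> bool" where
  "commuting G V \<longleftrightarrow> (\<forall>x\<in>V. \<forall>y\<in>V. x \<otimes>\<^bsub>G\<^esub> y = y \<otimes>\<^bsub>G\<^esub> x)"

definition torsion_free :: "('a, 'm) monoid_scheme \<Rightarrow> 'a set \<Rightarrow> bool" where
  "torsion_free G V \<longleftrightarrow> (\<forall>x\<in>V. \<forall>n::nat. n > 0 \<longrightarrow> x [^]\<^bsub>G\<^esub> n = \<one>\<^bsub>G\<^esub> \<longrightarrow> x = \<one>\<^bsub>G\<^esub>)"

definition powers :: "('a, 'm) monoid_scheme \<Rightarrow> nat \<Rightarrow> 'a set \<Rightarrow> 'a set" where
  "powers G n V = (\<lambda>x. x [^]\<^bsub>G\<^esub> n) ` V"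

definition adjoin :: "('a, 'm) monoid_scheme \<Rightarrow> 'a set \<Rightarrow> 'a \<Rightarrow> 'a set" where
  "adjoin G U x = {u \<otimes>\<^bsub>G\<^esub> x [^]\<^bsub>G\<^esub> i | u i. u \<in> U \<and> i \<in> (UNIV :: int set)}"

context group
begin

lemma inv_cancel_left [simp]:
  "x \<in> carrier G \<Longrightarrow> y \<in> carrier G \<Longrightarrow> inv x \<otimes> (x \<otimes> y) = y"
  "x \<in> carrier G \<Longrightarrow> y \<in> carrier G \<Longrightarrow> x \<otimes> (inv x \<otimes> y) = y"
  by (simp_all add: m_assoc [symmetric])

lemmas group_normalize = m_assoc inv_mult_group

lemma rcoset_eq_iff:
  assumes "subgroup K G" "x \<in> carrier G" "y \<in> carrier G"
  shows "K #> x = K #> y \<longleftrightarrow> x \<otimes> inv y \<in> K"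
proof
  assume "K #> x = K #> y"
  then have "x \<in> K #> y" using assms rcos_self by blast
  then obtain k where "k \<in> K" "x = k \<otimes> y" by (auto simp: r_coset_def)
  then show "x \<otimes> inv y \<in> K"
    using assms subgroup.mem_carrier[OF assms(1)] by (simp add: m_assoc)
next
  assume a: "x \<otimes> inv y \<in> K"
  then have "x \<in> K #> y"
    using assms unfolding r_coset_def by (auto intro!: bexI[of _ "x \<otimes> inv y"] simp: m_assoc)
  then show "K #> x = K #> y"
    using assms repr_independence by metis
qed

text \<open>When equal values of \<open>\<phi>\<close> force equal cosets, the coset is a function
  of the value, so finitely many values leave finitely many cosets. Later invariants are tuples of
  cosets, orbits, and values of a homomorphism.\<close>

lemma fidx_by_map:
  assumes "subgroup K G" "V \<subseteq> carrier G" "finite (\<phi> ` V)"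
    and "\<And>x y. \<lbrakk>x \<in> V; y \<in> V; \<phi> x = \<phi> y\<rbrakk> \<Longrightarrow> x \<otimes> inv y \<in> K"
  shows "fidx G K V"
proof -
  have "\<exists>f. \<forall>x\<in>V. K #> x = f (\<phi> x)"
  proof (rule exI, rule ballI)
    fix x assume x: "x \<in> V"
    let ?y = "SOME y. y \<in> V \<and> \<phi> y = \<phi> x"
    have "?y \<in> V \<and> \<phi> ?y = \<phi> x" using x by (metis (mono_tags, lifting) someI_ex)
    then show "K #> x = (\<lambda>c. K #> (SOME y. y \<in> V \<and> \<phi> y = c)) (\<phi> x)"
      using x assms(2) assms(4)[of x ?y] rcoset_eq_iff[OF assms(1), of x ?y] by auto
  qed
  then obtain f where "\<forall>x\<in>V. K #> x = f (\<phi> x)" ..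
  then have "(\<lambda>v. K #> v) ` V \<subseteq> f ` \<phi> ` V" by auto
  then show ?thesis unfolding fidx_def using assms(3) finite_surj by blast
qed

lemma fidx_subset:
  assumes "fidx G K V" "U \<subseteq> V"
  shows "fidx G K U"
  using assms unfolding fidx_def by (meson finite_subset image_mono)

lemma fidx_inter_restrict:
  assumes "subgroup K G" "subgroup U G" "U \<subseteq> V" "fidx G K V"
  shows "fidx G (K \<inter> U) U"
proof (rule fidx_by_map[where \<phi> = "\<lambda>v. K #> v"])
  show "subgroup (K \<inter> U) G" by (rule subgroups_Inter_pair[OF assms(1,2)])
  show "finite ((\<lambda>v. K #> v) ` U)" using fidx_subset[OF assms(4,3)] by (simp add: fidx_def)
  show "U \<subseteq> carrier G" using assms(2) subgroup.subset by blast
  fix x y assume "x \<in> U" "y \<in> U" "K #> x = K #> y"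
  then show "x \<otimes> inv y \<in> K \<inter> U"
    using assms rcoset_eq_iff[OF assms(1), of x y] subgroup.mem_carrier[OF assms(2)]
    by (auto simp: subgroup.m_closed subgroup.m_inv_closed)
qed

lemma fidx_transversal:
  assumes "subgroup K G" "V \<subseteq> carrier G" "fidx G K V"
  shows "\<exists>F. finite F \<and> F \<subseteq> V \<and> (\<forall>v\<in>V. \<exists>f\<in>F. v \<otimes> inv f \<in> K)"
proof -
  let ?s = "\<lambda>c. SOME y. y \<in> V \<and> K #> y = c"
  have s: "?s (K #> v) \<in> V \<and> K #> ?s (K #> v) = K #> v" if "v \<in> V" for v
    using that by (metis (mono_tags, lifting) someI_ex)
  have "finite (?s ` (\<lambda>v. K #> v) ` V)" using assms(3) unfolding fidx_def by (rule finite_imageI)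
  moreover have "?s ` (\<lambda>v. K #> v) ` V \<subseteq> V" using s by auto
  moreover have "\<forall>v\<in>V. \<exists>f\<in>?s ` (\<lambda>v. K #> v) ` V. v \<otimes> inv f \<in> K"
  proof
    fix v assume v: "v \<in> V"
    have "v \<otimes> inv (?s (K #> v)) \<in> K"
      using s[OF v] v assms(2) rcoset_eq_iff[OF assms(1), of v "?s (K #> v)"] by auto
    then show "\<exists>f\<in>?s ` (\<lambda>v. K #> v) ` V. v \<otimes> inv f \<in> K" using v by blast
  qed
  ultimately show ?thesis by blast
qed

lemma fidx_by_transversal:
  assumes "subgroup K G" "V \<subseteq> carrier G" "finite F" "F \<subseteq> carrier G"
    and "\<And>v. v \<in> V \<Longrightarrow> \<exists>f\<in>F. v \<otimes> inv f \<in> K"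
  shows "fidx G K V"
proof -
  have "(\<lambda>v. K #> v) ` V \<subseteq> (\<lambda>v. K #> v) ` F"
  proof
    fix c assume "c \<in> (\<lambda>v. K #> v) ` V"
    then obtain v where v: "v \<in> V" "c = K #> v" by blast
    then obtain f where f: "f \<in> F" "v \<otimes> inv f \<in> K" using assms(5) by blast
    then have "K #> v = K #> f" using v assms rcoset_eq_iff[OF assms(1), of v f] by blast
    then show "c \<in> (\<lambda>v. K #> v) ` F" using v f by blast
  qed
  then show ?thesis unfolding fidx_def using assms(3) by (meson finite_imageI finite_subset)
qed

lemma fidx_trans:
  assumes "subgroup K G" "subgroup U G" "V \<subseteq> carrier G" "fidx G K U" "fidx G U V"
  shows "fidx G K V"
proof -
  obtain F where F: "finite F" "F \<subseteq> V" "\<forall>v\<in>V. \<exists>f\<in>F. v \<otimes> inv f \<in> U"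
    using fidx_transversal[OF assms(2,3,5)] by blast
  obtain E where E: "finite E" "E \<subseteq> U" "\<forall>v\<in>U. \<exists>f\<in>E. v \<otimes> inv f \<in> K"
    using fidx_transversal[OF assms(1) subgroup.subset[OF assms(2)] assms(4)] by blast
  have Ec: "E \<subseteq> carrier G" using E subgroup.subset[OF assms(2)] by blast
  have Fc: "F \<subseteq> carrier G" using F assms(3) by blast
  show ?thesis
  proof (rule fidx_by_transversal[where F = "(\<lambda>(e,f). e \<otimes> f) ` (E \<times> F)"])
    show "(\<lambda>(e,f). e \<otimes> f) ` (E \<times> F) \<subseteq> carrier G" using Ec Fc by auto
    fix v assume v: "v \<in> V"
    obtain f where f: "f \<in> F" "v \<otimes> inv f \<in> U" using F v by blast
    obtain e where e: "e \<in> E" "v \<otimes> inv f \<otimes> inv e \<in> K" using E f by blast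
    have "v \<otimes> inv (e \<otimes> f) = v \<otimes> inv f \<otimes> inv e"
      using v f e Ec Fc assms(3) by (simp add: group_normalize subset_iff)
    then show "\<exists>x\<in>(\<lambda>(e,f). e \<otimes> f) ` (E \<times> F). v \<otimes> inv x \<in> K" using e f by force
  qed (use assms E F in auto)
qed

lemma finite_index_subgroup_iff:
  "finite_index_subgroup K G \<longleftrightarrow> subgroup K G \<and> fidx G K (carrier G)"
proof -
  have "rcosets K = (\<lambda>v. K #> v) ` carrier G" unfolding RCOSETS_def by auto
  then show ?thesis unfolding finite_index_subgroup_def fidx_def by simp
qed

text \<open>\<open>L\<close> is the intersection of all conjugates of \<open>K\<close>. The coset of
  \<open>x\<close> modulo \<open>L\<close> is determined by the cosets \<open>K f x\<close> with
  \<open>f\<close> in a finite transversal, because every \<open>g\<close> is an element of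
  \<open>K\<close> times such an \<open>f\<close>; there are finitely many such tuples.\<close>

lemma normal_core:
  assumes "subgroup K G" "fidx G K (carrier G)"
  shows "\<exists>L. L \<lhd> G \<and> L \<subseteq> K \<and> fidx G L (carrier G)"
proof -
  define L where "L = {x \<in> carrier G. \<forall>g\<in>carrier G. g \<otimes> x \<otimes> inv g \<in> K}"
  have sub: "subgroup L G"
  proof (rule subgroupI)
    show "L \<subseteq> carrier G" by (auto simp: L_def)
    show "L \<noteq> {}" using subgroup.one_closed[OF assms(1)] by (auto simp: L_def intro!: exI[of _ \<one>])
    fix x assume x: "x \<in> L"
    show "inv x \<in> L"
      unfolding L_def
    proof (safe)
      show "inv x \<in> carrier G" using x by (simp add: L_def)
      fix g assume g: "g \<in> carrier G"
      have "inv (g \<otimes> x \<otimes> inv g) \<in> K" using x g subgroup.m_inv_closed[OF assms(1)] by (auto simp: L_def)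
      then show "g \<otimes> inv x \<otimes> inv g \<in> K" using x g by (simp add: L_def group_normalize)
    qed
  next
    fix x y assume xy: "x \<in> L" "y \<in> L"
    show "x \<otimes> y \<in> L"
      unfolding L_def
    proof (safe)
      show "x \<otimes> y \<in> carrier G" using xy by (simp add: L_def)
      fix g assume g: "g \<in> carrier G"
      have "(g \<otimes> x \<otimes> inv g) \<otimes> (g \<otimes> y \<otimes> inv g) \<in> K"
        using xy g subgroup.m_closed[OF assms(1)] by (auto simp: L_def)
      then show "g \<otimes> (x \<otimes> y) \<otimes> inv g \<in> K" using xy g by (simp add: L_def group_normalize)
    qed
  qed
  have norm: "L \<lhd> G"
  proof (rule normal_invI[OF sub])
    fix x h assume xh: "x \<in> carrier G" "h \<in> L"
    show "x \<otimes> h \<otimes> inv x \<in> L" unfolding L_def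
    proof safe
      show "x \<otimes> h \<otimes> inv x \<in> carrier G" using xh by (simp add: L_def)
      fix g assume g: "g \<in> carrier G"
      have "(g \<otimes> x) \<otimes> h \<otimes> inv (g \<otimes> x) \<in> K" using xh g by (auto simp: L_def)
      then show "g \<otimes> (x \<otimes> h \<otimes> inv x) \<otimes> inv g \<in> K" using xh g by (simp add: L_def group_normalize)
    qed
  qed
  obtain F where F: "finite F" "F \<subseteq> carrier G" "\<forall>v\<in>carrier G. \<exists>f\<in>F. v \<otimes> inv f \<in> K"
    using fidx_transversal[OF assms(1) _ assms(2)] by blast
  have fin: "fidx G L (carrier G)"
  proof (rule fidx_by_map[OF sub, where \<phi> = "\<lambda>x. (\<lambda>f\<in>F. K #> (f \<otimes> x))"])
    show "finite ((\<lambda>x. \<lambda>f\<in>F. K #> (f \<otimes> x)) ` carrier G)"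
      by (rule finite_subset[of _ "PiE F (\<lambda>_. (\<lambda>v. K #> v) ` carrier G)"])
        (use assms F in \<open>auto simp: fidx_def intro!: finite_PiE\<close>)
  next
    fix x y assume xy: "x \<in> carrier G" "y \<in> carrier G"
      "(\<lambda>f\<in>F. K #> (f \<otimes> x)) = (\<lambda>f\<in>F. K #> (f \<otimes> y))"
    show "x \<otimes> inv y \<in> L" unfolding L_def
    proof safe
      show "x \<otimes> inv y \<in> carrier G" using xy by simp
      fix g assume g: "g \<in> carrier G"
      obtain f where f: "f \<in> F" "g \<otimes> inv f \<in> K" using F g by blast
      have fc: "f \<in> carrier G" using f F by auto
      have "K #> (f \<otimes> x) = K #> (f \<otimes> y)" using fun_cong[OF xy(3), of f] f by simp
      then have 1: "f \<otimes> x \<otimes> inv (f \<otimes> y) \<in> K"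
        using rcoset_eq_iff[OF assms(1), of "f \<otimes> x" "f \<otimes> y"] xy fc by simp
      have 2: "inv (g \<otimes> inv f) \<in> K" using f subgroup.m_inv_closed[OF assms(1)] by blast
      have "(g \<otimes> inv f) \<otimes> (f \<otimes> x \<otimes> inv (f \<otimes> y)) \<otimes> inv (g \<otimes> inv f) \<in> K"
        using 1 2 f subgroup.m_closed[OF assms(1)] by blast
      then show "g \<otimes> (x \<otimes> inv y) \<otimes> inv g \<in> K" using xy g fc by (simp add: group_normalize)
    qed
  qed auto
  have "L \<subseteq> K"
  proof
    fix x assume "x \<in> L"
    then show "x \<in> K" unfolding L_def by (auto dest!: bspec[of _ _ \<one>])
  qed
  then show ?thesis using norm fin by blast
qed

lemma subgroup_nat_pow_closed:
  assumes "subgroup H G" "h \<in> H" shows "h [^] (k :: nat) \<in> H"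
  by (induction k) (use assms subgroup.one_closed subgroup.m_closed in fastforce)+

text \<open>Among \<open>c + 1\<close> consecutive powers of \<open>v\<close> two share one of the
  \<open>c\<close> cosets of \<open>K\<close>, so some \<open>v^i\<close> with
  \<open>0 < i \<le> c\<close> lies in \<open>K\<close>. The factorial of \<open>c\<close> is a
  multiple of all such \<open>i\<close>, hence one exponent serves all of \<open>V\<close>.\<close>

lemma fidx_common_power:
  assumes "subgroup K G" "subgroup V G" "fidx G K V"
  shows "\<exists>n>0. \<forall>v\<in>V. v [^] (n::nat) \<in> K"
proof -
  define c where "c = card ((\<lambda>v. K #> v) ` V)"
  have fin: "finite ((\<lambda>v. K #> v) ` V)" using assms(3) by (simp add: fidx_def)
  have "v [^] (fact c :: nat) \<in> K" if v: "v \<in> V" for v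
  proof -
    have vc: "v \<in> carrier G" using v subgroup.mem_carrier[OF assms(2)] by auto
    have pow: "v [^] (i::nat) \<in> V" for i
      by (induction i) (use v subgroup.one_closed[OF assms(2)] subgroup.m_closed[OF assms(2)] in auto)
    have "\<not> inj_on (\<lambda>i::nat. K #> (v [^] i)) {..c}"
    proof (rule pigeonhole)
      have "(\<lambda>i. K #> v [^] i) ` {..c} \<subseteq> (\<lambda>v. K #> v) ` V" using pow by auto
      then have "card ((\<lambda>i. K #> v [^] i) ` {..c}) \<le> c" unfolding c_def by (rule card_mono[OF fin])
      then show "card ((\<lambda>i. K #> v [^] i) ` {..c}) < card {..c}" by simp
    qed
    then obtain i j where ij: "i < j" "j \<le> c" "K #> (v [^] i) = K #> (v [^] j)"
      unfolding inj_on_def by (metis (no_types, lifting) atMost_iff linorder_neqE_nat)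
    have "v [^] j \<otimes> inv (v [^] i) \<in> K"
      using ij rcoset_eq_iff[OF assms(1), of "v [^] j" "v [^] i"] vc by simp
    moreover have "v [^] j = v [^] (j - i) \<otimes> v [^] i" using ij vc by (simp add: nat_pow_mult)
    ultimately have "v [^] (j - i) \<in> K" using vc by (simp add: m_assoc)
    moreover have "j - i dvd fact c" using ij by (intro dvd_fact) auto
    then obtain q where "fact c = (j - i) * q" by (metis dvdE)
    ultimately show ?thesis
      using vc nat_pow_pow[OF vc, of "j - i" q]
      by (metis assms(1) subgroup_nat_pow_closed)
  qed
  then show ?thesis using fact_gt_zero by blast
qed

section \<open>Finitely generated abelian subgroups\<close>

text \<open>This form of induction lets a set absorb generators and their inverses on the right, one
  at a time, as Schreier's argument requires.\<close>

lemma generate_right_induct: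
  assumes "T \<subseteq> carrier G" "Y \<subseteq> carrier G"
    and step: "\<And>y t. \<lbrakk>y \<in> Y; t \<in> T\<rbrakk> \<Longrightarrow> y \<otimes> t \<in> Y \<and> y \<otimes> inv t \<in> Y"
    and "v \<in> generate G T" "y \<in> Y"
  shows "y \<otimes> v \<in> Y"
  using assms(4,5)
proof (induction arbitrary: y rule: generate.induct)
  case one
  then show ?case using assms(2) by (simp add: subset_iff)
next
  case (eng h1 h2)
  then have "h1 \<in> carrier G" "h2 \<in> carrier G" using generate_in_carrier[OF assms(1)] by auto
  moreover have "y \<in> carrier G" using eng assms(2) by auto
  moreover have "(y \<otimes> h1) \<otimes> h2 \<in> Y" using eng by blast
  ultimately show ?case by (simp add: m_assoc)
qed (use step in auto)

text \<open>Schreier's argument: the products of generators with transversal elements that lie in the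
  subgroup generate it.\<close>

lemma fg_subgroup_fidx:
  assumes U: "subgroup U G" and V: "fg_subgroup V G" and "U \<subseteq> V" "fidx G U V"
  shows "fg_subgroup U G"
proof -
  obtain T where T: "finite T" "T \<subseteq> carrier G" "generate G T = V"
    using V unfolding fg_subgroup_def by blast
  have Vs: "subgroup V G" using generate_is_subgroup[OF T(2)] T by simp
  note Vc = subgroup.subset[OF Vs] and Uc = subgroup.subset[OF U]
  obtain F where F: "finite F" "F \<subseteq> V" "\<forall>v\<in>V. \<exists>f\<in>F. v \<otimes> inv f \<in> U"
    using fidx_transversal[OF U Vc assms(4)] by blast
  define E where "E = insert \<one> F"
  define T' where "T' = T \<union> m_inv G ` T"
  \<comment> \<open>The transversal is not assumed to contain \<open>\<one>\<close>, so
    \<open>\<one>\<close> is added to it. Elements of \<open>E\<close> lying in \<open>U\<close>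
    must be generators too: once \<open>V = W E\<close> is known, an element \<open>u = w f\<close>
    of \<open>U\<close> leaves \<open>f\<close> in \<open>U\<close>, and this \<open>f\<close> has
    to be in \<open>W\<close>.\<close>
  define Xs where "Xs = ((\<lambda>(f, t, f'). f \<otimes> t \<otimes> inv f') ` (E \<times> T' \<times> E) \<union> E) \<inter> U"
  define W where "W = generate G Xs"
  define Y where "Y = {w \<otimes> f | w f. w \<in> W \<and> f \<in> E}"
  have finX: "finite Xs" unfolding Xs_def E_def T'_def using F T by auto
  have XU: "Xs \<subseteq> U" by (auto simp: Xs_def)
  have Xc: "Xs \<subseteq> carrier G" using XU Uc by blast
  have Ws: "subgroup W G" unfolding W_def by (rule generate_is_subgroup[OF Xc])
  have WU: "W \<subseteq> U" unfolding W_def by (rule generate_subgroup_incl[OF XU U])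
  have EV: "E \<subseteq> V" unfolding E_def using F subgroup.one_closed[OF Vs] by auto
  have TV: "T \<subseteq> V" using T generate.incl[of _ T G] by auto
  have T'V: "T' \<subseteq> V" unfolding T'_def using TV subgroup.m_inv_closed[OF Vs] by auto
  have Ec: "E \<subseteq> carrier G" and T'c: "T' \<subseteq> carrier G" using EV T'V Vc by auto
  have Wc: "W \<subseteq> carrier G" using WU Uc by blast
  have step: "y \<otimes> t \<in> Y" if y: "y \<in> Y" and t: "t \<in> T'" for y t
  proof -
    obtain w f where wf: "w \<in> W" "f \<in> E" "y = w \<otimes> f" using y by (auto simp: Y_def)
    have "f \<otimes> t \<in> V" using wf t EV T'V subgroup.m_closed[OF Vs] by blast
    then obtain f' where f': "f' \<in> F" "f \<otimes> t \<otimes> inv f' \<in> U" using F by blast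
    have f'E: "f' \<in> E" using f' by (simp add: E_def)
    have "f \<otimes> t \<otimes> inv f' \<in> Xs" unfolding Xs_def using f' f'E wf t by force
    then have 1: "w \<otimes> (f \<otimes> t \<otimes> inv f') \<in> W"
      using subgroup.m_closed[OF Ws] wf generate.incl unfolding W_def by metis
    have "y \<otimes> t = w \<otimes> (f \<otimes> t \<otimes> inv f') \<otimes> f'"
    proof -
      have "w \<in> carrier G" "f \<in> carrier G" "t \<in> carrier G" "f' \<in> carrier G"
        using wf t f'E Wc Ec T'c by auto
      then show ?thesis using wf(3) by (simp add: group_normalize)
    qed
    then show ?thesis using 1 f'E by (auto simp: Y_def)
  qed
  have Yc: "Y \<subseteq> carrier G" using Wc Ec by (auto simp: Y_def)
  have "\<one> = \<one> \<otimes> \<one>" by simp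
  then have oneY: "\<one> \<in> Y" using subgroup.one_closed[OF Ws] unfolding Y_def E_def by blast
  have VY: "v \<in> Y" if "v \<in> V" for v
  proof -
    have "\<one> \<otimes> v \<in> Y"
      by (rule generate_right_induct[OF T(2) Yc]) (use step that T oneY in \<open>auto simp: T'_def\<close>)
    then show ?thesis using that Vc by auto
  qed
  have "U \<subseteq> W"
  proof
    fix u assume u: "u \<in> U"
    then obtain w f where wf: "w \<in> W" "f \<in> E" "u = w \<otimes> f" using VY assms(3) by (force simp: Y_def)
    then have "f = inv w \<otimes> u" using Wc Ec by (auto simp: subset_iff)
    moreover have "inv w \<otimes> u \<in> U" using wf u WU subgroup.m_inv_closed[OF U] subgroup.m_closed[OF U] by blast
    ultimately have "f \<in> U" by simp
    then have "f \<in> Xs" using wf by (auto simp: Xs_def)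
    then show "u \<in> W" using wf subgroup.m_closed[OF Ws] generate.incl unfolding W_def by metis
  qed
  then have "generate G Xs = U" using WU W_def by auto
  then show ?thesis unfolding fg_subgroup_def using finX Xc by blast
qed

lemma fg_subgroup_fidx_extend:
  assumes V: "subgroup V G" and U: "fg_subgroup U G" and "U \<subseteq> V" "fidx G U V"
  shows "fg_subgroup V G"
proof -
  obtain T where T: "finite T" "T \<subseteq> carrier G" "generate G T = U"
    using U unfolding fg_subgroup_def by blast
  have Us: "subgroup U G" using generate_is_subgroup[OF T(2)] T by simp
  obtain F where F: "finite F" "F \<subseteq> V" "\<forall>v\<in>V. \<exists>f\<in>F. v \<otimes> inv f \<in> U"
    using fidx_transversal[OF Us subgroup.subset[OF V] assms(4)] by blast
  have Fc: "F \<subseteq> carrier G" using F subgroup.subset[OF V] by blast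
  have Tc: "T \<union> F \<subseteq> V" using T F assms(3) generate.incl[of _ T G] by auto
  have "V \<subseteq> generate G (T \<union> F)"
  proof
    fix v assume v: "v \<in> V"
    obtain f where f: "f \<in> F" "v \<otimes> inv f \<in> U" using F v by blast
    have "v \<otimes> inv f \<in> generate G (T \<union> F)" using f T mono_generate[of T "T \<union> F"] by auto
    moreover have "f \<in> generate G (T \<union> F)" using f by (intro generate.incl) auto
    ultimately have "(v \<otimes> inv f) \<otimes> f \<in> generate G (T \<union> F)" by (rule generate.eng)
    then show "v \<in> generate G (T \<union> F)"
      using v f Fc subgroup.mem_carrier[OF V] by (auto simp: m_assoc subset_iff)
  qed
  then have "generate G (T \<union> F) = V" using generate_subgroup_incl[OF Tc V] by auto
  then show ?thesis unfolding fg_subgroup_def using T F Fc by (intro exI[of _ "T \<union> F"]) auto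
qed

section \<open>Abelian subgroups by adjoining one generator at a time\<close>

lemma commutingD: "commuting G V \<Longrightarrow> x \<in> V \<Longrightarrow> y \<in> V \<Longrightarrow> x \<otimes> y = y \<otimes> x"
  by (simp add: commuting_def)

lemma commuting_subset: "commuting G V \<Longrightarrow> U \<subseteq> V \<Longrightarrow> commuting G U"
  by (auto simp: commuting_def)

lemma torsion_free_subset: "torsion_free G V \<Longrightarrow> U \<subseteq> V \<Longrightarrow> torsion_free G U"
  by (auto simp: torsion_free_def)

lemma adjoin_mult:
  assumes "subgroup V G" "commuting G V" "u \<in> V" "u' \<in> V" "x \<in> V"
  shows "(u \<otimes> x [^] (i::int)) \<otimes> (u' \<otimes> x [^] (j::int)) = (u \<otimes> u') \<otimes> x [^] (i + j)"
proof -
  have c: "u \<in> carrier G" "u' \<in> carrier G" "x \<in> carrier G"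
    using assms subgroup.mem_carrier[OF assms(1)] by auto
  have "x [^] i \<otimes> u' = u' \<otimes> x [^] i"
    using commutingD[OF assms(2)] subgroup_int_pow_closed[OF assms(1,5)] assms by blast
  then have "x [^] i \<otimes> (u' \<otimes> x [^] j) = u' \<otimes> (x [^] i \<otimes> x [^] j)"
    using c by (simp add: m_assoc [symmetric])
  then show ?thesis using c by (simp add: m_assoc int_pow_mult)
qed

lemma adjoin_subgroup:
  assumes "subgroup V G" "commuting G V" "subgroup U G" "U \<subseteq> V" "x \<in> V"
  shows "subgroup (adjoin G U x) G" "U \<subseteq> adjoin G U x" "x \<in> adjoin G U x" "adjoin G U x \<subseteq> V"
proof -
  have c: "V \<subseteq> carrier G" using assms subgroup.subset by auto
  show V: "adjoin G U x \<subseteq> V"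
    using assms subgroup_int_pow_closed[OF assms(1,5)] subgroup.m_closed[OF assms(1)] by (auto simp: adjoin_def)
  show U: "U \<subseteq> adjoin G U x"
  proof
    fix u assume "u \<in> U"
    moreover have "u = u \<otimes> x [^] (0::int)" using \<open>u \<in> U\<close> assms c by auto
    ultimately show "u \<in> adjoin G U x" unfolding adjoin_def by blast
  qed
  have "x = \<one> \<otimes> x [^] (1::int)" using assms c by auto
  then show "x \<in> adjoin G U x" using subgroup.one_closed[OF assms(3)] unfolding adjoin_def by blast
  show "subgroup (adjoin G U x) G"
  proof (rule subgroupI)
    show "adjoin G U x \<subseteq> carrier G" using V c by blast
    show "adjoin G U x \<noteq> {}" using U subgroup.one_closed[OF assms(3)] by blast
    fix a b assume a: "a \<in> adjoin G U x" and b: "b \<in> adjoin G U x"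
    obtain u i where u: "u \<in> U" "a = u \<otimes> x [^] (i::int)" using a by (auto simp: adjoin_def)
    obtain u' j where u': "u' \<in> U" "b = u' \<otimes> x [^] (j::int)" using b by (auto simp: adjoin_def)
    have "a \<otimes> b = (u \<otimes> u') \<otimes> x [^] (i + j)"
      using adjoin_mult[OF assms(1,2) _ _ assms(5)] u u' assms(4) by blast
    then show "a \<otimes> b \<in> adjoin G U x"
      using u u' subgroup.m_closed[OF assms(3)] unfolding adjoin_def by blast
  next
    fix a assume a: "a \<in> adjoin G U x"
    obtain u i where u: "u \<in> U" "a = u \<otimes> x [^] (i::int)" using a by (auto simp: adjoin_def)
    have ui: "inv u \<in> U" using u subgroup.m_inv_closed[OF assms(3)] by blast
    have "a \<otimes> (inv u \<otimes> x [^] (- i)) = (u \<otimes> inv u) \<otimes> x [^] (i + - i)"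
      unfolding u(2) by (rule adjoin_mult[OF assms(1,2) _ _ assms(5)]) (use u ui assms(4) in auto)
    then have "a \<otimes> (inv u \<otimes> x [^] (- i)) = \<one>" using u assms c by (auto simp: subset_iff)
    moreover have ac: "a \<in> carrier G" "inv u \<otimes> x [^] (- i) \<in> carrier G" using a V c ui assms(4,5) by auto
    ultimately have "(inv u \<otimes> x [^] (- i)) \<otimes> a = \<one>" using inv_comm by blast
    then have "inv a = inv u \<otimes> x [^] (- i)" using inv_equality ac by blast
    then show "inv a \<in> adjoin G U x" using ui unfolding adjoin_def by blast
  qed
qed

text \<open>Adjoining the generators of \<open>V\<close> one by one to \<open>U0\<close> exhausts
  \<open>V\<close>, so a property that survives each adjunction reaches \<open>V\<close>. This takes
  the place of the structure theorem for finitely generated abelian groups.\<close>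

lemma abelian_fg_induct:
  assumes V: "subgroup V G" "commuting G V" "fg_subgroup V G"
    and U0: "subgroup U0 G" "U0 \<subseteq> V" and "Q U0"
    and step: "\<And>U x. \<lbrakk>subgroup U G; U0 \<subseteq> U; U \<subseteq> V; x \<in> V; Q U\<rbrakk> \<Longrightarrow> Q (adjoin G U x)"
  shows "Q V"
proof -
  obtain T where T: "finite T" "T \<subseteq> carrier G" "generate G T = V"
    using V unfolding fg_subgroup_def by blast
  have TV: "T \<subseteq> V" using T generate.incl[of _ T G] by auto
  have ex: "\<exists>U. subgroup U G \<and> U0 \<subseteq> U \<and> U \<subseteq> V \<and> T' \<subseteq> U \<and> Q U" if "finite T'" "T' \<subseteq> V" for T'
    using that
  proof (induction T')
    case empty
    then show ?case using U0 assms(6) by blast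
  next
    case (insert x T')
    then obtain U where U: "subgroup U G" "U0 \<subseteq> U" "U \<subseteq> V" "T' \<subseteq> U" "Q U" by auto
    have x: "x \<in> V" using insert by auto
    note a = adjoin_subgroup[OF V(1,2) U(1,3) x]
    have "U0 \<subseteq> adjoin G U x" "insert x T' \<subseteq> adjoin G U x" using a(2,3) U(2,4) by auto
    then show ?case using a(1,4) step[OF U(1,2,3) x U(5)] by blast
  qed
  from ex[OF T(1) TV] obtain U where U: "subgroup U G" "U \<subseteq> V" "T \<subseteq> U" "Q U" by blast
  then have "U = V" using generate_subgroup_incl[OF U(3,1)] T by auto
  then show ?thesis using U by simp
qed

lemma trivial_fg: "fg_subgroup {\<one>} G"
  unfolding fg_subgroup_def using generate_empty by (intro exI[of _ "{}"]) auto

text \<open>The exponents of \<open>x\<close> occurring in \<open>W\<close> form a subgroup of the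
  integers. If it is generated by \<open>d > 0\<close>, then \<open>W \<inter> U\<close> and one
  element with exponent \<open>d\<close> generate \<open>W\<close>; if it is zero, \<open>W\<close>
  already lies in \<open>U\<close>.\<close>

lemma abelian_subgroup_fg:
  assumes V: "subgroup V G" "commuting G V" "fg_subgroup V G" and W: "subgroup W G" "W \<subseteq> V"
  shows "fg_subgroup W G"
proof -
  have "\<forall>W. subgroup W G \<and> W \<subseteq> V \<longrightarrow> fg_subgroup W G"
  proof (rule abelian_fg_induct[where Q = "\<lambda>U. \<forall>W. subgroup W G \<and> W \<subseteq> U \<longrightarrow> fg_subgroup W G", OF V triv_subgroup])
    show "{\<one>} \<subseteq> V" using subgroup.one_closed[OF V(1)] by simp
    show "\<forall>W. subgroup W G \<and> W \<subseteq> {\<one>} \<longrightarrow> fg_subgroup W G"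
    proof (intro allI impI, elim conjE)
      fix W assume "subgroup W G" "W \<subseteq> {\<one>}"
      then have "W = {\<one>}" using subgroup.one_closed[of W G] by auto
      then show "fg_subgroup W G" using trivial_fg by simp
    qed
    fix U x assume U: "subgroup U G" "U \<subseteq> V" and x: "x \<in> V"
      and IH: "\<forall>W. subgroup W G \<and> W \<subseteq> U \<longrightarrow> fg_subgroup W G"
    have Vc: "V \<subseteq> carrier G" using subgroup.subset[OF V(1)] .
    show "\<forall>W. subgroup W G \<and> W \<subseteq> adjoin G U x \<longrightarrow> fg_subgroup W G"
    proof (intro allI impI, elim conjE)
      fix W assume W: "subgroup W G" "W \<subseteq> adjoin G U x"
      \<comment> \<open>Exponents are not unique when a power of \<open>x\<close> lies in
        \<open>U\<close>, so \<open>I\<close> collects every exponent that some representation of an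
        element of \<open>W\<close> uses.\<close>
      define I where "I = {i::int. \<exists>u\<in>U. u \<otimes> x [^] i \<in> W}"
      show "fg_subgroup W G"
      proof (cases "\<exists>i\<in>I. i \<noteq> 0")
        case False
        have "W \<subseteq> U"
        proof
          fix w assume w: "w \<in> W"
          then obtain u i where u: "u \<in> U" "w = u \<otimes> x [^] (i::int)" using W by (auto simp: adjoin_def)
          then have "i = 0" using False w by (auto simp: I_def)
          then show "w \<in> U" using u U Vc by (auto simp: subset_iff)
        qed
        then show ?thesis using IH W by blast
      next
        case True
        then obtain i where i: "i \<in> I" "i \<noteq> 0" by blast
        have neg: "- i \<in> I" if i: "i \<in> I" for i
        proof -
          obtain u where u: "u \<in> U" "u \<otimes> x [^] i \<in> W" using i by (auto simp: I_def)
          have uc: "u \<in> V" "u \<in> carrier G" "x \<in> carrier G" using u U Vc x by auto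
          have "inv u \<otimes> x [^] (- i) = inv (u \<otimes> x [^] i)"
            using uc commutingD[OF V(2), of "inv u" "inv (x [^] i)"]
              subgroup.m_inv_closed[OF V(1)] subgroup_int_pow_closed[OF V(1) x]
            by (simp add: inv_mult_group int_pow_neg)
          then show ?thesis using u subgroup.m_inv_closed[OF W(1)] subgroup.m_inv_closed[OF U(1)]
            unfolding I_def by (metis (mono_tags, lifting) mem_Collect_eq)
        qed
        have ex: "\<exists>n::nat. n > 0 \<and> int n \<in> I"
          using i neg[OF i(1)] by (cases "i > 0") (auto intro: exI[of _ "nat i"] exI[of _ "nat (- i)"])
        define d where "d = (LEAST n::nat. n > 0 \<and> int n \<in> I)"
        have d: "d > 0" "int d \<in> I" and dmin: "\<And>n. n > 0 \<Longrightarrow> int n \<in> I \<Longrightarrow> d \<le> n"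
          using LeastI_ex[OF ex] Least_le[of "\<lambda>n. n > 0 \<and> int n \<in> I"] unfolding d_def by auto
        obtain u0 where u0: "u0 \<in> U" "u0 \<otimes> x [^] (int d) \<in> W" using d by (auto simp: I_def)
        define w0 where "w0 = u0 \<otimes> x [^] (int d)"
        have w0: "w0 \<in> W" "w0 \<in> carrier G" using u0 subgroup.mem_carrier[OF W(1)] by (auto simp: w0_def)
        have "subgroup (W \<inter> U) G" by (rule subgroups_Inter_pair[OF W(1) U(1)])
        then obtain T where T: "finite T" "T \<subseteq> carrier G" "generate G T = W \<inter> U"
          using IH unfolding fg_subgroup_def by blast
        have TW: "insert w0 T \<subseteq> W" using T w0 generate.incl[of _ T G] by auto
        have Tc: "insert w0 T \<subseteq> carrier G" using T w0 by auto
        note gs = generate_is_subgroup[OF Tc]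
        have "W \<subseteq> generate G (insert w0 T)"
        proof
          fix w assume w: "w \<in> W"
          then obtain u i where u: "u \<in> U" "w = u \<otimes> x [^] (i::int)" using W by (auto simp: adjoin_def)
          define q where "q = i div int d"
          have uc: "u \<in> carrier G" "u0 \<in> carrier G" "x \<in> carrier G" "u \<in> V" "u0 \<in> V"
            using u u0 U Vc x by auto
          have u0q: "u0 [^] (- q) \<in> U" by (rule subgroup_int_pow_closed[OF U(1) u0(1)])
          have "w0 [^] (- q) = u0 [^] (- q) \<otimes> x [^] (int d * - q)"
            unfolding w0_def using uc commutingD[OF V(2), of u0 "x [^] int d"] subgroup_int_pow_closed[OF V(1) x]
            by (subst int_pow_mult_distrib) (auto simp: int_pow_pow)
          then have "w \<otimes> w0 [^] (- q) = (u \<otimes> u0 [^] (- q)) \<otimes> x [^] (i + int d * - q)"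
            unfolding u(2) using adjoin_mult[OF V(1,2) uc(4) _ x] u0q U(2) by auto
          moreover have "i + int d * - q = i mod int d" unfolding q_def by (simp add: minus_mult_div_eq_mod)
          ultimately have eq: "w \<otimes> w0 [^] (- q) = (u \<otimes> u0 [^] (- q)) \<otimes> x [^] (i mod int d)" by simp
          have inW: "w \<otimes> w0 [^] (- q) \<in> W"
            using w w0 subgroup.m_closed[OF W(1)] subgroup_int_pow_closed[OF W(1) w0(1)] by blast
          have uu: "u \<otimes> u0 [^] (- q) \<in> U" using u u0q subgroup.m_closed[OF U(1)] by blast
          then have "i mod int d \<in> I" using eq inW by (auto simp: I_def)
          \<comment> \<open>The remainder is an exponent in \<open>I\<close> below the least
            positive one, so dividing by a power of \<open>w0\<close> leaves an element of
            \<open>W \<inter> U\<close>.\<close>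
          then have "i mod int d = 0"
            using dmin[of "nat (i mod int d)"] d pos_mod_bound[of "int d" i] pos_mod_sign[of "int d" i]
            by (smt (verit, best) nat_0_iff int_nat_eq nat_less_iff not_le zero_less_nat_eq of_nat_0_less_iff)
          then have "w \<otimes> w0 [^] (- q) \<in> U" using eq uu uc by simp
          then have "w \<otimes> w0 [^] (- q) \<in> generate G (insert w0 T)"
            using inW T(3) mono_generate[of T "insert w0 T"] by auto
          moreover have "w0 [^] q \<in> generate G (insert w0 T)"
            by (rule subgroup_int_pow_closed[OF gs]) (auto intro: generate.incl)
          ultimately have "(w \<otimes> w0 [^] (- q)) \<otimes> w0 [^] q \<in> generate G (insert w0 T)"
            by (rule generate.eng)
          moreover have "w \<in> carrier G" using w subgroup.mem_carrier[OF W(1)] by auto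
          ultimately show "w \<in> generate G (insert w0 T)"
            using w0 by (simp add: m_assoc int_pow_neg)
        qed
        then have "generate G (insert w0 T) = W" using generate_subgroup_incl[OF TW W(1)] by auto
        then show ?thesis unfolding fg_subgroup_def using T Tc by (intro exI[of _ "insert w0 T"]) auto
      qed
    qed
  qed
  then show ?thesis using W by blast
qed

text \<open>Adjoining \<open>x\<close> multiplies the number of cosets of \<open>U\<close> by at
  most \<open>k\<close>: writing \<open>i = k q + r\<close>, the factor \<open>x^(k q)\<close> lies
  in the group already reached, and only the \<open>k\<close> remainders contribute new
  cosets.\<close>

lemma abelian_power_fidx:
  assumes V: "subgroup V G" "commuting G V" "fg_subgroup V G" and U: "subgroup U G" "U \<subseteq> V"
    and k: "k > 0" "\<And>v. v \<in> V \<Longrightarrow> v [^] (k::nat) \<in> U"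
  shows "fidx G U V"
proof (rule abelian_fg_induct[where Q = "\<lambda>U'. fidx G U U'", OF V U])
  have Vc: "V \<subseteq> carrier G" using subgroup.subset[OF V(1)] .
  show "fidx G U U"
    by (rule fidx_by_map[OF U(1), where \<phi> = "\<lambda>_. ()"])
      (use subgroup.subset[OF U(1)] subgroup.m_closed[OF U(1)] subgroup.m_inv_closed[OF U(1)] in auto)
  fix U' x assume U': "subgroup U' G" "U \<subseteq> U'" "U' \<subseteq> V" and x: "x \<in> V" and fin: "fidx G U U'"
  have xc: "x \<in> carrier G" using x Vc by auto
  have "(\<lambda>v. U #> v) ` adjoin G U' x \<subseteq> (\<lambda>(c, r). c #> x [^] r) ` (((\<lambda>v. U #> v) ` U') \<times> {0..<int k})"
  proof
    fix c assume "c \<in> (\<lambda>v. U #> v) ` adjoin G U' x"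
    then obtain u i where u: "u \<in> U'" "c = U #> (u \<otimes> x [^] (i::int))" by (auto simp: adjoin_def)
    define q where "q = i div int k"
    define r where "r = i mod int k"
    have r: "r \<in> {0..<int k}" using k by (auto simp: r_def)
    have "i = int k * q + r" by (simp add: q_def r_def)
    then have "x [^] i = (x [^] k) [^] q \<otimes> x [^] r"
      using xc by (simp add: int_pow_mult int_pow_pow int_pow_int [symmetric])
    moreover have "(x [^] k) [^] q \<in> U'" using k(2)[OF x] U' subgroup_int_pow_closed[OF U'(1)] by blast
    moreover have "u \<in> carrier G" using u U' Vc by auto
    ultimately have "c = (U #> (u \<otimes> (x [^] k) [^] q)) #> x [^] r" and "u \<otimes> (x [^] k) [^] q \<in> U'"
      using u xc subgroup.subset[OF U(1)] subgroup.m_closed[OF U'(1)] by (auto simp: coset_mult_assoc m_assoc)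
    then show "c \<in> (\<lambda>(c, r). c #> x [^] r) ` (((\<lambda>v. U #> v) ` U') \<times> {0..<int k})" using r by force
  qed
  moreover have "finite (((\<lambda>v. U #> v) ` U') \<times> {0..<int k})" using fin by (simp add: fidx_def)
  ultimately show "fidx G U (adjoin G U' x)" unfolding fidx_def using finite_surj by blast
qed

text \<open>A substitute for a projection onto \<open>W\<close>, which need not be a direct factor
  of \<open>V\<close>: a homomorphism into \<open>W\<close> that is a power map on \<open>W\<close>
  instead of the identity.\<close>

lemma virtual_projection:
  assumes V: "subgroup V G" "commuting G V" "fg_subgroup V G" and W: "subgroup W G" "W \<subseteq> V"
  shows "\<exists>k>0. \<exists>p. (\<forall>x\<in>V. \<forall>y\<in>V. p (x \<otimes> y) = p x \<otimes> p y) \<and> p ` V \<subseteq> W \<and> (\<forall>w\<in>W. p w = w [^] (k::nat))"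
proof (rule abelian_fg_induct[where Q = "\<lambda>U. \<exists>k>0. \<exists>p. (\<forall>x\<in>U. \<forall>y\<in>U. p (x \<otimes> y) = p x \<otimes> p y) \<and> p ` U \<subseteq> W
    \<and> (\<forall>w\<in>W. p w = w [^] (k::nat))", OF V W])
  have Vc: "V \<subseteq> carrier G" using subgroup.subset[OF V(1)] .
  show "\<exists>k>0. \<exists>p. (\<forall>x\<in>W. \<forall>y\<in>W. p (x \<otimes> y) = p x \<otimes> p y) \<and> p ` W \<subseteq> W \<and> (\<forall>w\<in>W. p w = w [^] (k::nat))"
    by (rule exI[of _ 1], simp, rule exI[of _ id]) (use W Vc in \<open>auto simp: subset_iff\<close>)
  fix U x assume U: "subgroup U G" "W \<subseteq> U" "U \<subseteq> V" and x: "x \<in> V"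
    and "\<exists>k>0. \<exists>p. (\<forall>x\<in>U. \<forall>y\<in>U. p (x \<otimes> y) = p x \<otimes> p y) \<and> p ` U \<subseteq> W \<and> (\<forall>w\<in>W. p w = w [^] (k::nat))"
  then obtain k p where k: "k > 0" and p0: "\<forall>x\<in>U. \<forall>y\<in>U. p (x \<otimes> y) = p x \<otimes> p y"
    "p ` U \<subseteq> W" "\<forall>w\<in>W. p w = w [^] (k::nat)" by (elim exE conjE) (rule that)
  have p: "\<And>x y. x \<in> U \<Longrightarrow> y \<in> U \<Longrightarrow> p (x \<otimes> y) = p x \<otimes> p y" "p ` U \<subseteq> W"
    "\<And>w. w \<in> W \<Longrightarrow> p w = w [^] k" using p0 by auto
  note a = adjoin_subgroup[OF V(1,2) U(1,3) x]
  have xc: "x \<in> carrier G" using x Vc by auto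
  show "\<exists>k>0. \<exists>p. (\<forall>y\<in>adjoin G U x. \<forall>z\<in>adjoin G U x. p (y \<otimes> z) = p y \<otimes> p z) \<and> p ` adjoin G U x \<subseteq> W
      \<and> (\<forall>w\<in>W. p w = w [^] (k::nat))"
  proof (cases "\<exists>j>0. x [^] (j::nat) \<in> U")
    case True
    \<comment> \<open>Here \<open>j\<close>-th powers of the enlarged group lie in \<open>U\<close>,
      and \<open>p\<close> is precomposed with the \<open>j\<close>-th power map, at the price of
      replacing \<open>k\<close> by \<open>j * k\<close>.\<close>
    then obtain j where j: "j > 0" "x [^] (j::nat) \<in> U" by blast
    have pw: "y [^] j \<in> U" if y: "y \<in> adjoin G U x" for y
    proof -
      obtain u i where u: "u \<in> U" "y = u \<otimes> x [^] (i::int)" using y by (auto simp: adjoin_def)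
      have uc: "u \<in> V" "u \<in> carrier G" using u U Vc by auto
      have "y [^] j = u [^] j \<otimes> (x [^] j) [^] i"
      proof -
        have "u \<otimes> x [^] i = x [^] i \<otimes> u"
          using uc commutingD[OF V(2)] subgroup_int_pow_closed[OF V(1) x] by blast
        then have "y [^] j = u [^] j \<otimes> (x [^] i) [^] j" unfolding u(2) using uc xc by (intro pow_mult_distrib) auto
        moreover have "(x [^] i) [^] int j = (x [^] int j) [^] i" using xc by (simp add: int_pow_pow mult.commute)
        ultimately show ?thesis by (simp add: int_pow_int)
      qed
      then show ?thesis using u j subgroup.m_closed[OF U(1)] subgroup_int_pow_closed[OF U(1)]
          subgroup_nat_pow_closed[OF U(1)] by auto
    qed
    have "p ((y \<otimes> z) [^] j) = p (y [^] j) \<otimes> p (z [^] j)" if yz: "y \<in> adjoin G U x" "z \<in> adjoin G U x" for y z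
      using yz pw a Vc commutingD[OF V(2), of y z] by (subst pow_mult_distrib) (auto simp: p subset_iff)
    moreover have "p (w [^] j) = w [^] (j * k)" if w: "w \<in> W" for w
      using w U Vc p(3)[of "w [^] j"] subgroup_nat_pow_closed[OF W(1) w] by (auto simp: nat_pow_pow subset_iff)
    ultimately show ?thesis
      using j k pw p(2) by (intro exI[of _ "j * k"]) (auto intro!: exI[of _ "\<lambda>y. p (y [^] j)"])
  next
    case False
    \<comment> \<open>No power of \<open>x\<close> returns to \<open>U\<close>, so the enlarged
      group is the direct product of \<open>U\<close> and the infinite cyclic group of
      \<open>x\<close>, and \<open>p\<close> is extended by killing \<open>x\<close>.\<close>
    have zero: "i = 0" if "x [^] (i::int) \<in> U" for i
    proof (rule ccontr)
      assume i: "i \<noteq> 0"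
      have "x [^] (\<bar>i\<bar>) \<in> U" using that subgroup.m_inv_closed[OF U(1) that] xc
        by (cases "i \<ge> 0") (auto simp: int_pow_neg [symmetric])
      then have "x [^] (nat \<bar>i\<bar>) \<in> U" using int_pow_int[of G x "nat \<bar>i\<bar>"] by simp
      then show False using False i by (metis zero_less_abs_iff zero_less_nat_eq)
    qed
    have uniq: "u = u'" if "u \<in> U" "u' \<in> U" "u \<otimes> x [^] (i::int) = u' \<otimes> x [^] (i'::int)" for u u' i i'
    proof -
      have c: "u \<in> carrier G" "u' \<in> carrier G" using that U Vc by auto
      have "x [^] (i - i') = inv u \<otimes> (u \<otimes> x [^] i) \<otimes> inv (x [^] i')"
        using c xc by (simp add: int_pow_diff m_assoc)
      also have "\<dots> = inv u \<otimes> u'" unfolding that(3) using c xc by (simp add: m_assoc)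
      finally have "x [^] (i - i') \<in> U"
        using that subgroup.m_closed[OF U(1)] subgroup.m_inv_closed[OF U(1)] by auto
      then have "i = i'" using zero by force
      then show ?thesis using that(3) c xc by simp
    qed
    define f where "f y = (SOME u. u \<in> U \<and> (\<exists>i::int. y = u \<otimes> x [^] i))" for y
    have f: "f (u \<otimes> x [^] i) = u" if "u \<in> U" for u and i :: int
      unfolding f_def by (rule some_equality) (use that uniq in blast)+
    have fU: "f u = u" if "u \<in> U" for u using f[OF that, of 0] that U Vc by (auto simp: subset_iff)
    have "p (f (y \<otimes> z)) = p (f y) \<otimes> p (f z)" if yz: "y \<in> adjoin G U x" "z \<in> adjoin G U x" for y z
    proof -
      obtain u i where u: "u \<in> U" "y = u \<otimes> x [^] (i::int)" using yz by (auto simp: adjoin_def)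
      obtain u' i' where u': "u' \<in> U" "z = u' \<otimes> x [^] (i'::int)" using yz by (auto simp: adjoin_def)
      have "y \<otimes> z = (u \<otimes> u') \<otimes> x [^] (i + i')"
        unfolding u u' by (rule adjoin_mult[OF V(1,2)]) (use u u' U x in auto)
      then show ?thesis using f u u' subgroup.m_closed[OF U(1)] p(1) by auto
    qed
    moreover have "f ` adjoin G U x \<subseteq> U" using f by (auto simp: adjoin_def)
    ultimately show ?thesis using k p U fU
      by (intro exI[of _ k]) (auto intro!: exI[of _ "\<lambda>y. p (f y)"] simp: image_subset_iff)
  qed
qed

section \<open>Invariant complements\<close>

lemma powers_subgroup:
  assumes "subgroup V G" "commuting G V"
  shows "subgroup (powers G n V) G" "powers G n V \<subseteq> V"
proof -
  have c: "V \<subseteq> carrier G" using subgroup.subset[OF assms(1)] .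
  show s: "powers G n V \<subseteq> V" using subgroup_nat_pow_closed[OF assms(1)] by (auto simp: powers_def)
  show "subgroup (powers G n V) G"
  proof (rule subgroupI)
    show "powers G n V \<subseteq> carrier G" using s c by blast
    show "powers G n V \<noteq> {}" using subgroup.one_closed[OF assms(1)] by (auto simp: powers_def)
    fix a b assume "a \<in> powers G n V" "b \<in> powers G n V"
    then obtain x y where xy: "x \<in> V" "a = x [^] n" "y \<in> V" "b = y [^] n" by (auto simp: powers_def)
    then have "a \<otimes> b = (x \<otimes> y) [^] n" using c commutingD[OF assms(2)] by (simp add: pow_mult_distrib subset_iff)
    then show "a \<otimes> b \<in> powers G n V" using xy subgroup.m_closed[OF assms(1)] by (auto simp: powers_def)
  next
    fix a assume "a \<in> powers G n V"
    then obtain x where x: "x \<in> V" "a = x [^] n" by (auto simp: powers_def)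
    then have "inv a = (inv x) [^] n" using c by (simp add: nat_pow_inv subset_iff)
    then show "inv a \<in> powers G n V" using x subgroup.m_inv_closed[OF assms(1)] by (auto simp: powers_def)
  qed
qed

lemma conj_pow:
  assumes "g \<in> carrier G" "x \<in> carrier G"
  shows "g \<otimes> (x [^] (n::nat)) \<otimes> inv g = (g \<otimes> x \<otimes> inv g) [^] n"
proof (induction n)
  case (Suc n)
  have "g \<otimes> (x [^] Suc n) \<otimes> inv g = (g \<otimes> (x [^] n) \<otimes> inv g) \<otimes> (g \<otimes> x \<otimes> inv g)"
    using assms by (simp add: m_assoc)
  then show ?case using Suc by simp
qed (use assms in simp)

lemma powers_conj_closed:
  assumes "V \<subseteq> carrier G" "g \<in> carrier G" "\<And>v. v \<in> V \<Longrightarrow> g \<otimes> v \<otimes> inv g \<in> V" "x \<in> powers G n V"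
  shows "g \<otimes> x \<otimes> inv g \<in> powers G n V"
  using assms conj_pow[OF assms(2)] by (auto simp: powers_def)

text \<open>The torsion elements form a finitely generated abelian group, which has a finite
  exponent \<open>n\<close>. If \<open>v^n\<close> is torsion then so is \<open>v\<close>, whence
  \<open>v^n = \<one>\<close>; thus raising to the power \<open>n\<close> removes all
  torsion.\<close>

lemma torsion_free_powers:
  assumes V: "subgroup V G" "commuting G V" "fg_subgroup V G"
  shows "\<exists>n>0. torsion_free G (powers G n V)"
proof -
  have c: "V \<subseteq> carrier G" using subgroup.subset[OF V(1)] .
  define T where "T = {x \<in> V. \<exists>n>0. x [^] (n::nat) = \<one>}"
  have T: "subgroup T G"
  proof (rule subgroupI)
    show "T \<subseteq> carrier G" using c by (auto simp: T_def)
    have "\<one> \<in> T" using subgroup.one_closed[OF V(1)] by (auto simp: T_def intro: exI[of _ 1])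
    then show "T \<noteq> {}" by blast
    fix a assume a: "a \<in> T"
    then obtain n where n: "n > 0" "a [^] (n::nat) = \<one>" by (auto simp: T_def)
    have "a \<in> V" using a by (simp add: T_def)
    then have "(inv a) [^] n = \<one>" using n c by (simp add: nat_pow_inv subset_iff)
    then show "inv a \<in> T" using \<open>a \<in> V\<close> n(1) subgroup.m_inv_closed[OF V(1)] by (auto simp: T_def)
  next
    fix a b assume ab: "a \<in> T" "b \<in> T"
    then obtain n m where n: "n > 0" "a [^] (n::nat) = \<one>" and m: "m > 0" "b [^] (m::nat) = \<one>"
      by (auto simp: T_def)
    have v: "a \<in> V" "b \<in> V" "a \<in> carrier G" "b \<in> carrier G" using ab c by (auto simp: T_def)
    have "a [^] (n * m) = \<one>" using nat_pow_pow[OF v(3), of n m] n by simp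
    moreover have "b [^] (n * m) = \<one>" using nat_pow_pow[OF v(4), of m n] m by (simp add: mult.commute)
    ultimately have "(a \<otimes> b) [^] (n * m) = \<one>"
      using v commutingD[OF V(2)] by (simp add: pow_mult_distrib)
    then show "a \<otimes> b \<in> T" using v n(1) m(1) subgroup.m_closed[OF V(1)]
      unfolding T_def by (auto intro!: exI[of _ "n * m"])
  qed
  have TV: "T \<subseteq> V" by (auto simp: T_def)
  note Tc = commuting_subset[OF V(2) TV]
  have "\<exists>n>0. \<forall>u\<in>T. u [^] (n::nat) = \<one>"
  proof (rule abelian_fg_induct[OF T Tc abelian_subgroup_fg[OF V T TV] triv_subgroup])
    show "{\<one>} \<subseteq> T" using subgroup.one_closed[OF T] by simp
    show "\<exists>n>0. \<forall>u\<in>{\<one>}. u [^] (n::nat) = \<one>" by (intro exI[of _ 1]) auto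
    fix U x assume U: "subgroup U G" "U \<subseteq> T" "x \<in> T" "\<exists>n>0. \<forall>u\<in>U. u [^] (n::nat) = \<one>"
    then obtain n where n: "n > 0" "\<And>u. u \<in> U \<Longrightarrow> u [^] (n::nat) = \<one>" by blast
    obtain m where m: "m > 0" "x [^] (m::nat) = \<one>" using U by (auto simp: T_def)
    have "y [^] (n * m) = \<one>" if y: "y \<in> adjoin G U x" for y
    proof -
      obtain u i where u: "u \<in> U" "y = u \<otimes> x [^] (i::int)" using y by (auto simp: adjoin_def)
      have uc: "u \<in> T" "x \<in> T" "u \<in> carrier G" "x \<in> carrier G" using u U TV c by auto
      have "u \<otimes> x [^] i = x [^] i \<otimes> u"
        using uc commutingD[OF Tc] subgroup_int_pow_closed[OF T] by blast
      then have "y [^] (n * m) = u [^] (n * m) \<otimes> (x [^] i) [^] (n * m)"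
        unfolding u(2) using uc by (intro pow_mult_distrib) auto
      moreover have "u [^] (n * m) = \<one>" using n(2)[OF u(1)] nat_pow_pow[OF uc(3), of n m] by simp
      moreover have "(x [^] i) [^] int (n * m) = (x [^] int m) [^] (i * int n)"
        using uc by (simp add: int_pow_pow algebra_simps)
      then have "(x [^] i) [^] (n * m) = \<one>" using m by (simp only: int_pow_int int_pow_one)
      ultimately show ?thesis by simp
    qed
    then show "\<exists>n>0. \<forall>u\<in>adjoin G U x. u [^] (n::nat) = \<one>"
      using n(1) m(1) by (intro exI[of _ "n * m"]) auto
  qed
  then obtain n where n: "n > 0" "\<And>u. u \<in> T \<Longrightarrow> u [^] (n::nat) = \<one>" by blast
  have "torsion_free G (powers G n V)" unfolding torsion_free_def
  proof (intro ballI allI impI)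
    fix x and m :: nat assume x: "x \<in> powers G n V" "m > 0" "x [^] m = \<one>"
    then obtain v where v: "v \<in> V" "x = v [^] n" by (auto simp: powers_def)
    have vc: "v \<in> carrier G" using v c by auto
    then have "v [^] (n * m) = \<one>" using x v by (simp add: nat_pow_pow)
    then have "v \<in> T" using v n(1) x(2) by (auto simp: T_def intro!: exI[of _ "n * m"])
    then show "x = \<one>" using n v by simp
  qed
  then show ?thesis using n by blast
qed

section \<open>Free abelian normal subgroups of finite index\<close>

lemma relative_normal_core:
  assumes V: "subgroup V G" and K: "subgroup K G" "K \<subseteq> V" "fidx G K V"
  shows "\<exists>L. subgroup L G \<and> L \<subseteq> K \<and> fidx G L V \<and> (\<forall>v\<in>V. \<forall>x\<in>L. v \<otimes> x \<otimes> inv v \<in> L)"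
proof -
  interpret H: group "G\<lparr>carrier := V\<rparr>" by (rule subgroup_imp_group[OF V])
  have "subgroup K (G\<lparr>carrier := V\<rparr>)" using subgroup_incl[OF K(1) V K(2)] .
  moreover have "fidx (G\<lparr>carrier := V\<rparr>) K (carrier (G\<lparr>carrier := V\<rparr>))" using K(3) by (simp add: fidx_def)
  ultimately obtain L where L: "L \<lhd> G\<lparr>carrier := V\<rparr>" "L \<subseteq> K" "fidx (G\<lparr>carrier := V\<rparr>) L V"
    using H.normal_core by auto
  have "subgroup L (G\<lparr>carrier := V\<rparr>)" using normal_imp_subgroup[OF L(1)] .
  then have "subgroup L G" using incl_subgroup[OF V] by blast
  moreover have "v \<otimes> x \<otimes> inv v \<in> L" if "v \<in> V" "x \<in> L" for v x
    using normal.inv_op_closed2[OF L(1), of v x] that m_inv_consistent[OF V] by simp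
  ultimately show ?thesis using L by (auto simp: fidx_def)
qed

text \<open>A free abelian subgroup of finite index in \<open>P\<close> that \<open>P\<close>
  normalizes. Freeness enters as abelian, finitely generated and torsion free; no basis is ever
  chosen.\<close>

definition lattice_in :: "'a set \<Rightarrow> 'a set \<Rightarrow> bool" where
  "lattice_in M P \<longleftrightarrow> subgroup M G \<and> M \<subseteq> P \<and> commuting G M \<and> fg_subgroup M G \<and> torsion_free G M \<and>
     fidx G M P \<and> (\<forall>p\<in>P. \<forall>m\<in>M. p \<otimes> m \<otimes> inv p \<in> M)"

lemma lattice_in_exists:
  assumes P: "subgroup P G" "fg_subgroup P G" and K: "subgroup K G" "K \<subseteq> P" "commuting G K" "fidx G K P"
    and L: "subgroup L G" "fidx G L P"
  shows "\<exists>M. lattice_in M P \<and> M \<subseteq> L"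
proof -
  have Pc: "P \<subseteq> carrier G" using subgroup.subset[OF P(1)] .
  obtain K0 where K0: "subgroup K0 G" "K0 \<subseteq> K" "fidx G K0 P" "\<And>p x. p \<in> P \<Longrightarrow> x \<in> K0 \<Longrightarrow> p \<otimes> x \<otimes> inv p \<in> K0"
    using relative_normal_core[OF P(1) K(1,2,4)] by auto
  have K0P: "K0 \<subseteq> P" and K0comm: "commuting G K0" using K0 K commuting_subset by auto
  have K0fg: "fg_subgroup K0 G" by (rule fg_subgroup_fidx[OF K0(1) P(2) K0P K0(3)])
  have K0c: "K0 \<subseteq> carrier G" using subgroup.subset[OF K0(1)] .
  obtain e where e: "e > 0" "\<And>v. v \<in> K0 \<Longrightarrow> v [^] (e::nat) \<in> L"
    using fidx_common_power[OF L(1) K0(1) fidx_subset[OF L(2) K0P]] by blast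
  obtain n where n: "n > 0" "torsion_free G (powers G n K0)" using torsion_free_powers[OF K0(1) K0comm K0fg] by blast
  \<comment> \<open>Two requirements multiply: the factor \<open>e\<close> pushes powers into
    \<open>L\<close>, the factor \<open>n\<close> removes torsion. Passing to powers keeps the
    subgroup normalized by \<open>P\<close> and of finite index.\<close>
  define M where "M = powers G (e * n) K0"
  note M1 = powers_subgroup[OF K0(1) K0comm, of "e * n", folded M_def]
  have "M \<subseteq> powers G n K0"
    using K0c subgroup_nat_pow_closed[OF K0(1)] by (force simp: M_def powers_def nat_pow_pow [symmetric])
  then have "torsion_free G M" using n torsion_free_subset by blast
  moreover have "M \<subseteq> L"
    using K0c e(2) subgroup_nat_pow_closed[OF L(1)] by (auto simp: M_def powers_def nat_pow_pow [symmetric] subset_iff)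
  moreover have "fidx G M K0"
    by (rule abelian_power_fidx[OF K0(1) K0comm K0fg M1, of "e * n"]) (use e n in \<open>auto simp: M_def powers_def\<close>)
  then have "fidx G M P" using fidx_trans[OF M1(1) K0(1) Pc] K0(3) by blast
  moreover have "p \<otimes> m \<otimes> inv p \<in> M" if "p \<in> P" "m \<in> M" for p m
    unfolding M_def by (rule powers_conj_closed[OF K0c]) (use that Pc K0(4) in \<open>auto simp: M_def\<close>)
  moreover have "fg_subgroup M G" by (rule abelian_subgroup_fg[OF K0(1) K0comm K0fg M1])
  ultimately show ?thesis unfolding lattice_in_def
    using M1 K0P commuting_subset[OF K0comm M1(2)] by blast
qed

text \<open>Maschke's averaging argument, applied to a virtual projection onto \<open>S \<inter> M\<close>.\<close>

lemma invariant_complement: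
  assumes M: "subgroup M G" "commuting G M" "fg_subgroup M G" "torsion_free G M"
    and S: "subgroup S G" "\<And>s m. \<lbrakk>s \<in> S; m \<in> M\<rbrakk> \<Longrightarrow> s \<otimes> m \<otimes> inv s \<in> M"
    and fin: "finite ((\<lambda>s. \<lambda>m\<in>M. s \<otimes> m \<otimes> inv s) ` S)"
  shows "\<exists>R. subgroup R G \<and> R \<subseteq> M \<and> (\<forall>s\<in>S. \<forall>r\<in>R. s \<otimes> r \<otimes> inv s \<in> R) \<and> R \<inter> S = {\<one>} \<and>
    (\<exists>k>0. \<forall>m\<in>M. \<exists>r\<in>R. \<exists>w\<in>S \<inter> M. m [^] (k::nat) = r \<otimes> w)"
proof -
  define W where "W = S \<inter> M"
  have W: "subgroup W G" "W \<subseteq> M" unfolding W_def using subgroups_Inter_pair[OF S(1) M(1)] by auto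
  have Mc: "M \<subseteq> carrier G" and Sc: "S \<subseteq> carrier G" using subgroup.subset[OF M(1)] subgroup.subset[OF S(1)] .
  obtain k p where k: "k > 0" and p0: "\<forall>x\<in>M. \<forall>y\<in>M. p (x \<otimes> y) = p x \<otimes> p y"
    "p ` M \<subseteq> W" "\<forall>w\<in>W. p w = w [^] (k::nat)"
    using virtual_projection[OF M(1,2,3) W] by (elim exE conjE) (rule that)
  define c where "c s m = s \<otimes> m \<otimes> inv s" for s m
  \<comment> \<open>\<open>S\<close> may be infinite, so the average runs over the finitely many
    automorphisms of \<open>M\<close> that it induces.\<close>
  define \<Phi> where "\<Phi> = (\<lambda>s. \<lambda>m\<in>M. c s m) ` S"
  have fin\<Phi>: "finite \<Phi>" unfolding \<Phi>_def c_def by (rule fin)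
  have cM: "c s m \<in> M" if "s \<in> S" "m \<in> M" for s m using S that by (simp add: c_def)
  have cmult: "c s (m \<otimes> m') = c s m \<otimes> c s m'" if "s \<in> S" "m \<in> M" "m' \<in> M" for s m m'
    using that Sc Mc by (simp add: c_def group_normalize subset_iff)
  have cc: "c s (c t m) = c (s \<otimes> t) m" if "s \<in> S" "t \<in> S" "m \<in> M" for s t m
    using that Sc Mc by (simp add: c_def group_normalize subset_iff)
  have cinv: "c (inv s) (c s m) = m" "c s (c (inv s) m) = m" if "s \<in> S" "m \<in> M" for s m
    using that Sc Mc by (simp_all add: c_def group_normalize subset_iff)
  have Sinv: "inv s \<in> S" if "s \<in> S" for s using that subgroup.m_inv_closed[OF S(1)] by blast
  have cW: "c s w \<in> W" if "s \<in> S" "w \<in> W" for s w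
    using that cM[of s w] subgroup.m_closed[OF S(1)] Sinv by (auto simp: W_def c_def)
  define MG where "MG = G\<lparr>carrier := M\<rparr>"
  have MGs: "carrier MG = M" "monoid.mult MG = (\<otimes>)" "\<one>\<^bsub>MG\<^esub> = \<one>" by (simp_all add: MG_def)
  interpret MG: comm_group MG
    unfolding MG_def using commutingD[OF M(2)]
    by (intro group.group_comm_groupI[OF subgroup_imp_group[OF M(1)]]) auto
  have powMG: "x [^]\<^bsub>MG\<^esub> (n::nat) = x [^] n" for x n unfolding MG_def by (rule nat_pow_consistent [symmetric])
  \<comment> \<open>\<open>q \<sigma>\<close> is the conjugate of the projection \<open>p\<close> by
    \<sigma>. It is written in terms of \<sigma> alone, so that it does not depend on the element of
    \<open>S\<close> inducing \<sigma>.\<close>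
  define q :: "('a \<Rightarrow> 'a) \<Rightarrow> 'a \<Rightarrow> 'a" where "q \<sigma> m = \<sigma> (p (inv_into M \<sigma> m))" for \<sigma> m
  have qc: "q (\<lambda>m\<in>M. c s m) m = c s (p (c (inv s) m))" if s: "s \<in> S" and m: "m \<in> M" for s m
  proof -
    have "inj_on (\<lambda>m\<in>M. c s m) M" using cinv[OF s] by (intro inj_onI) (metis restrict_apply')
    moreover have "(\<lambda>m\<in>M. c s m) (c (inv s) m) = m" using cinv[OF s m] cM[OF Sinv[OF s] m] by simp
    ultimately have "inv_into M (\<lambda>m\<in>M. c s m) m = c (inv s) m"
      using cM[OF Sinv[OF s] m] by (intro inv_into_f_eq) auto
    moreover have "p (c (inv s) m) \<in> M" using p0(2) W cM[OF Sinv[OF s] m] by auto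
    ultimately show ?thesis unfolding q_def by simp
  qed
  have qW: "q \<sigma> m \<in> W" if "\<sigma> \<in> \<Phi>" "m \<in> M" for \<sigma> m
    using that qc cW p0(2) cM[OF Sinv] by (auto simp: \<Phi>_def image_subset_iff)
  define P where "P m = finprod MG (\<lambda>\<sigma>. q \<sigma> m) \<Phi>" for m
  have finprod_W: "finprod MG f A \<in> W" if "finite A" "\<And>x. x \<in> A \<Longrightarrow> f x \<in> W" for f and A :: "('a \<Rightarrow> 'a) set"
    using that
  proof (induction A)
    case empty
    then show ?case using subgroup.one_closed[OF W(1)] by (simp add: MGs)
  next
    case (insert x A)
    then have "finprod MG f (insert x A) = f x \<otimes> finprod MG f A"
      using W by (subst MG.finprod_insert) (auto simp: MGs Pi_def)
    then show ?case using insert subgroup.m_closed[OF W(1)] by auto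
  qed
  have finprod_c: "c t (finprod MG f A) = finprod MG (\<lambda>x. c t (f x)) A"
    if "finite A" "\<And>x. x \<in> A \<Longrightarrow> f x \<in> W" "t \<in> S" for f t and A :: "('a \<Rightarrow> 'a) set"
    using that
  proof (induction A)
    case empty
    then show ?case using Sc by (simp add: MGs c_def subset_iff)
  next
    case (insert x A)
    have "finprod MG f (insert x A) = f x \<otimes> finprod MG f A"
      using W insert by (subst MG.finprod_insert) (auto simp: MGs Pi_def)
    moreover have "finprod MG (\<lambda>x. c t (f x)) (insert x A) = c t (f x) \<otimes> finprod MG (\<lambda>x. c t (f x)) A"
      using W insert cW by (subst MG.finprod_insert) (auto simp: MGs Pi_def subset_iff)
    moreover have "f x \<in> M" "finprod MG f A \<in> M" using insert finprod_W[of A f] W by auto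
    ultimately show ?case using insert cmult by simp
  qed
  have PW: "P m \<in> W" if "m \<in> M" for m unfolding P_def using finprod_W[OF fin\<Phi>] qW that by auto
  have Pmult: "P (m \<otimes> m') = P m \<otimes> P m'" if m: "m \<in> M" "m' \<in> M" for m m'
  proof -
    have "q \<sigma> (m \<otimes> m') = q \<sigma> m \<otimes> q \<sigma> m'" if \<sigma>: "\<sigma> \<in> \<Phi>" for \<sigma>
    proof -
      obtain s where s: "s \<in> S" "\<sigma> = (\<lambda>m\<in>M. c s m)" using \<sigma> unfolding \<Phi>_def by blast
      have mm: "m \<otimes> m' \<in> M" using m subgroup.m_closed[OF M(1)] by blast
      note cmM = cM[OF Sinv[OF s(1)] m(1)] cM[OF Sinv[OF s(1)] m(2)]
      have pM: "p (c (inv s) m) \<in> M" "p (c (inv s) m') \<in> M" using p0(2) W(2) cmM by auto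
      have "p (c (inv s) (m \<otimes> m')) = p (c (inv s) m) \<otimes> p (c (inv s) m')"
        using cmult[OF Sinv[OF s(1)] m] p0(1) cmM by simp
      then show ?thesis
        unfolding s(2) qc[OF s(1) mm] qc[OF s(1) m(1)] qc[OF s(1) m(2)] using cmult[OF s(1) pM] by simp
    qed
    then have "P (m \<otimes> m') = finprod MG (\<lambda>\<sigma>. q \<sigma> m \<otimes>\<^bsub>MG\<^esub> q \<sigma> m') \<Phi>"
      unfolding P_def using qW m W subgroup.m_closed[OF M(1)]
      by (intro MG.finprod_cong') (auto simp: MGs Pi_def subset_iff)
    also have "\<dots> = P m \<otimes> P m'"
      unfolding P_def using qW m W by (subst MG.finprod_multf) (auto simp: MGs Pi_def subset_iff)
    finally show ?thesis .
  qed
  \<comment> \<open>Each conjugate of \<open>p\<close> is the \<open>k\<close>-th power map on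
    \<open>W\<close>, so their product is the power map with exponent \<open>k\<close> times the
    number of factors.\<close>
  define K where "K = k * card \<Phi>"
  have "\<Phi> \<noteq> {}" using subgroup.one_closed[OF S(1)] by (auto simp: \<Phi>_def)
  then have K: "K > 0" using k fin\<Phi> by (simp add: K_def card_gt_0_iff)
  have Pw: "P w = w [^] K" if w: "w \<in> W" for w
  proof -
    have wM: "w \<in> M" "w \<in> carrier G" using w W Mc by auto
    have "q \<sigma> w = w [^] k" if \<sigma>: "\<sigma> \<in> \<Phi>" for \<sigma>
    proof -
      obtain s where s: "s \<in> S" "\<sigma> = (\<lambda>m\<in>M. c s m)" using \<sigma> unfolding \<Phi>_def by blast
      have "c (inv s) w \<in> W" using cW[OF Sinv[OF s(1)] w] .
      then have "p (c (inv s) w) = (c (inv s) w) [^] k" using p0 by blast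
      also have "\<dots> = c (inv s) (w [^] k)" using conj_pow[of "inv s" w k] s Sc wM by (auto simp: c_def)
      finally show ?thesis unfolding s(2) qc[OF s(1) wM(1)]
        using cinv(2)[OF s(1)] subgroup_nat_pow_closed[OF M(1) wM(1)] by simp
    qed
    then have "P w = finprod MG (\<lambda>\<sigma>. w [^] k) \<Phi>"
      unfolding P_def using subgroup_nat_pow_closed[OF M(1) wM(1)]
      by (intro MG.finprod_cong') (auto simp: MGs)
    also have "\<dots> = (w [^] k) [^]\<^bsub>MG\<^esub> card \<Phi>"
      using subgroup_nat_pow_closed[OF M(1) wM(1)] by (intro MG.finprod_const) (auto simp: MGs)
    finally show ?thesis using wM by (simp add: powMG nat_pow_pow K_def)
  qed
  have Pc: "P (c t m) = c t (P m)" if t: "t \<in> S" and m: "m \<in> M" for t m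
  proof -
    \<comment> \<open>Composition with conjugation by \<open>t\<close> permutes
      \<open>\<Phi>\<close>, which reindexes the product and makes \<open>P\<close> commute with the
      action of \<open>S\<close>.\<close>
    define \<tau> where "\<tau> \<sigma> = (\<lambda>m\<in>M. c t (\<sigma> m))" for \<sigma>
    have \<tau>s: "\<tau> (\<lambda>m\<in>M. c s m) = (\<lambda>m\<in>M. c (t \<otimes> s) m)" if "s \<in> S" for s
      using cc[OF t that] by (auto simp: \<tau>_def)
    have ts: "t \<otimes> s \<in> S" if "s \<in> S" for s using t that subgroup.m_closed[OF S(1)] by blast
    have img: "\<tau> ` \<Phi> \<subseteq> \<Phi>" using \<tau>s ts by (auto simp: \<Phi>_def)
    have inj: "inj_on \<tau> \<Phi>"
    proof (rule inj_onI)
      fix \<sigma> \<sigma>' assume "\<sigma> \<in> \<Phi>" "\<sigma>' \<in> \<Phi>" and eq: "\<tau> \<sigma> = \<tau> \<sigma>'"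
      then obtain s s' where s: "s \<in> S" "\<sigma> = (\<lambda>m\<in>M. c s m)" "s' \<in> S" "\<sigma>' = (\<lambda>m\<in>M. c s' m)"
        by (auto simp: \<Phi>_def)
      have "c s m = c s' m" if "m \<in> M" for m
      proof -
        have "c t (c s m) = c t (c s' m)" using fun_cong[OF eq, of m] that s by (simp add: \<tau>_def)
        then show ?thesis using cinv(1)[OF t] cM s that by metis
      qed
      then show "\<sigma> = \<sigma>'" using s by auto
    qed
    have bij: "\<tau> ` \<Phi> = \<Phi>" using img inj fin\<Phi> by (simp add: endo_inj_surj)
    have cm: "c t m \<in> M" using cM t m by blast
    have "q (\<tau> \<sigma>) (c t m) = c t (q \<sigma> m)" if \<sigma>: "\<sigma> \<in> \<Phi>" for \<sigma>
    proof -
      obtain s where s: "s \<in> S" "\<sigma> = (\<lambda>m\<in>M. c s m)" using \<sigma> unfolding \<Phi>_def by blast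
      have "c (inv (t \<otimes> s)) (c t m) = c (inv s) m"
        using s t m Sc Mc by (simp add: c_def group_normalize subset_iff)
      then have "q (\<tau> \<sigma>) (c t m) = c (t \<otimes> s) (p (c (inv s) m))"
        unfolding s(2) \<tau>s[OF s(1)] using qc[OF ts[OF s(1)] cm] by simp
      also have "\<dots> = c t (c s (p (c (inv s) m)))"
        using p0(2) W cM[OF Sinv[OF s(1)] m] by (intro cc[OF t s(1), symmetric]) auto
      finally show ?thesis unfolding s(2) qc[OF s(1) m] .
    qed
    then have "finprod MG (\<lambda>\<sigma>. c t (q \<sigma> m)) \<Phi> = finprod MG (\<lambda>\<sigma>. q (\<tau> \<sigma>) (c t m)) \<Phi>"
      using qW[OF _ m] W(2) cM[OF t] by (intro MG.finprod_cong') (auto simp: MGs Pi_def subset_iff)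
    also have "\<dots> = finprod MG (\<lambda>\<sigma>. q \<sigma> (c t m)) (\<tau> ` \<Phi>)"
      using qW[OF _ cm] W img by (intro MG.finprod_reindex[symmetric] inj) (auto simp: MGs Pi_def subset_iff image_subset_iff)
    finally have "finprod MG (\<lambda>\<sigma>. c t (q \<sigma> m)) \<Phi> = P (c t m)" unfolding bij P_def .
    then show ?thesis unfolding P_def using finprod_c[OF fin\<Phi> _ t, of "\<lambda>\<sigma>. q \<sigma> m"] qW[OF _ m] by simp
  qed
  \<comment> \<open>The complement is the kernel of the averaged projection; equivariance of
    \<open>P\<close> makes it invariant under \<open>S\<close>.\<close>
  define R where "R = {m \<in> M. P m = \<one>}"
  have Rs: "subgroup R G"
  proof (rule subgroupI)
    show "R \<subseteq> carrier G" using Mc by (auto simp: R_def)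
    have "P \<one> = \<one> [^] K" by (rule Pw[OF subgroup.one_closed[OF W(1)]])
    then show "R \<noteq> {}" using subgroup.one_closed[OF M(1)] by (auto simp: R_def)
    fix a assume a: "a \<in> R"
    have aM: "a \<in> M" "inv a \<in> M" "a \<in> carrier G" using a subgroup.m_inv_closed[OF M(1)] Mc by (auto simp: R_def)
    have "P (inv a \<otimes> a) = P (inv a) \<otimes> P a" by (rule Pmult[OF aM(2,1)])
    moreover have "P (inv a) \<in> carrier G" using PW[OF aM(2)] W(2) Mc by blast
    moreover have "P a = \<one>" using a by (simp add: R_def)
    ultimately have "P (inv a) = \<one>" using aM(3) \<open>P \<one> = \<one> [^] K\<close> by simp
    then show "inv a \<in> R" using aM by (simp add: R_def)
  next
    fix a b assume "a \<in> R" "b \<in> R"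
    then show "a \<otimes> b \<in> R" using subgroup.m_closed[OF M(1)] Pmult by (auto simp: R_def)
  qed
  have "s \<otimes> r \<otimes> inv s \<in> R" if "s \<in> S" "r \<in> R" for s r
  proof -
    have "P (c s r) = c s \<one>" using that Pc by (auto simp: R_def)
    then show ?thesis using that cM[of s r] Sc by (auto simp: R_def c_def)
  qed
  \<comment> \<open>An element of both lies in \<open>W\<close>, where \<open>P\<close> is a power
    map; its \<open>K\<close>-th power is therefore \<open>\<one>\<close>, and \<open>M\<close> is
    torsion free.\<close>
  moreover have "R \<inter> S = {\<one>}"
  proof -
    have "x = \<one>" if "x \<in> R" "x \<in> S" for x
    proof -
      have "x \<in> W" "P x = \<one>" "x \<in> M" using that by (auto simp: R_def W_def)
      then have "x [^] K = \<one>" using Pw[of x] by simp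
      then show ?thesis using M(4) K \<open>x \<in> M\<close> unfolding torsion_free_def by blast
    qed
    then show ?thesis using subgroup.one_closed[OF Rs] subgroup.one_closed[OF S(1)] by blast
  qed
  moreover have "\<exists>r\<in>R. \<exists>w\<in>S \<inter> M. m [^] K = r \<otimes> w" if m: "m \<in> M" for m
  proof -
    have c1: "m \<in> carrier G" "P m \<in> carrier G" "P m \<in> M" using m PW[OF m] W Mc by auto
    \<comment> \<open>\<open>P\<close> takes the same value on \<open>m^K\<close> and on
      \<open>P m\<close>, since \<open>P m\<close> lies in \<open>W\<close>; their quotient is
      therefore in the kernel.\<close>
    define r where "r = m [^] K \<otimes> inv (P m)"
    have rM: "r \<in> M" unfolding r_def
      using subgroup.m_closed[OF M(1)] subgroup.m_inv_closed[OF M(1)] subgroup_nat_pow_closed[OF M(1) m] c1 by blast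
    have eq: "m [^] K = r \<otimes> P m" unfolding r_def using c1 by (simp add: m_assoc)
    have Ppow: "P (m [^] n) = P m [^] n" for n :: nat
    proof (induction n)
      case 0
      show ?case using Pw[OF subgroup.one_closed[OF W(1)]] by simp
    next
      case (Suc n)
      then show ?case using Pmult[OF subgroup_nat_pow_closed[OF M(1) m] m] by simp
    qed
    have "P r \<otimes> P (P m) = P (P m)" using Pmult[OF rM c1(3)] Ppow[of K] Pw[OF PW[OF m]] unfolding eq by simp
    moreover have "P r \<in> carrier G" "P (P m) \<in> carrier G" using PW[OF rM] PW[OF c1(3)] W Mc by auto
    ultimately have "P r = \<one>" using right_cancel[of "P (P m)" "P r" \<one>] by simp
    then show ?thesis using eq rM PW[OF m] by (auto simp: R_def W_def)
  qed
  moreover have "R \<subseteq> M" by (auto simp: R_def)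
  ultimately show ?thesis using Rs K by (intro exI[of _ R]) blast
qed

text \<open>If \<open>m^j = e\<close>, a virtual projection \<open>p\<close> onto the cyclic group
  of \<open>e\<close> with exponent \<open>k\<close> gives \<open>p m = e^i\<close> and
  \<open>e^k = e^(i j)\<close>; as \<open>e\<close> has infinite order, \<open>j\<close> divides
  \<open>k\<close>. So every \<open>j > k\<close> is safe for this \<open>e\<close>.\<close>

lemma avoid_powers:
  assumes M: "subgroup M G" "commuting G M" "fg_subgroup M G" "torsion_free G M"
    and E: "finite E" "E \<subseteq> M" "\<one> \<notin> E"
  shows "\<exists>j>0. \<forall>m\<in>M. m [^] (j::nat) \<notin> E"
proof -
  have Mc: "M \<subseteq> carrier G" using subgroup.subset[OF M(1)] .
  have "\<exists>k. \<forall>j>k. \<forall>m\<in>M. m [^] (j::nat) \<noteq> e" if e: "e \<in> E" for e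
  proof -
    have ec: "e \<in> M" "e \<in> carrier G" "e \<noteq> \<one>" using e E Mc by auto
    define W where "W = generate G {e}"
    have W: "W = {e [^] (i::int) | i. i \<in> UNIV}" unfolding W_def by (rule generate_pow[OF ec(2)])
    have Ws: "subgroup W G" unfolding W_def using ec by (intro generate_is_subgroup) auto
    have WM: "W \<subseteq> M" unfolding W_def using ec by (intro generate_subgroup_incl[OF _ M(1)]) auto
    obtain k p where k: "k > 0" and p0: "\<forall>x\<in>M. \<forall>y\<in>M. p (x \<otimes> y) = p x \<otimes> p y"
      "p ` M \<subseteq> W" "\<forall>w\<in>W. p w = w [^] (k::nat)"
      using virtual_projection[OF M(1,2,3) Ws WM] by (elim exE conjE) (rule that)
    have "m [^] j \<noteq> e" if j: "j > k" and m: "m \<in> M" for j m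
    proof
      assume eq: "m [^] j = e"
      have ppow: "p (m [^] n) = p m [^] n" for n :: nat
      proof (induction n)
        case 0
        show ?case using p0(3) subgroup.one_closed[OF Ws] by simp
      next
        case (Suc n)
        then show ?case using p0(1) subgroup_nat_pow_closed[OF M(1) m] m by simp
      qed
      obtain i where i: "p m = e [^] (i::int)" using p0(2) m W by auto
      have "e \<in> W" unfolding W_def by (intro generate.incl) simp
      then have "e [^] k = p m [^] j" using ppow[of j] eq p0(3) by simp
      then have "e [^] int k = e [^] (i * int j)" unfolding i using ec by (simp add: int_pow_int [symmetric] int_pow_pow)
      then have "e [^] (int k - i * int j) = \<one>" using ec by (simp add: int_pow_diff)
      then have z: "e [^] (\<bar>int k - i * int j\<bar>) = \<one>"
        using int_pow_neg[OF ec(2), of "int k - i * int j"] by (simp only: abs_if split: if_splits) simp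
      have "int k - i * int j = 0"
      proof (rule ccontr)
        assume nz: "int k - i * int j \<noteq> 0"
        have "e [^] (nat \<bar>int k - i * int j\<bar>) = \<one>"
          using z int_pow_int[of G e "nat \<bar>int k - i * int j\<bar>"] by simp
        moreover have "nat \<bar>int k - i * int j\<bar> > 0" using nz by simp
        ultimately show False using M(4) ec unfolding torsion_free_def by blast
      qed
      then have "int k = i * int j" by simp
      then have "int j dvd int k" by simp
      then show False using j k by (metis int_dvd_int_iff nat_dvd_not_less)
    qed
    then show ?thesis by blast
  qed
  then obtain k where k: "\<And>e j m. e \<in> E \<Longrightarrow> j > k e \<Longrightarrow> m \<in> M \<Longrightarrow> m [^] (j::nat) \<noteq> e" by metis
  \<comment> \<open>This exponent exceeds \<open>k e\<close> for every \<open>e\<close> in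
    \<open>E\<close> at once.\<close>
  have "m [^] (Suc (sum k E)) \<notin> E" if "m \<in> M" for m
  proof
    assume "m [^] (Suc (sum k E)) \<in> E"
    moreover from this have "k (m [^] (Suc (sum k E))) \<le> sum k E" using E(1) by (intro member_le_sum) auto
    ultimately show False using k that by (metis le_imp_less_Suc)
  qed
  then show ?thesis by blast
qed

section \<open>Collapsing double cosets\<close>

text \<open>A complement of \<open>S \<inter> M\<close> in the abelian group \<open>M\<close> up to
  finite index: the last clause puts a fixed power of every element of \<open>M\<close> into
  \<open>R (S \<inter> M)\<close>. The other clauses make it compatible with the whole of
  \<open>S\<close>.\<close>

definition complement_in :: "'a set \<Rightarrow> 'a set \<Rightarrow> 'a set \<Rightarrow> bool" where
  "complement_in M S R \<longleftrightarrow> subgroup R G \<and> R \<subseteq> M \<and> (\<forall>s\<in>S. \<forall>r\<in>R. s \<otimes> r \<otimes> inv s \<in> R) \<and> R \<inter> S = {\<one>} \<and>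
    (\<exists>k>0. \<forall>m\<in>M. \<exists>r\<in>R. \<exists>w\<in>S \<inter> M. m [^] (k::nat) = r \<otimes> w)"

definition conj_set :: "'a \<Rightarrow> 'a set \<Rightarrow> 'a set" where
  "conj_set p R = (\<lambda>r. p \<otimes> r \<otimes> inv p) ` R"

lemma conj_set_subgroup:
  assumes "subgroup R G" "p \<in> carrier G"
  shows "subgroup (conj_set p R) G"
proof (rule subgroupI)
  have c: "R \<subseteq> carrier G" using subgroup.subset[OF assms(1)] .
  show "conj_set p R \<subseteq> carrier G" using c assms by (auto simp: conj_set_def)
  show "conj_set p R \<noteq> {}" using subgroup.one_closed[OF assms(1)] by (auto simp: conj_set_def)
  fix a b assume "a \<in> conj_set p R" "b \<in> conj_set p R"
  then obtain x y where xy: "x \<in> R" "y \<in> R" "a = p \<otimes> x \<otimes> inv p" "b = p \<otimes> y \<otimes> inv p" by (auto simp: conj_set_def)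
  have "a \<otimes> b = p \<otimes> (x \<otimes> y) \<otimes> inv p"
    using xy c assms by (simp add: group_normalize subset_iff)
  then show "a \<otimes> b \<in> conj_set p R"
    using xy subgroup.m_closed[OF assms(1)] by (auto simp: conj_set_def)
next
  have c: "R \<subseteq> carrier G" using subgroup.subset[OF assms(1)] .
  fix a assume "a \<in> conj_set p R"
  then obtain x where x: "x \<in> R" "a = p \<otimes> x \<otimes> inv p" by (auto simp: conj_set_def)
  have "inv a = p \<otimes> inv x \<otimes> inv p" using x c assms by (simp add: group_normalize subset_iff)
  then show "inv a \<in> conj_set p R" using x subgroup.m_inv_closed[OF assms(1)] by (auto simp: conj_set_def)
qed

lemma conj_set_conj_set:
  assumes "R \<subseteq> carrier G" "p \<in> carrier G" "q \<in> carrier G"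
  shows "conj_set p (conj_set q R) = conj_set (p \<otimes> q) R"
  unfolding conj_set_def image_image
  by (rule image_cong) (use assms in \<open>auto simp: group_normalize subset_iff\<close>)

lemma conj_set_eq:
  assumes "subgroup S G" "R \<subseteq> carrier G" "s \<in> S" "\<And>s r. \<lbrakk>s \<in> S; r \<in> R\<rbrakk> \<Longrightarrow> s \<otimes> r \<otimes> inv s \<in> R"
  shows "conj_set s R = R"
proof
  show "conj_set s R \<subseteq> R" using assms by (auto simp: conj_set_def)
  show "R \<subseteq> conj_set s R"
  proof
    fix r assume r: "r \<in> R"
    have si: "inv s \<in> S" "s \<in> carrier G"
      using subgroup.m_inv_closed[OF assms(1)] subgroup.mem_carrier[OF assms(1)] assms(3) by auto
    have "inv s \<otimes> r \<otimes> inv (inv s) \<in> R" by (rule assms(4)[OF si(1) r])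
    moreover have "r = s \<otimes> (inv s \<otimes> r \<otimes> inv (inv s)) \<otimes> inv s"
      using si r assms(2) by (simp add: group_normalize subset_iff)
    ultimately show "r \<in> conj_set s R" unfolding conj_set_def by blast
  qed
qed

text \<open>\<open>M\<close> is abelian, so it acts trivially on itself, and conjugation by
  \<open>P\<close> on \<open>M\<close> factors through the finite quotient of \<open>P\<close> by
  \<open>M\<close>.\<close>

lemma lattice_conj_finite:
  assumes "subgroup P G" "lattice_in M P" "S \<subseteq> P"
  shows "finite ((\<lambda>s. \<lambda>m\<in>M. s \<otimes> m \<otimes> inv s) ` S)"
proof -
  have M: "subgroup M G" "M \<subseteq> P" "commuting G M" "fidx G M P" "\<And>p m. p \<in> P \<Longrightarrow> m \<in> M \<Longrightarrow> p \<otimes> m \<otimes> inv p \<in> M"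
    using assms(2) by (auto simp: lattice_in_def)
  have Pc: "P \<subseteq> carrier G" and Mc: "M \<subseteq> carrier G" using subgroup.subset[OF assms(1)] subgroup.subset[OF M(1)] .
  obtain F where F: "finite F" "F \<subseteq> P" "\<forall>v\<in>P. \<exists>f\<in>F. v \<otimes> inv f \<in> M"
    using fidx_transversal[OF M(1) Pc M(4)] by blast
  have "(\<lambda>s. \<lambda>m\<in>M. s \<otimes> m \<otimes> inv s) ` S \<subseteq> (\<lambda>s. \<lambda>m\<in>M. s \<otimes> m \<otimes> inv s) ` F"
  proof
    fix y assume "y \<in> (\<lambda>s. \<lambda>m\<in>M. s \<otimes> m \<otimes> inv s) ` S"
    then obtain s where s: "s \<in> P" "y = (\<lambda>m\<in>M. s \<otimes> m \<otimes> inv s)" using assms(3) by blast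
    obtain f where f: "f \<in> F" "s \<otimes> inv f \<in> M" using F s by blast
    have "s \<otimes> m \<otimes> inv s = f \<otimes> m \<otimes> inv f" if m: "m \<in> M" for m
    proof -
      have c: "s \<in> carrier G" "f \<in> carrier G" "m \<in> carrier G" using s f m F Pc Mc by auto
      have fm: "f \<otimes> m \<otimes> inv f \<in> M" using M(5) f F m by blast
      have "s \<otimes> m \<otimes> inv s = (s \<otimes> inv f) \<otimes> (f \<otimes> m \<otimes> inv f) \<otimes> inv (s \<otimes> inv f)"
        using c by (simp add: group_normalize)
      also have "\<dots> = (f \<otimes> m \<otimes> inv f) \<otimes> (s \<otimes> inv f) \<otimes> inv (s \<otimes> inv f)"
        using commutingD[OF M(3) f(2) fm] by simp
      also have "\<dots> = f \<otimes> m \<otimes> inv f" using c by (simp add: group_normalize)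
      finally show ?thesis .
    qed
    then have "y = (\<lambda>m\<in>M. f \<otimes> m \<otimes> inv f)" unfolding s(2) by (intro restrict_ext)
    then show "y \<in> (\<lambda>s. \<lambda>m\<in>M. s \<otimes> m \<otimes> inv s) ` F" using f(1) by blast
  qed
  then show ?thesis using F(1) finite_surj by blast
qed

end

text \<open>\<open>P\<close> stands for either factor. \<open>D\<close> records that
  \<open>H\<close> contains a subgroup of finite index of \<open>N\<close>; its normality in
  \<open>G\<close> places it in every conjugate of \<open>H\<close> as well. \<open>C\<close> holds
  the finitely many elements whose blocks must not be merged by accident.\<close>

locale block_data = group G for G (structure) +
  fixes N H D P M C
  assumes P: "subgroup P G" and N: "N \<lhd> G" "N \<subseteq> P" and H: "subgroup H G"
    and D: "D \<lhd> G" "D \<subseteq> N" "D \<subseteq> H" "fidx G D N"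
    and M: "lattice_in M P"
    and C: "finite C" "C \<subseteq> carrier G"
begin

text \<open>The stabilizer in \<open>P\<close> of the coset \<open>x H\<close>, that is, the
  intersection of \<open>P\<close> with the conjugate of \<open>H\<close> by
  \<open>x\<close>.\<close>

definition stab :: "'a \<Rightarrow> 'a set" where
  "stab x = {s \<in> P. inv x \<otimes> s \<otimes> x \<in> H}"

lemma subsets: "P \<subseteq> carrier G" "N \<subseteq> carrier G" "H \<subseteq> carrier G" "M \<subseteq> carrier G" "D \<subseteq> carrier G"
  using subgroup.subset[OF P] subgroup.subset[OF H] N D M by (auto simp: lattice_in_def)

lemma in_carrier: "p \<in> P \<Longrightarrow> p \<in> carrier G" "n \<in> N \<Longrightarrow> n \<in> carrier G" "h \<in> H \<Longrightarrow> h \<in> carrier G" "m \<in> M \<Longrightarrow> m \<in> carrier G"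
  using subsets by auto

lemma stab_subgroup:
  assumes "x \<in> carrier G"
  shows "subgroup (stab x) G"
proof (rule subgroupI)
  show "stab x \<subseteq> carrier G" using subsets by (auto simp: stab_def)
  have "\<one> \<in> stab x" using assms subgroup.one_closed[OF P] subgroup.one_closed[OF H] by (simp add: stab_def)
  then show "stab x \<noteq> {}" by blast
  fix a b assume ab: "a \<in> stab x" "b \<in> stab x"
  have "inv x \<otimes> (a \<otimes> b) \<otimes> x = (inv x \<otimes> a \<otimes> x) \<otimes> (inv x \<otimes> b \<otimes> x)"
    using ab assms in_carrier by (simp add: stab_def group_normalize)
  then show "a \<otimes> b \<in> stab x"
    using ab subgroup.m_closed[OF P] subgroup.m_closed[OF H] by (simp add: stab_def)
next
  fix a assume a: "a \<in> stab x"
  have "inv x \<otimes> inv a \<otimes> x = inv (inv x \<otimes> a \<otimes> x)"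
    using a assms in_carrier by (simp add: stab_def group_normalize)
  then show "inv a \<in> stab x"
    using a subgroup.m_inv_closed[OF P] subgroup.m_inv_closed[OF H] by (simp add: stab_def)
qed

lemma stab_translate:
  assumes "x \<in> carrier G" "p \<in> P" "h \<in> H"
  shows "stab (p \<otimes> x \<otimes> h) = conj_set p (stab x)"
proof -
  have c: "p \<in> carrier G" "h \<in> carrier G" using assms in_carrier by auto
  have key: "inv (p \<otimes> x \<otimes> h) \<otimes> s \<otimes> (p \<otimes> x \<otimes> h) \<in> H \<longleftrightarrow> inv x \<otimes> (inv p \<otimes> s \<otimes> p) \<otimes> x \<in> H" if "s \<in> P" for s
  proof -
    let ?y = "inv x \<otimes> (inv p \<otimes> s \<otimes> p) \<otimes> x"
    have sc: "s \<in> carrier G" using that in_carrier by auto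
    have "inv (p \<otimes> x \<otimes> h) \<otimes> s \<otimes> (p \<otimes> x \<otimes> h) = inv h \<otimes> ?y \<otimes> h"
      using sc c assms by (simp add: group_normalize)
    moreover have "?y = h \<otimes> (inv h \<otimes> ?y \<otimes> h) \<otimes> inv h"
      using sc c assms by (simp add: group_normalize)
    ultimately show ?thesis
      using assms(3) subgroup.m_closed[OF H] subgroup.m_inv_closed[OF H] by metis
  qed
  show ?thesis
  proof
    show "stab (p \<otimes> x \<otimes> h) \<subseteq> conj_set p (stab x)"
    proof
      fix s assume s: "s \<in> stab (p \<otimes> x \<otimes> h)"
      have sP: "s \<in> P" "s \<in> carrier G" using s in_carrier by (auto simp: stab_def)
      have "inv p \<otimes> s \<otimes> p \<in> stab x"
        using s key[OF sP(1)] assms subgroup.m_closed[OF P] subgroup.m_inv_closed[OF P] by (simp add: stab_def)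
      moreover have "s = p \<otimes> (inv p \<otimes> s \<otimes> p) \<otimes> inv p" using sP c by (simp add: group_normalize)
      ultimately show "s \<in> conj_set p (stab x)" unfolding conj_set_def by blast
    qed
    show "conj_set p (stab x) \<subseteq> stab (p \<otimes> x \<otimes> h)"
    proof
      fix s assume "s \<in> conj_set p (stab x)"
      then obtain t where t: "t \<in> stab x" "s = p \<otimes> t \<otimes> inv p" by (auto simp: conj_set_def)
      have tP: "t \<in> P" "t \<in> carrier G" using t in_carrier by (auto simp: stab_def)
      have "s \<in> P" using tP t assms subgroup.m_closed[OF P] subgroup.m_inv_closed[OF P] by simp
      moreover have "inv p \<otimes> s \<otimes> p = t" using tP c t by (simp add: group_normalize)
      ultimately show "s \<in> stab (p \<otimes> x \<otimes> h)" using key[of s] t by (simp add: stab_def)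
    qed
  qed
qed

lemma M_facts: "subgroup M G" "M \<subseteq> P" "commuting G M" "fg_subgroup M G" "torsion_free G M"
  "fidx G M P" "\<And>p m. p \<in> P \<Longrightarrow> m \<in> M \<Longrightarrow> p \<otimes> m \<otimes> inv p \<in> M"
  using M by (auto simp: lattice_in_def)

lemma complement_exists:
  assumes "x \<in> carrier G"
  shows "\<exists>R. complement_in M (stab x) R"
proof -
  have "stab x \<subseteq> P" by (auto simp: stab_def)
  then show ?thesis unfolding complement_in_def
    by (intro invariant_complement M_facts stab_subgroup assms lattice_conj_finite[OF P M]) auto
qed

lemma complement_translate:
  assumes "complement_in M S R" "p \<in> P" "S \<subseteq> carrier G"
  shows "complement_in M (conj_set p S) (conj_set p R)"
proof -
  have p: "p \<in> carrier G" using assms in_carrier by auto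
  have R: "subgroup R G" "R \<subseteq> M" "\<And>s r. s \<in> S \<Longrightarrow> r \<in> R \<Longrightarrow> s \<otimes> r \<otimes> inv s \<in> R" "R \<inter> S = {\<one>}"
    using assms by (auto simp: complement_in_def)
  obtain k where k: "k > 0" "\<And>m. m \<in> M \<Longrightarrow> \<exists>r\<in>R. \<exists>w\<in>S \<inter> M. m [^] (k::nat) = r \<otimes> w"
    using assms(1) by (auto simp: complement_in_def)
  have Rc: "R \<subseteq> carrier G" using R in_carrier by auto
  have "\<exists>r\<in>conj_set p R. \<exists>w\<in>conj_set p S \<inter> M. m [^] k = r \<otimes> w" if m: "m \<in> M" for m
  proof -
    have pi: "inv p \<in> P" using subgroup.m_inv_closed[OF P] assms by blast
    then have m': "inv p \<otimes> m \<otimes> inv (inv p) \<in> M" using M_facts m by blast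
    then obtain r w where rw: "r \<in> R" "w \<in> S" "w \<in> M" "(inv p \<otimes> m \<otimes> inv (inv p)) [^] k = r \<otimes> w"
      using k(2) by blast
    have c: "r \<in> carrier G" "w \<in> carrier G" "m \<in> carrier G" using rw Rc in_carrier m by auto
    have "m [^] k = p \<otimes> (inv p \<otimes> m \<otimes> inv (inv p)) [^] k \<otimes> inv p"
    proof -
      have "p \<otimes> (inv p \<otimes> m \<otimes> inv (inv p)) [^] k \<otimes> inv p = (p \<otimes> (inv p \<otimes> m \<otimes> inv (inv p)) \<otimes> inv p) [^] k"
        using c p by (intro conj_pow) auto
      also have "p \<otimes> (inv p \<otimes> m \<otimes> inv (inv p)) \<otimes> inv p = m" using c p by (simp add: group_normalize)
      finally show ?thesis by simp
    qed
    also have "\<dots> = (p \<otimes> r \<otimes> inv p) \<otimes> (p \<otimes> w \<otimes> inv p)" unfolding rw(4) using c p by (simp add: group_normalize)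
    finally show ?thesis using rw M_facts(7)[OF assms(2) rw(3)] unfolding conj_set_def by blast
  qed
  moreover have "conj_set p R \<subseteq> M" using R M_facts assms by (auto simp: conj_set_def)
  moreover have "s \<otimes> r \<otimes> inv s \<in> conj_set p R" if sr0: "s \<in> conj_set p S" "r \<in> conj_set p R" for s r
  proof -
    obtain s' r' where sr: "s' \<in> S" "r' \<in> R" "s = p \<otimes> s' \<otimes> inv p" "r = p \<otimes> r' \<otimes> inv p"
      using sr0 by (auto simp: conj_set_def)
    have "s \<otimes> r \<otimes> inv s = p \<otimes> (s' \<otimes> r' \<otimes> inv s') \<otimes> inv p"
      using sr assms(3) Rc p by (simp add: group_normalize subset_iff)
    then show ?thesis using R(3) sr by (auto simp: conj_set_def)
  qed
  moreover have "conj_set p R \<inter> conj_set p S = {\<one>}"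
  proof
    show "conj_set p R \<inter> conj_set p S \<subseteq> {\<one>}"
    proof
      fix y assume "y \<in> conj_set p R \<inter> conj_set p S"
      then obtain r s where rs: "r \<in> R" "s \<in> S" "y = p \<otimes> r \<otimes> inv p" "p \<otimes> r \<otimes> inv p = p \<otimes> s \<otimes> inv p"
        by (auto simp: conj_set_def)
      have c: "r \<in> carrier G" "s \<in> carrier G" using rs Rc assms by auto
      have "r = s" using rs(4) c p by (simp add: m_assoc)
      then have "r = \<one>" using R(4) rs by blast
      then show "y \<in> {\<one>}" using rs p by simp
    qed
    show "{\<one>} \<subseteq> conj_set p R \<inter> conj_set p S"
      using R(4) p by (auto simp: conj_set_def intro!: image_eqI[of _ _ \<one>])
  qed
  ultimately show ?thesis unfolding complement_in_def using conj_set_subgroup[OF R(1) p] k(1) by blast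
qed

text \<open>A complement is chosen at one representative of each double coset \<open>P x H\<close>
  and conjugated to the other elements. The conjugating element is unique up to the stabilizer of
  the representative, which normalizes the chosen complement, so the result is well defined.\<close>

lemma equivariant_complements:
  "\<exists>R. (\<forall>x\<in>carrier G. complement_in M (stab x) (R x)) \<and>
    (\<forall>x\<in>carrier G. \<forall>p\<in>P. \<forall>h\<in>H. R (p \<otimes> x \<otimes> h) = conj_set p (R x))"
proof -
  obtain Q where Q: "\<And>x. x \<in> carrier G \<Longrightarrow> complement_in M (stab x) (Q x)"
    using complement_exists by metis
  define dc where "dc x = {p \<otimes> x \<otimes> h | p h. p \<in> P \<and> h \<in> H}" for x
  have dc_self: "x \<in> dc x" if "x \<in> carrier G" for x
  proof -
    have "x = \<one> \<otimes> x \<otimes> \<one>" using that by simp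
    then show ?thesis unfolding dc_def using subgroup.one_closed[OF P] subgroup.one_closed[OF H] by blast
  qed
  have dc_sub: "dc (p \<otimes> x \<otimes> h) \<subseteq> dc x" if "x \<in> carrier G" "p \<in> P" "h \<in> H" for x p h
  proof
    fix y assume "y \<in> dc (p \<otimes> x \<otimes> h)"
    then obtain p' h' where y: "p' \<in> P" "h' \<in> H" "y = p' \<otimes> (p \<otimes> x \<otimes> h) \<otimes> h'" by (auto simp: dc_def)
    have "y = (p' \<otimes> p) \<otimes> x \<otimes> (h \<otimes> h')" using y that in_carrier by (simp add: group_normalize)
    then show "y \<in> dc x" using y that subgroup.m_closed[OF P] subgroup.m_closed[OF H] unfolding dc_def by blast
  qed
  have dc_eq: "dc (p \<otimes> x \<otimes> h) = dc x" if "x \<in> carrier G" "p \<in> P" "h \<in> H" for x p h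
  proof
    have "x = inv p \<otimes> (p \<otimes> x \<otimes> h) \<otimes> inv h" using that in_carrier by (simp add: group_normalize)
    then show "dc x \<subseteq> dc (p \<otimes> x \<otimes> h)"
      using dc_sub[of "p \<otimes> x \<otimes> h" "inv p" "inv h"] that in_carrier subgroup.m_inv_closed[OF P] subgroup.m_inv_closed[OF H]
      by simp
  qed (rule dc_sub[OF that])
  \<comment> \<open>The choice sees only the set \<open>dc x\<close>, hence is the same for all
    elements of a double coset.\<close>
  define rep where "rep x = (SOME y. y \<in> dc x)" for x
  have rep: "rep x \<in> dc x" if "x \<in> carrier G" for x unfolding rep_def using dc_self[OF that] by (rule someI)
  have repc: "rep x \<in> carrier G" if "x \<in> carrier G" for x using rep[OF that] that in_carrier by (auto simp: dc_def)
  have ex: "\<exists>p. p \<in> P \<and> (\<exists>h\<in>H. x = p \<otimes> rep x \<otimes> h)" if x: "x \<in> carrier G" for x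
  proof -
    obtain p h where ph: "p \<in> P" "h \<in> H" "rep x = p \<otimes> x \<otimes> h" using rep[OF x] by (auto simp: dc_def)
    then have "x = inv p \<otimes> rep x \<otimes> inv h" using x in_carrier by (simp add: group_normalize)
    then show ?thesis using ph subgroup.m_inv_closed[OF P] subgroup.m_inv_closed[OF H] by blast
  qed
  define R where "R x = conj_set (SOME p. p \<in> P \<and> (\<exists>h\<in>H. x = p \<otimes> rep x \<otimes> h)) (Q (rep x))" for x
  have Req: "R x = conj_set p (Q (rep x))" if x: "x \<in> carrier G" and p: "p \<in> P" "h \<in> H" "x = p \<otimes> rep x \<otimes> h" for x p h
  proof -
    define q where "q = (SOME p. p \<in> P \<and> (\<exists>h\<in>H. x = p \<otimes> rep x \<otimes> h))"
    obtain h' where q: "q \<in> P" "h' \<in> H" "x = q \<otimes> rep x \<otimes> h'"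
      using someI_ex[OF ex[OF x]] unfolding q_def by blast
    let ?s = "inv p \<otimes> q" and ?g = "rep x"
    have c: "p \<in> carrier G" "q \<in> carrier G" "h \<in> carrier G" "h' \<in> carrier G" "?g \<in> carrier G"
      using p q in_carrier repc[OF x] by auto
    have "inv ?g \<otimes> ?s \<otimes> ?g = inv ?g \<otimes> inv p \<otimes> (q \<otimes> ?g \<otimes> h') \<otimes> inv h'" using c by (simp add: group_normalize)
    also have "\<dots> = inv ?g \<otimes> inv p \<otimes> (p \<otimes> ?g \<otimes> h) \<otimes> inv h'" using p q by metis
    also have "\<dots> = h \<otimes> inv h'" using c by (simp add: group_normalize)
    finally have "?s \<in> stab ?g"
      using p q subgroup.m_closed[OF P] subgroup.m_inv_closed[OF P] subgroup.m_closed[OF H] subgroup.m_inv_closed[OF H]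
      by (simp add: stab_def)
    moreover have Qc: "subgroup (Q ?g) G" "\<And>s r. s \<in> stab ?g \<Longrightarrow> r \<in> Q ?g \<Longrightarrow> s \<otimes> r \<otimes> inv s \<in> Q ?g"
      using Q[OF repc[OF x]] by (auto simp: complement_in_def)
    ultimately have "conj_set ?s (Q ?g) = Q ?g"
      using conj_set_eq[OF stab_subgroup[OF repc[OF x]] subgroup.subset[OF Qc(1)]] by blast
    then have "conj_set p (Q ?g) = conj_set (p \<otimes> ?s) (Q ?g)"
      using conj_set_conj_set[OF subgroup.subset[OF Qc(1)], of p ?s] c by simp
    moreover have "p \<otimes> ?s = q" using c by simp
    ultimately show ?thesis unfolding R_def q_def[symmetric] by simp
  qed
  have rep_eq: "rep (p \<otimes> x \<otimes> h) = rep x" if "x \<in> carrier G" "p \<in> P" "h \<in> H" for x p h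
    unfolding rep_def dc_eq[OF that] ..
  have "complement_in M (stab x) (R x)" if x: "x \<in> carrier G" for x
  proof -
    obtain p h where ph: "p \<in> P" "h \<in> H" "x = p \<otimes> rep x \<otimes> h" using ex[OF x] by blast
    have "stab x = conj_set p (stab (rep x))" using stab_translate[OF repc[OF x] ph(1,2)] ph(3) by simp
    then show ?thesis
      using complement_translate[OF Q[OF repc[OF x]] ph(1) subgroup.subset[OF stab_subgroup[OF repc[OF x]]]] Req[OF x ph] by simp
  qed
  moreover have "R (p \<otimes> x \<otimes> h) = conj_set p (R x)" if x: "x \<in> carrier G" "p \<in> P" "h \<in> H" for x p h
  proof -
    obtain q k where qk: "q \<in> P" "k \<in> H" "x = q \<otimes> rep x \<otimes> k" using ex[OF x(1)] by blast
    have c: "p \<in> carrier G" "q \<in> carrier G" "h \<in> carrier G" "k \<in> carrier G" "rep x \<in> carrier G"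
      using x qk in_carrier repc[OF x(1)] by auto
    have "p \<otimes> x \<otimes> h = p \<otimes> (q \<otimes> rep x \<otimes> k) \<otimes> h" using qk(3) by simp
    also have "\<dots> = (p \<otimes> q) \<otimes> rep (p \<otimes> x \<otimes> h) \<otimes> (k \<otimes> h)" unfolding rep_eq[OF x] using c by (simp add: group_normalize)
    finally have "R (p \<otimes> x \<otimes> h) = conj_set (p \<otimes> q) (Q (rep (p \<otimes> x \<otimes> h)))"
      using Req[of "p \<otimes> x \<otimes> h" "p \<otimes> q" "k \<otimes> h"] x qk c subgroup.m_closed[OF P] subgroup.m_closed[OF H] by auto
    moreover have "Q (rep x) \<subseteq> carrier G"
      using Q[OF c(5)] by (auto simp: complement_in_def dest!: subgroup.subset)
    ultimately show ?thesis unfolding rep_eq[OF x] Req[OF x(1) qk] using conj_set_conj_set c by simp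
  qed
  ultimately show ?thesis by blast
qed

text \<open>\<open>stab x\<close> has finite index in \<open>N stab x\<close>, so that a power of \<open>r\<close> lies in \<open>R \<inter> stab x\<close>.\<close>

lemma complement_free:
  assumes x: "x \<in> carrier G" and R: "complement_in M (stab x) R"
    and "r \<in> R" "n \<in> N" "h \<in> H" "r \<otimes> x = n \<otimes> x \<otimes> h"
  shows "r = \<one>"
proof -
  have Rf: "subgroup R G" "R \<subseteq> M" "R \<inter> stab x = {\<one>}" using R by (auto simp: complement_in_def)
  have c: "r \<in> carrier G" "n \<in> carrier G" "h \<in> carrier G" "r \<in> P" "n \<in> P"
    using assms Rf in_carrier M_facts N by auto
  note Ss = stab_subgroup[OF x]
  define U where "U = N <#> stab x"
  have U: "subgroup U G" unfolding U_def by (rule mult_norm_subgroup[OF N(1) Ss])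
  have "fidx G (stab x) U"
  proof -
    have Dsub: "subgroup D G" by (rule normal_imp_subgroup[OF D(1)])
    obtain F where F: "finite F" "F \<subseteq> N" "\<forall>v\<in>N. \<exists>f\<in>F. v \<otimes> inv f \<in> D"
      using fidx_transversal[OF Dsub subsets(2) D(4)] by blast
    show ?thesis
    proof (rule fidx_by_transversal[OF Ss _ F(1)])
      show "U \<subseteq> carrier G" using subgroup.subset[OF U] .
      show "F \<subseteq> carrier G" using F subsets by blast
      fix v assume "v \<in> U"
      then obtain m s where v: "m \<in> N" "s \<in> stab x" "v = m \<otimes> s" by (auto simp: U_def set_mult_def)
      have vc: "m \<in> carrier G" "s \<in> carrier G" using v in_carrier subgroup.mem_carrier[OF Ss] by auto
      have "inv s \<otimes> m \<otimes> s \<in> N" using normal.inv_op_closed1[OF N(1)] v vc by blast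
      then obtain f where f: "f \<in> F" "inv s \<otimes> m \<otimes> s \<otimes> inv f \<in> D" using F by blast
      let ?d = "inv s \<otimes> m \<otimes> s \<otimes> inv f"
      have fc: "f \<in> carrier G" using f F subsets by blast
      \<comment> \<open>Here normality of \<open>D\<close> in \<open>G\<close> enters: its conjugate
        by \<open>x\<close> is still inside \<open>H\<close>, so \<open>D\<close> is contained in
        every stabilizer.\<close>
      have "inv x \<otimes> ?d \<otimes> x \<in> H" using normal.inv_op_closed1[OF D(1)] x f D(3) by blast
      then have "?d \<in> stab x" using f D N by (auto simp: stab_def)
      then have "s \<otimes> ?d \<in> stab x" using v subgroup.m_closed[OF Ss] by blast
      moreover have "s \<otimes> ?d = v \<otimes> inv f" using vc fc v by (simp add: group_normalize)
      ultimately show "\<exists>f\<in>F. v \<otimes> inv f \<in> stab x" using f by auto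
    qed
  qed
  then obtain k where k: "k > 0" "\<And>u. u \<in> U \<Longrightarrow> u [^] (k::nat) \<in> stab x"
    using fidx_common_power[OF Ss U] by blast
  \<comment> \<open>The equation says that \<open>r\<close> and \<open>n\<close> move the coset
    \<open>x H\<close> to the same place, so \<open>r\<close> lies in \<open>N stab x\<close> and a
    positive power of it in the stabilizer.\<close>
  have "inv x \<otimes> (inv n \<otimes> r) \<otimes> x = inv x \<otimes> inv n \<otimes> (r \<otimes> x)" using c x by (simp add: group_normalize)
  also have "\<dots> = h" unfolding assms(6) using c x by (simp add: group_normalize)
  finally have "inv n \<otimes> r \<in> stab x"
    using assms c subgroup.m_closed[OF P] subgroup.m_inv_closed[OF P] by (simp add: stab_def)
  moreover have "r = n \<otimes> (inv n \<otimes> r)" using c by simp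
  ultimately have "r \<in> U" unfolding U_def set_mult_def using assms(4) by blast
  then have "r [^] k \<in> R \<inter> stab x" using k(2) subgroup_nat_pow_closed[OF Rf(1) assms(3)] by blast
  then have "r [^] k = \<one>" using Rf by blast
  then show ?thesis using M_facts(5) k(1) Rf assms(3) unfolding torsion_free_def by blast
qed

lemma complement_powers:
  assumes "complement_in M S R" "j > 0" "subgroup S G"
  shows "complement_in M S (powers G j R)"
proof -
  have R: "subgroup R G" "R \<subseteq> M" "\<And>s r. s \<in> S \<Longrightarrow> r \<in> R \<Longrightarrow> s \<otimes> r \<otimes> inv s \<in> R" "R \<inter> S = {\<one>}"
    using assms by (auto simp: complement_in_def)
  obtain k where k: "k > 0" "\<And>m. m \<in> M \<Longrightarrow> \<exists>r\<in>R. \<exists>w\<in>S \<inter> M. m [^] (k::nat) = r \<otimes> w"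
    using assms(1) by (auto simp: complement_in_def)
  have Rc: "R \<subseteq> carrier G" using R in_carrier by auto
  note pR = powers_subgroup[OF R(1) commuting_subset[OF M_facts(3) R(2)], of j]
  have "\<exists>r\<in>powers G j R. \<exists>w\<in>S \<inter> M. m [^] (k * j) = r \<otimes> w" if m: "m \<in> M" for m
  proof -
    obtain r w where rw: "r \<in> R" "w \<in> S" "w \<in> M" "m [^] k = r \<otimes> w" using k(2)[OF m] by blast
    have c: "r \<in> carrier G" "w \<in> carrier G" "m \<in> carrier G" "r \<in> M" using rw Rc R in_carrier m by auto
    have "m [^] (k * j) = (m [^] k) [^] j" using c by (simp add: nat_pow_pow)
    also have "\<dots> = r [^] j \<otimes> w [^] j" unfolding rw(4)
      using c commutingD[OF M_facts(3) c(4) rw(3)] by (intro pow_mult_distrib) auto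
    finally show ?thesis
      using rw subgroup_nat_pow_closed[OF assms(3)] subgroup_nat_pow_closed[OF M_facts(1)] unfolding powers_def by blast
  qed
  moreover have "s \<otimes> r \<otimes> inv s \<in> powers G j R" if s: "s \<in> S" and r: "r \<in> powers G j R" for s r
    by (rule powers_conj_closed[OF Rc subgroup.mem_carrier[OF assms(3) s] R(3)[OF s] r])
  moreover have "powers G j R \<inter> S = {\<one>}"
    using pR R(4) subgroup.one_closed[OF pR(1)] subgroup.one_closed[OF assms(3)] by blast
  moreover have "k * j > 0" using k assms(2) by simp
  ultimately show ?thesis unfolding complement_in_def using pR R(2) by blast
qed

text \<open>By freeness each coset in question meets the complement in at most one element. As the
  complement is free abelian, passing to a suitable power removes these finitely many elements.\<close>

lemma core_complements:
  "\<exists>R. (\<forall>x\<in>carrier G. complement_in M (stab x) (R x)) \<and>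
    (\<forall>x\<in>carrier G. \<forall>p\<in>P. \<forall>h\<in>H. R (p \<otimes> x \<otimes> h) = conj_set p (R x)) \<and>
    (\<forall>c\<in>C. \<forall>c'\<in>C. \<forall>n\<in>N. \<forall>h\<in>H. \<forall>r\<in>R c'. r \<otimes> c' = n \<otimes> c \<otimes> h \<longrightarrow> r = \<one>)"
proof -
  obtain R where R: "\<And>x. x \<in> carrier G \<Longrightarrow> complement_in M (stab x) (R x)"
    "\<And>x p h. x \<in> carrier G \<Longrightarrow> p \<in> P \<Longrightarrow> h \<in> H \<Longrightarrow> R (p \<otimes> x \<otimes> h) = conj_set p (R x)"
    using equivariant_complements by blast
  have Rs: "subgroup (R x) G" "R x \<subseteq> M" if "x \<in> carrier G" for x
    using R(1)[OF that] by (auto simp: complement_in_def)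
  define B where "B c c' = {r \<in> R c'. \<exists>n\<in>N. \<exists>h\<in>H. r \<otimes> c' = n \<otimes> c \<otimes> h}" for c c'
  \<comment> \<open>If \<open>r c'\<close> and \<open>r' c'\<close> both lie in
    \<open>N c H\<close>, then \<open>inv r' \<otimes> r\<close> moves \<open>c'\<close> inside
    \<open>N c' H\<close>; by freeness it is trivial.\<close>
  have B1: "r = r'" if cc: "c \<in> C" "c' \<in> C" and r: "r \<in> B c c'" "r' \<in> B c c'" for c c' r r'
  proof -
    have cG: "c \<in> carrier G" "c' \<in> carrier G" using cc C by auto
    obtain n h where nh: "n \<in> N" "h \<in> H" "r \<otimes> c' = n \<otimes> c \<otimes> h" using r by (auto simp: B_def)
    obtain n' h' where nh': "n' \<in> N" "h' \<in> H" "r' \<otimes> c' = n' \<otimes> c \<otimes> h'" using r by (auto simp: B_def)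
    have rR: "r \<in> R c'" "r' \<in> R c'" using r by (auto simp: B_def)
    have g: "r \<in> carrier G" "r' \<in> carrier G" "n \<in> carrier G" "n' \<in> carrier G" "h \<in> carrier G" "h' \<in> carrier G"
      using rR Rs[OF cG(2)] nh nh' in_carrier by auto
    let ?m = "inv r' \<otimes> (n' \<otimes> inv n) \<otimes> r'"
    have Ns: "subgroup N G" using normal_imp_subgroup[OF N(1)] .
    have "n' \<otimes> inv n \<in> N" using nh nh' subgroup.m_closed[OF Ns] subgroup.m_inv_closed[OF Ns] by blast
    then have mN: "inv r' \<otimes> (n' \<otimes> inv n) \<otimes> r' \<in> N" using normal.inv_op_closed1[OF N(1) g(2)] by blast
    have cinv: "c = inv n \<otimes> (r \<otimes> c') \<otimes> inv h" unfolding nh(3) using g cG by (simp add: group_normalize)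
    have "r' \<otimes> c' = n' \<otimes> (inv n \<otimes> (r \<otimes> c') \<otimes> inv h) \<otimes> h'" using nh'(3) cinv by simp
    then have "(inv r' \<otimes> r) \<otimes> c' = inv r' \<otimes> (n \<otimes> inv n' \<otimes> (r' \<otimes> c') \<otimes> inv h' \<otimes> h)"
      using g cG by (simp add: group_normalize)
    also have "\<dots> = inv ?m \<otimes> c' \<otimes> (inv h' \<otimes> h)" using g cG by (simp add: group_normalize)
    finally have eq: "(inv r' \<otimes> r) \<otimes> c' = inv ?m \<otimes> c' \<otimes> (inv h' \<otimes> h)" .
    have "inv r' \<otimes> r = \<one>"
      by (rule complement_free[OF cG(2) R(1)[OF cG(2)] _ _ _ eq])
        (use rR nh nh' mN subgroup.m_closed[OF Rs(1)[OF cG(2)]] subgroup.m_inv_closed[OF Rs(1)[OF cG(2)]]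
          subgroup.m_inv_closed[OF Ns] subgroup.m_closed[OF H] subgroup.m_inv_closed[OF H] in blast)+
    then have "inv r' = inv r" using inv_equality[of "inv r'" r] g by simp
    then show ?thesis using g by (metis inv_inv)
  qed
  \<comment> \<open>All nontrivial elements to be avoided, over all pairs from \<open>C\<close>. A
    single exponent has to avoid them all, so that the complements stay equivariant.\<close>
  define E where "E = (\<Union>c\<in>C. \<Union>c'\<in>C. B c c') - {\<one>}"
  have "finite (B c c')" if "c \<in> C" "c' \<in> C" for c c'
  proof (cases "B c c' = {}")
    case False
    then obtain r where "r \<in> B c c'" by blast
    then have "B c c' \<subseteq> {r}" using B1[OF that] by blast
    then show ?thesis by (rule finite_subset) simp
  qed simp
  then have "finite E" unfolding E_def using C by auto
  moreover have "E \<subseteq> M"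
  proof
    fix r assume "r \<in> E"
    then obtain c' where "c' \<in> C" "r \<in> R c'" by (auto simp: E_def B_def)
    then show "r \<in> M" using Rs(2)[of c'] C by auto
  qed
  ultimately obtain j where j: "j > 0" "\<And>m. m \<in> M \<Longrightarrow> m [^] (j::nat) \<notin> E"
    using avoid_powers[OF M_facts(1,3,4,5), of E] by (auto simp: E_def)
  define R' where "R' x = powers G j (R x)" for x
  have "complement_in M (stab x) (R' x)" if "x \<in> carrier G" for x
    unfolding R'_def by (rule complement_powers[OF R(1)[OF that] j(1) stab_subgroup[OF that]])
  moreover have "R' (p \<otimes> x \<otimes> h) = conj_set p (R' x)" if x: "x \<in> carrier G" "p \<in> P" "h \<in> H" for x p h
  proof -
    have "(p \<otimes> r \<otimes> inv p) [^] j = p \<otimes> r [^] j \<otimes> inv p" if "r \<in> R x" for r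
      using conj_pow[of p r j] that x in_carrier subgroup.mem_carrier[OF Rs(1)[OF x(1)]] by simp
    then show ?thesis unfolding R'_def R(2)[OF x] powers_def conj_set_def image_image by (intro image_cong) auto
  qed
  moreover have "r = \<one>"
    if h: "c \<in> C" "c' \<in> C" "n \<in> N" "h \<in> H" "r \<in> R' c'" "r \<otimes> c' = n \<otimes> c \<otimes> h" for c c' n h r
  proof (rule ccontr)
    assume "r \<noteq> \<one>"
    have cG: "c' \<in> carrier G" using that C by auto
    obtain r0 where r0: "r0 \<in> R c'" "r = r0 [^] j" using h by (auto simp: R'_def powers_def)
    then have "r \<in> R c'" "r0 \<in> M" using subgroup_nat_pow_closed[OF Rs(1)[OF cG]] Rs[OF cG] by auto
    then have "r \<in> E" unfolding E_def B_def using that \<open>r \<noteq> \<one>\<close> by blast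
    then show False using j(2) \<open>r0 \<in> M\<close> r0 by blast
  qed
  ultimately show ?thesis by (intro exI[of _ R']) blast
qed

text \<open>\<open>R (stab x \<inter> M)\<close> has finite index in \<open>M\<close>, hence in
  \<open>P\<close>, so finitely many left translates of \<open>R stab x\<close> cover
  \<open>P\<close>. This leaves the collapsed double coset with finitely many
  \<open>H\<close>-orbits.\<close>

lemma complement_cofinite:
  assumes x: "x \<in> carrier G" and R: "complement_in M (stab x) R"
  shows "\<exists>T. finite T \<and> T \<subseteq> P \<and> (\<forall>p\<in>P. \<exists>t\<in>T. \<exists>r\<in>R. \<exists>s\<in>stab x. p = t \<otimes> r \<otimes> s)"
proof -
  have Rf: "subgroup R G" "R \<subseteq> M" using R by (auto simp: complement_in_def)
  obtain k where k: "k > 0" "\<And>m. m \<in> M \<Longrightarrow> \<exists>r\<in>R. \<exists>w\<in>stab x \<inter> M. m [^] (k::nat) = r \<otimes> w"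
    using R by (auto simp: complement_in_def)
  have Ss: "subgroup (stab x \<inter> M) G" using subgroups_Inter_pair[OF stab_subgroup[OF x] M_facts(1)] .
  define U where "U = {r \<otimes> w | r w. r \<in> R \<and> w \<in> stab x \<inter> M}"
  have UM: "U \<subseteq> M" using Rf subgroup.m_closed[OF M_facts(1)] by (auto simp: U_def)
  have Us: "subgroup U G"
  proof (rule subgroupI)
    show "U \<subseteq> carrier G" using UM in_carrier by blast
    show "U \<noteq> {}" using subgroup.one_closed[OF Rf(1)] subgroup.one_closed[OF Ss] by (auto simp: U_def)
    fix a b assume "a \<in> U" "b \<in> U"
    then obtain r w r' w' where a: "r \<in> R" "w \<in> stab x \<inter> M" "a = r \<otimes> w" and b: "r' \<in> R" "w' \<in> stab x \<inter> M" "b = r' \<otimes> w'"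
      unfolding U_def by blast
    have c: "r \<in> carrier G" "w \<in> carrier G" "r' \<in> carrier G" "w' \<in> carrier G" using a b Rf in_carrier by auto
    have "w \<otimes> r' = r' \<otimes> w" using commutingD[OF M_facts(3)] a b Rf by blast
    then have "w \<otimes> (r' \<otimes> w') = r' \<otimes> (w \<otimes> w')" using c by (simp add: m_assoc[symmetric])
    then have "a \<otimes> b = (r \<otimes> r') \<otimes> (w \<otimes> w')" using a b c by (simp add: m_assoc)
    then show "a \<otimes> b \<in> U" using a b subgroup.m_closed[OF Rf(1)] subgroup.m_closed[OF Ss] unfolding U_def by blast
  next
    fix a assume "a \<in> U"
    then obtain r w where a: "r \<in> R" "w \<in> stab x \<inter> M" "a = r \<otimes> w" unfolding U_def by blast
    have c: "r \<in> carrier G" "w \<in> carrier G" using a Rf in_carrier by auto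
    have "a = w \<otimes> r" using commutingD[OF M_facts(3)] a Rf by blast
    then have "inv a = inv r \<otimes> inv w" using c by (simp add: inv_mult_group)
    then show "inv a \<in> U" using a subgroup.m_inv_closed[OF Rf(1)] subgroup.m_inv_closed[OF Ss] unfolding U_def by blast
  qed
  have "m [^] k \<in> U" if "m \<in> M" for m using k(2)[OF that] unfolding U_def by blast
  then have "fidx G U M" using abelian_power_fidx[OF M_facts(1,3,4) Us UM k(1)] by blast
  then have "fidx G U P" by (rule fidx_trans[OF Us M_facts(1) subsets(1) _ M_facts(6)])
  then obtain F where F: "finite F" "F \<subseteq> P" "\<forall>v\<in>P. \<exists>f\<in>F. v \<otimes> inv f \<in> U"
    using fidx_transversal[OF Us subsets(1)] by blast
  have "\<exists>t\<in>m_inv G ` F. \<exists>r\<in>R. \<exists>s\<in>stab x. p = t \<otimes> r \<otimes> s" if p: "p \<in> P" for p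
  proof -
    \<comment> \<open>Transversals represent right cosets, whereas left translates are wanted; hence
      the passage to inverses.\<close>
    obtain f where f: "f \<in> F" "inv p \<otimes> inv f \<in> U" using F subgroup.m_inv_closed[OF P p] by blast
    then have "inv (inv p \<otimes> inv f) \<in> U" using subgroup.m_inv_closed[OF Us] by blast
    moreover have c: "p \<in> carrier G" "f \<in> carrier G" using p f F in_carrier by auto
    ultimately have "f \<otimes> p \<in> U" by (simp add: inv_mult_group)
    then obtain r w where rw: "r \<in> R" "w \<in> stab x \<inter> M" "f \<otimes> p = r \<otimes> w" unfolding U_def by blast
    have "p = inv f \<otimes> (f \<otimes> p)" using c by simp
    also have "\<dots> = inv f \<otimes> r \<otimes> w" unfolding rw(3) using rw c Rf in_carrier by (simp add: m_assoc subset_iff)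
    finally show ?thesis using rw f by blast
  qed
  then show ?thesis using F subgroup.m_inv_closed[OF P] by (intro exI[of _ "m_inv G ` F"]) auto
qed

text \<open>The interface of the collapse: \<open>Bl x\<close> is the point to which
  \<open>x\<close> is collapsed, and from here on these properties stand in for the complements. The
  clause on \<open>C\<close> lets distinct double cosets \<open>N c H\<close> of elements of
  \<open>C\<close> survive in the quotient.\<close>

definition block_map :: "('a \<Rightarrow> 'a set) \<Rightarrow> bool" where
  "block_map Bl \<longleftrightarrow> (\<forall>x\<in>carrier G. Bl x \<subseteq> carrier G) \<and>
    (\<forall>x\<in>carrier G. \<forall>p\<in>P. Bl (p \<otimes> x) = p <# Bl x) \<and>
    (\<forall>x\<in>carrier G. \<forall>h\<in>H. Bl (x \<otimes> h) = Bl x #> h) \<and>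
    (\<forall>x\<in>carrier G. \<forall>y\<in>carrier G. Bl x = Bl y \<longrightarrow> y \<otimes> inv x \<in> M) \<and>
    (\<forall>x\<in>carrier G. \<forall>n\<in>N. \<forall>h\<in>H. Bl (n \<otimes> x \<otimes> h) = Bl x \<longrightarrow> n \<otimes> x \<otimes> h = x) \<and>
    (\<forall>c\<in>C. \<forall>c'\<in>C. \<forall>n\<in>N. \<forall>h\<in>H. Bl (n \<otimes> c \<otimes> h) = Bl c' \<longrightarrow> n \<otimes> c \<otimes> h = c') \<and>
    (\<forall>x\<in>carrier G. \<exists>T. finite T \<and> T \<subseteq> P \<and> (\<forall>p\<in>P. \<exists>t\<in>T. \<exists>h\<in>H. Bl (p \<otimes> x) = Bl (t \<otimes> x \<otimes> h)))"

lemma block_map_exists: "\<exists>Bl. block_map Bl"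
proof -
  obtain R where R0: "\<forall>x\<in>carrier G. complement_in M (stab x) (R x)"
    "\<forall>x\<in>carrier G. \<forall>p\<in>P. \<forall>h\<in>H. R (p \<otimes> x \<otimes> h) = conj_set p (R x)"
    "\<forall>c\<in>C. \<forall>c'\<in>C. \<forall>n\<in>N. \<forall>h\<in>H. \<forall>r\<in>R c'. r \<otimes> c' = n \<otimes> c \<otimes> h \<longrightarrow> r = \<one>"
    using core_complements by (elim exE conjE) (rule that)
  have R: "\<And>x. x \<in> carrier G \<Longrightarrow> complement_in M (stab x) (R x)"
    "\<And>x p h. x \<in> carrier G \<Longrightarrow> p \<in> P \<Longrightarrow> h \<in> H \<Longrightarrow> R (p \<otimes> x \<otimes> h) = conj_set p (R x)"
    "\<And>c c' n h r. c \<in> C \<Longrightarrow> c' \<in> C \<Longrightarrow> n \<in> N \<Longrightarrow> h \<in> H \<Longrightarrow> r \<in> R c' \<Longrightarrow> r \<otimes> c' = n \<otimes> c \<otimes> h \<Longrightarrow> r = \<one>"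
    using R0 by auto
  have Rs: "subgroup (R x) G" "R x \<subseteq> M" "R x \<subseteq> carrier G" if "x \<in> carrier G" for x
    using R(1)[OF that] subgroup.subset by (auto simp: complement_in_def)
  \<comment> \<open>A block is a coset of a complement that moves with \<open>x\<close>;
    equivariance of the complements turns left multiplication by \<open>P\<close> and right
    multiplication by \<open>H\<close> into maps of blocks.\<close>
  define Bl where "Bl x = R x #> x" for x
  have Bc: "Bl x \<subseteq> carrier G" if "x \<in> carrier G" for x
    unfolding Bl_def using r_coset_subset_G[OF Rs(3)[OF that] that] .
  have Bp: "Bl (p \<otimes> x) = p <# Bl x" if x: "x \<in> carrier G" "p \<in> P" for x p
  proof -
    have c: "p \<in> carrier G" using x in_carrier by auto
    have "R (p \<otimes> x) = conj_set p (R x)"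
      using R(2)[OF x subgroup.one_closed[OF H]] x c by simp
    then have "Bl (p \<otimes> x) = (\<lambda>r. p \<otimes> r \<otimes> inv p \<otimes> (p \<otimes> x)) ` R x"
      by (auto simp: Bl_def r_coset_def conj_set_def)
    also have "\<dots> = (\<lambda>r. p \<otimes> (r \<otimes> x)) ` R x"
      using x c Rs(3)[OF x(1)] by (intro image_cong) (auto simp: m_assoc subset_iff)
    also have "\<dots> = p <# Bl x" by (auto simp: Bl_def l_coset_def r_coset_def)
    finally show ?thesis .
  qed
  have Bh: "Bl (x \<otimes> h) = Bl x #> h" if x: "x \<in> carrier G" "h \<in> H" for x h
  proof -
    have "R (\<one> \<otimes> x \<otimes> h) = conj_set \<one> (R x)" by (rule R(2)[OF x(1) subgroup.one_closed[OF P] x(2)])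
    moreover have "conj_set \<one> (R x) = R x"
      using Rs(3)[OF x(1)] by (force simp: conj_set_def subset_iff)
    ultimately have "R (x \<otimes> h) = R x" using x by simp
    then show ?thesis unfolding Bl_def using coset_mult_assoc[OF Rs(3)[OF x(1)] x(1)] x in_carrier by simp
  qed
  have Beq: "\<exists>r\<in>R y. x = r \<otimes> y" if xy: "x \<in> carrier G" "y \<in> carrier G" "Bl x = Bl y" for x y
  proof -
    have "x \<in> Bl x" unfolding Bl_def using rcos_self[OF xy(1) Rs(1)[OF xy(1)]] .
    then show ?thesis using xy(3) by (auto simp: Bl_def r_coset_def)
  qed
  have BM: "y \<otimes> inv x \<in> M" if xy: "x \<in> carrier G" "y \<in> carrier G" "Bl x = Bl y" for x y
  proof -
    obtain r where r: "r \<in> R x" "y = r \<otimes> x" using Beq[OF xy(2,1)] xy by auto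
    then have "y \<otimes> inv x = r" using xy Rs(3)[OF xy(1)] by (auto simp: m_assoc subset_iff)
    then show ?thesis using r Rs(2)[OF xy(1)] by auto
  qed
  have BN: "n \<otimes> x \<otimes> h = x" if a: "x \<in> carrier G" "n \<in> N" "h \<in> H" "Bl (n \<otimes> x \<otimes> h) = Bl x" for x n h
  proof -
    obtain r where r: "r \<in> R x" "n \<otimes> x \<otimes> h = r \<otimes> x" using Beq[OF _ a(1,4)] a in_carrier by auto
    then have "r = \<one>" using complement_free[OF a(1) R(1)[OF a(1)] r(1) a(2,3)] by simp
    then show ?thesis using r a by simp
  qed
  have BC: "n \<otimes> c \<otimes> h = c'" if a: "c \<in> C" "c' \<in> C" "n \<in> N" "h \<in> H" "Bl (n \<otimes> c \<otimes> h) = Bl c'" for c c' n h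
  proof -
    have c: "c \<in> carrier G" "c' \<in> carrier G" using a C by auto
    obtain r where r: "r \<in> R c'" "n \<otimes> c \<otimes> h = r \<otimes> c'" using Beq[OF _ c(2) a(5)] a c in_carrier by auto
    then have "r = \<one>" using R(3)[OF a(1-4) r(1)] by simp
    then show ?thesis using r c by simp
  qed
  have BT: "\<exists>T. finite T \<and> T \<subseteq> P \<and> (\<forall>p\<in>P. \<exists>t\<in>T. \<exists>h\<in>H. Bl (p \<otimes> x) = Bl (t \<otimes> x \<otimes> h))" if x: "x \<in> carrier G" for x
  proof -
    obtain T where T: "finite T" "T \<subseteq> P" "\<forall>p\<in>P. \<exists>t\<in>T. \<exists>r\<in>R x. \<exists>s\<in>stab x. p = t \<otimes> r \<otimes> s"
      using complement_cofinite[OF x R(1)[OF x]] by (elim exE conjE) (rule that)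
    have "\<exists>t\<in>T. \<exists>h\<in>H. Bl (p \<otimes> x) = Bl (t \<otimes> x \<otimes> h)" if p: "p \<in> P" for p
    proof -
      obtain t r s where trs: "t \<in> T" "r \<in> R x" "s \<in> stab x" "p = t \<otimes> r \<otimes> s" using bspec[OF T(3) p] by blast
      define h where "h = inv x \<otimes> s \<otimes> x"
      have hH: "h \<in> H" using trs by (simp add: stab_def h_def)
      have c: "t \<in> carrier G" "r \<in> carrier G" "s \<in> carrier G" "h \<in> carrier G" "t \<in> P" "r \<in> P"
        using trs T Rs[OF x] M_facts in_carrier hH by (auto simp: stab_def)
      have "p \<otimes> x = t \<otimes> (r \<otimes> x) \<otimes> h" unfolding trs(4) h_def using c x by (simp add: m_assoc)
      also have "Bl \<dots> = (t <# Bl (r \<otimes> x)) #> h" using c x hH Bh Bp by simp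
      \<comment> \<open>The factor \<open>r\<close> is absorbed: as an element of \<open>R x\<close>
        it normalizes \<open>R x\<close> and does not change the coset.\<close>
      also have "Bl (r \<otimes> x) = Bl x"
      proof -
        have "R (r \<otimes> x) = R x"
          using R(2)[OF x c(6) subgroup.one_closed[OF H]] x c(2)
            conj_set_eq[OF Rs(1)[OF x] Rs(3)[OF x] trs(2)] subgroup.m_closed[OF Rs(1)[OF x]] subgroup.m_inv_closed[OF Rs(1)[OF x]]
          by simp
        moreover have "R x #> (r \<otimes> x) = R x #> x"
        proof -
          have "R x #> (r \<otimes> x) = (R x #> r) #> x" by (rule coset_mult_assoc[OF Rs(3)[OF x] c(2) x, symmetric])
          also have "R x #> r = R x" by (rule coset_join2[OF c(2) Rs(1)[OF x] trs(2)])
          finally show ?thesis .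
        qed
        ultimately show ?thesis unfolding Bl_def by simp
      qed
      also have "(t <# Bl x) #> h = Bl (t \<otimes> x \<otimes> h)" using Bh Bp x c hH by simp
      finally show ?thesis using trs hH by blast
    qed
    then show ?thesis using T by blast
  qed
  show ?thesis unfolding block_map_def
    by (rule exI[of _ Bl]) (intro conjI ballI impI; (rule Bc Bp Bh BM BN BC BT; assumption))
qed

end

section \<open>Counting orbits of blocks\<close>

text \<open>The matching is forced on the image of \<open>C\<close>, where equal fibres make it well
  defined and injective; the remaining parts have equal cardinality and are matched
  arbitrarily.\<close>

lemma bij_extending:
  assumes "finite I" "finite J" "card I = card J" "f ` C \<subseteq> I" "g ` C \<subseteq> J"
    and eq: "\<And>c c'. \<lbrakk>c \<in> C; c' \<in> C\<rbrakk> \<Longrightarrow> f c = f c' \<longleftrightarrow> g c = g c'"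
  shows "\<exists>\<pi>. bij_betw \<pi> I J \<and> (\<forall>c\<in>C. \<pi> (f c) = g c)"
proof -
  define \<kappa> where "\<kappa> = g \<circ> inv_into C f"
  have \<kappa>: "\<kappa> (f c) = g c" if c: "c \<in> C" for c
  proof -
    have "inv_into C f (f c) \<in> C" "f (inv_into C f (f c)) = f c"
      using c by (auto intro: inv_into_into f_inv_into_f)
    then show ?thesis using eq c by (auto simp: \<kappa>_def)
  qed
  have inj: "inj_on \<kappa> (f ` C)"
  proof (rule inj_onI)
    fix i j assume "i \<in> f ` C" "j \<in> f ` C" "\<kappa> i = \<kappa> j"
    then show "i = j" using \<kappa> eq by (metis imageE)
  qed
  have img: "\<kappa> ` f ` C = g ` C" unfolding image_image by (rule image_cong) (use \<kappa> in simp_all)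
  have "card (f ` C) = card (g ` C)" using card_image[OF inj] img by simp
  then have "card (I - f ` C) = card (J - g ` C)"
    using assms by (simp add: card_Diff_subset finite_subset)
  then obtain \<beta> where \<beta>: "bij_betw \<beta> (I - f ` C) (J - g ` C)"
    using assms(1,2) finite_same_card_bij[of "I - f ` C" "J - g ` C"] by auto
  define \<pi> where "\<pi> i = (if i \<in> f ` C then \<kappa> i else \<beta> i)" for i
  have b1: "bij_betw \<pi> (f ` C) (g ` C)"
    using inj img by (subst bij_betw_cong[of _ _ \<kappa>]) (auto simp: \<pi>_def bij_betw_def)
  have b2: "bij_betw \<pi> (I - f ` C) (J - g ` C)"
    using \<beta> by (subst bij_betw_cong[of _ _ \<beta>]) (auto simp: \<pi>_def)
  have "bij_betw \<pi> (f ` C \<union> (I - f ` C)) (g ` C \<union> (J - g ` C))"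
    by (rule bij_betw_combine[OF b1 b2]) auto
  moreover have "f ` C \<union> (I - f ` C) = I" "g ` C \<union> (J - g ` C) = J" using assms by auto
  ultimately show ?thesis using \<kappa> by (auto simp: \<pi>_def)
qed

text \<open>Equal fibres identify the two images. Equivariance of the resulting bijection can then
  be read off from the parameters.\<close>

lemma bij_of_parametrizations:
  assumes "\<xi> ` Z = S" "\<eta> ` Z = T" and eq: "\<And>z z'. \<lbrakk>z \<in> Z; z' \<in> Z\<rbrakk> \<Longrightarrow> \<xi> z = \<xi> z' \<longleftrightarrow> \<eta> z = \<eta> z'"
  shows "\<exists>f. bij_betw f S T \<and> (\<forall>z\<in>Z. f (\<xi> z) = \<eta> z)"
proof -
  define f where "f = \<eta> \<circ> inv_into Z \<xi>"
  have f: "f (\<xi> z) = \<eta> z" if z: "z \<in> Z" for z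
  proof -
    have "inv_into Z \<xi> (\<xi> z) \<in> Z" "\<xi> (inv_into Z \<xi> (\<xi> z)) = \<xi> z"
      using z by (auto intro: inv_into_into f_inv_into_f)
    then show ?thesis using eq z by (auto simp: f_def)
  qed
  have "inj_on f S"
  proof (rule inj_onI)
    fix i j assume "i \<in> S" "j \<in> S" "f i = f j"
    then show "i = j" unfolding assms(1)[symmetric] using f eq by (metis imageE)
  qed
  moreover have "f ` S = T" unfolding assms(1,2)[symmetric] image_image using f by (intro image_cong) auto
  ultimately show ?thesis using f by (auto simp: bij_betw_def)
qed

definition action :: "('a, 'm) monoid_scheme \<Rightarrow> 'a set \<Rightarrow> 'x set \<Rightarrow> ('a \<Rightarrow> 'x \<Rightarrow> 'x) \<Rightarrow> bool" where
  "action G A S \<theta> \<longleftrightarrow> (\<forall>a\<in>A. \<forall>x\<in>S. \<theta> a x \<in> S) \<and> (\<forall>x\<in>S. \<theta> \<one>\<^bsub>G\<^esub> x = x) \<and>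
     (\<forall>a\<in>A. \<forall>b\<in>A. \<forall>x\<in>S. \<theta> (a \<otimes>\<^bsub>G\<^esub> b) x = \<theta> a (\<theta> b x))"

text \<open>\<open>L\<close> and \<open>C\<close> are common to both factors, only \<open>P\<close>
  and \<open>Bl\<close> change. Since a block never leaves a coset of \<open>L\<close>, the double
  coset of \<open>L\<close> and \<open>H\<close> containing it serves as a type that both factors
  can compare.\<close>

locale block_system = group G for G (structure) +
  fixes N H P L C and Bl :: "'a \<Rightarrow> 'a set"
  assumes P: "subgroup P G" and N: "N \<lhd> G" "N \<subseteq> P" "N \<subseteq> L" and H: "subgroup H G"
    and L: "L \<lhd> G"
    and C: "finite C" "C \<subseteq> carrier G"
      "\<And>x. x \<in> carrier G \<Longrightarrow> \<exists>c\<in>C. \<exists>l\<in>L. \<exists>h\<in>H. x = l \<otimes> c \<otimes> h"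
    and Bl_carrier: "\<And>x. x \<in> carrier G \<Longrightarrow> Bl x \<subseteq> carrier G"
    and Bl_left: "\<And>x p. \<lbrakk>x \<in> carrier G; p \<in> P\<rbrakk> \<Longrightarrow> Bl (p \<otimes> x) = p <# Bl x"
    and Bl_right: "\<And>x h. \<lbrakk>x \<in> carrier G; h \<in> H\<rbrakk> \<Longrightarrow> Bl (x \<otimes> h) = Bl x #> h"
    and Bl_L: "\<And>x y. \<lbrakk>x \<in> carrier G; y \<in> carrier G; Bl x = Bl y\<rbrakk> \<Longrightarrow> y \<otimes> inv x \<in> L"
    and Bl_free: "\<And>x n h. \<lbrakk>x \<in> carrier G; n \<in> N; h \<in> H; Bl (n \<otimes> x \<otimes> h) = Bl x\<rbrakk> \<Longrightarrow> n \<otimes> x \<otimes> h = x"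
    and Bl_core: "\<And>c c' n h. \<lbrakk>c \<in> C; c' \<in> C; n \<in> N; h \<in> H; Bl (n \<otimes> c \<otimes> h) = Bl c'\<rbrakk> \<Longrightarrow> n \<otimes> c \<otimes> h = c'"
    and Bl_cofinite: "\<And>x. x \<in> carrier G \<Longrightarrow>
      \<exists>T. finite T \<and> T \<subseteq> P \<and> (\<forall>p\<in>P. \<exists>t\<in>T. \<exists>h\<in>H. Bl (p \<otimes> x) = Bl (t \<otimes> x \<otimes> h))"
begin

lemma subsets: "P \<subseteq> carrier G" "N \<subseteq> carrier G" "H \<subseteq> carrier G" "L \<subseteq> carrier G"
  using subgroup.subset[OF P] subgroup.subset[OF H] N normal_imp_subgroup[OF L, THEN subgroup.subset] by auto

lemma in_carrier [simp]: "p \<in> P \<Longrightarrow> p \<in> carrier G" "n \<in> N \<Longrightarrow> n \<in> carrier G" "h \<in> H \<Longrightarrow> h \<in> carrier G"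
    "l \<in> L \<Longrightarrow> l \<in> carrier G" "c \<in> C \<Longrightarrow> c \<in> carrier G"
  using subsets C by auto

lemma Ns: "subgroup N G" and Ls: "subgroup L G"
  using normal_imp_subgroup N L by auto

lemmas closed = subgroup.m_closed[OF P] subgroup.m_closed[OF H] subgroup.m_closed[OF Ns] subgroup.m_closed[OF Ls]
  subgroup.m_inv_closed[OF P] subgroup.m_inv_closed[OF H] subgroup.m_inv_closed[OF Ns] subgroup.m_inv_closed[OF Ls]
  subgroup.one_closed[OF P] subgroup.one_closed[OF H] subgroup.one_closed[OF Ns] subgroup.one_closed[OF Ls]

text \<open>The type of \<open>x\<close>. It depends on \<open>L\<close> and \<open>H\<close> but
  neither on \<open>P\<close> nor on \<open>Bl\<close>, so it is the same notion for both
  factors.\<close>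

definition dcoset :: "'a \<Rightarrow> 'a set" where "dcoset x = {l \<otimes> x \<otimes> h | l h. l \<in> L \<and> h \<in> H}"

text \<open>The finitely many double cosets of \<open>P\<close> and \<open>H\<close> that meet the
  core \<open>C\<close>. Only these are collapsed, which keeps the number of \<open>H\<close>-orbits
  finite.\<close>

definition region :: "'a set" where "region = {p \<otimes> c \<otimes> h | p c h. p \<in> P \<and> c \<in> C \<and> h \<in> H}"

definition orb :: "'a \<Rightarrow> 'a set set" where "orb x = {Bl (n \<otimes> x \<otimes> h) | n h. n \<in> N \<and> h \<in> H}"

definition orbits :: "'a set \<Rightarrow> 'a set set set" where "orbits \<tau> = {orb x | x. x \<in> region \<and> dcoset x = \<tau>}"

lemma dcosetI: "l \<in> L \<Longrightarrow> h \<in> H \<Longrightarrow> l \<otimes> x \<otimes> h \<in> dcoset x"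
  by (auto simp: dcoset_def)

lemma regionI: "p \<in> P \<Longrightarrow> c \<in> C \<Longrightarrow> h \<in> H \<Longrightarrow> p \<otimes> c \<otimes> h \<in> region"
  by (auto simp: region_def)

lemma orbI: "n \<in> N \<Longrightarrow> h \<in> H \<Longrightarrow> Bl (n \<otimes> x \<otimes> h) \<in> orb x"
  by (auto simp: orb_def)

lemma region_carrier: "x \<in> region \<Longrightarrow> x \<in> carrier G"
  by (auto simp: region_def)

lemma region_mult:
  assumes "x \<in> region" "p \<in> P" "h \<in> H" shows "p \<otimes> x \<otimes> h \<in> region"
proof -
  obtain q c k where q: "q \<in> P" "c \<in> C" "k \<in> H" "x = q \<otimes> c \<otimes> k" using assms by (auto simp: region_def)
  have "p \<otimes> x \<otimes> h = (p \<otimes> q) \<otimes> c \<otimes> (k \<otimes> h)" using q assms by (simp add: m_assoc)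
  then show ?thesis by (elim ssubst) (intro regionI closed; use q assms in auto)
qed

lemma region_left: "x \<in> region \<Longrightarrow> p \<in> P \<Longrightarrow> p \<otimes> x \<in> region"
  using region_mult[of x p \<one>] closed region_carrier by simp

lemma region_right: "x \<in> region \<Longrightarrow> h \<in> H \<Longrightarrow> x \<otimes> h \<in> region"
  using region_mult[of x \<one> h] closed region_carrier by simp

lemma core_region: "c \<in> C \<Longrightarrow> c \<in> region"
proof -
  assume c: "c \<in> C"
  then have "c = \<one> \<otimes> c \<otimes> \<one>" by simp
  then show "c \<in> region" using regionI[OF _ c] closed by metis
qed

lemma dcoset_mult:
  assumes "x \<in> carrier G" "l \<in> L" "h \<in> H" shows "dcoset (l \<otimes> x \<otimes> h) = dcoset x"
proof
  show "dcoset (l \<otimes> x \<otimes> h) \<subseteq> dcoset x"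
  proof
    fix y assume "y \<in> dcoset (l \<otimes> x \<otimes> h)"
    then obtain k g where k: "k \<in> L" "g \<in> H" "y = k \<otimes> (l \<otimes> x \<otimes> h) \<otimes> g" by (auto simp: dcoset_def)
    then have "y = (k \<otimes> l) \<otimes> x \<otimes> (h \<otimes> g)" using assms by (simp add: m_assoc)
    then show "y \<in> dcoset x" by (elim ssubst) (intro dcosetI closed; use k assms in auto)
  qed
  show "dcoset x \<subseteq> dcoset (l \<otimes> x \<otimes> h)"
  proof
    fix y assume "y \<in> dcoset x"
    then obtain k g where k: "k \<in> L" "g \<in> H" "y = k \<otimes> x \<otimes> g" by (auto simp: dcoset_def)
    then have "y = (k \<otimes> inv l) \<otimes> (l \<otimes> x \<otimes> h) \<otimes> (inv h \<otimes> g)" using assms by (simp add: m_assoc)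
    then show "y \<in> dcoset (l \<otimes> x \<otimes> h)" by (elim ssubst) (intro dcosetI closed; use k assms in auto)
  qed
qed

lemma dcoset_self: "x \<in> carrier G \<Longrightarrow> x \<in> dcoset x"
proof -
  assume x: "x \<in> carrier G"
  then have "x = \<one> \<otimes> x \<otimes> \<one>" by simp
  then show "x \<in> dcoset x" using dcosetI closed by metis
qed

lemma dcoset_eqD: "x \<in> carrier G \<Longrightarrow> y \<in> carrier G \<Longrightarrow> dcoset x = dcoset y \<Longrightarrow> \<exists>l\<in>L. \<exists>h\<in>H. y = l \<otimes> x \<otimes> h"
proof -
  assume "y \<in> carrier G" "dcoset x = dcoset y"
  then have "y \<in> dcoset x" using dcoset_self by simp
  then show ?thesis unfolding dcoset_def by blast
qed

lemma dcoset_right: "x \<in> carrier G \<Longrightarrow> h \<in> H \<Longrightarrow> dcoset (x \<otimes> h) = dcoset x"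
  using dcoset_mult[of x \<one> h] closed by simp

lemma dcoset_Bl:
  assumes "x \<in> carrier G" "y \<in> carrier G" "Bl x = Bl y" shows "dcoset x = dcoset y"
proof -
  have "y = (y \<otimes> inv x) \<otimes> x \<otimes> \<one>" using assms by (simp add: m_assoc)
  then show ?thesis using dcoset_mult[of x "y \<otimes> inv x" \<one>] Bl_L[OF assms] assms closed by metis
qed

text \<open>Normality of \<open>L\<close> lets every \<open>g\<close> in \<open>G\<close> permute
  the types. Left multiplication by \<open>P\<close> may well change the type.\<close>

lemma dcoset_left_cong:
  assumes "x \<in> carrier G" "y \<in> carrier G" "g \<in> carrier G" "dcoset x = dcoset y" shows "dcoset (g \<otimes> x) = dcoset (g \<otimes> y)"
proof -
  obtain l h where lh: "l \<in> L" "h \<in> H" "y = l \<otimes> x \<otimes> h" using dcoset_eqD[OF assms(1,2,4)] by blast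
  have "g \<otimes> l \<otimes> inv g \<in> L" using normal.inv_op_closed2[OF L] assms lh by blast
  moreover have "g \<otimes> y = (g \<otimes> l \<otimes> inv g) \<otimes> (g \<otimes> x) \<otimes> h" using lh assms by (simp add: m_assoc)
  ultimately show ?thesis using dcoset_mult[of "g \<otimes> x" "g \<otimes> l \<otimes> inv g" h] lh assms by simp
qed

lemma types_finite: "finite (dcoset ` carrier G)"
proof -
  have "dcoset ` carrier G \<subseteq> dcoset ` C"
  proof
    fix \<tau> assume "\<tau> \<in> dcoset ` carrier G"
    then obtain x where x: "x \<in> carrier G" "\<tau> = dcoset x" by blast
    obtain c l h where "c \<in> C" "l \<in> L" "h \<in> H" "x = l \<otimes> c \<otimes> h" using C(3)[OF x(1)] by blast
    then show "\<tau> \<in> dcoset ` C" using x dcoset_mult by auto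
  qed
  then show ?thesis using C(1) finite_surj by blast
qed

lemma Bl_mult: "x \<in> carrier G \<Longrightarrow> p \<in> P \<Longrightarrow> h \<in> H \<Longrightarrow> Bl (p \<otimes> x \<otimes> h) = (p <# Bl x) #> h"
  using Bl_left Bl_right by simp

lemma NP: "n \<in> N \<Longrightarrow> n \<in> P" and NL: "n \<in> N \<Longrightarrow> n \<in> L" using N by auto

lemma orb_eqI:
  assumes "x \<in> carrier G" "y \<in> carrier G" "n \<in> N" "h \<in> H" "Bl y = Bl (n \<otimes> x \<otimes> h)"
  shows "orb y = orb x"
proof
  show "orb y \<subseteq> orb x"
  proof
    fix b assume "b \<in> orb y"
    then obtain m k where m: "m \<in> N" "k \<in> H" "b = Bl (m \<otimes> y \<otimes> k)" by (auto simp: orb_def)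
    have "b = Bl (m \<otimes> (n \<otimes> x \<otimes> h) \<otimes> k)" using m assms NP by (simp only: Bl_mult in_carrier m_closed)
    also have "m \<otimes> (n \<otimes> x \<otimes> h) \<otimes> k = (m \<otimes> n) \<otimes> x \<otimes> (h \<otimes> k)" using m assms by (simp add: m_assoc)
    finally show "b \<in> orb x" by (elim ssubst) (intro orbI closed; use m assms in auto)
  qed
  show "orb x \<subseteq> orb y"
  proof
    fix b assume "b \<in> orb x"
    then obtain m k where m: "m \<in> N" "k \<in> H" "b = Bl (m \<otimes> x \<otimes> k)" by (auto simp: orb_def)
    have "m \<otimes> x \<otimes> k = (m \<otimes> inv n) \<otimes> (n \<otimes> x \<otimes> h) \<otimes> (inv h \<otimes> k)" using m assms by (simp add: m_assoc)
    then have "b = Bl ((m \<otimes> inv n) \<otimes> (n \<otimes> x \<otimes> h) \<otimes> (inv h \<otimes> k))" using m by simp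
    also have "\<dots> = Bl ((m \<otimes> inv n) \<otimes> y \<otimes> (inv h \<otimes> k))"
      using m assms NP closed by (simp only: Bl_mult in_carrier m_closed)
    finally show "b \<in> orb y" by (elim ssubst) (intro orbI closed; use m assms in auto)
  qed
qed

lemma orb_mult: "x \<in> carrier G \<Longrightarrow> n \<in> N \<Longrightarrow> h \<in> H \<Longrightarrow> orb (n \<otimes> x \<otimes> h) = orb x"
  by (rule orb_eqI) auto

lemma Bl_in_orb: "x \<in> carrier G \<Longrightarrow> Bl x \<in> orb x"
proof -
  assume x: "x \<in> carrier G"
  then have "Bl x = Bl (\<one> \<otimes> x \<otimes> \<one>)" by simp
  then show "Bl x \<in> orb x" using orbI closed by metis
qed

lemma orb_eqD: "x \<in> carrier G \<Longrightarrow> y \<in> carrier G \<Longrightarrow> orb x = orb y \<Longrightarrow> \<exists>n\<in>N. \<exists>h\<in>H. Bl y = Bl (n \<otimes> x \<otimes> h)"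
proof -
  assume "y \<in> carrier G" "orb x = orb y"
  then have "Bl y \<in> orb x" using Bl_in_orb by simp
  then show ?thesis unfolding orb_def by blast
qed

lemma orb_eq_dcoset:
  assumes "x \<in> carrier G" "y \<in> carrier G" "orb x = orb y" shows "dcoset x = dcoset y"
proof -
  obtain n h where nh: "n \<in> N" "h \<in> H" "Bl y = Bl (n \<otimes> x \<otimes> h)" using orb_eqD[OF assms] by blast
  then show ?thesis using dcoset_Bl[of y "n \<otimes> x \<otimes> h"] dcoset_mult[of x n h] assms NL by simp
qed

text \<open>On the core, orbits of blocks correspond to orbits of elements. The right-hand side does
  not mention \<open>P\<close>, so the two factors agree on which core elements share an orbit; this
  is the compatibility required for the prescribed part of the matching.\<close>

lemma core_orb_eq:
  assumes "c \<in> C" "c' \<in> C" shows "orb c = orb c' \<longleftrightarrow> (\<exists>n\<in>N. \<exists>h\<in>H. c' = n \<otimes> c \<otimes> h)"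
proof
  assume "orb c = orb c'"
  then obtain n h where "n \<in> N" "h \<in> H" "Bl c' = Bl (n \<otimes> c \<otimes> h)" using orb_eqD assms by (meson in_carrier(5))
  then show "\<exists>n\<in>N. \<exists>h\<in>H. c' = n \<otimes> c \<otimes> h" using Bl_core[OF assms] by metis
qed (use orb_mult assms in auto)

text \<open>The collapse is injective on each \<open>N x H\<close>, so an orbit of blocks is a copy
  of the double coset \<open>N x H\<close> with its two actions.\<close>

lemma Bl_inj_orbit:
  assumes "x \<in> carrier G" "n \<in> N" "h \<in> H" "n' \<in> N" "h' \<in> H" "Bl (n \<otimes> x \<otimes> h) = Bl (n' \<otimes> x \<otimes> h')"
  shows "n \<otimes> x \<otimes> h = n' \<otimes> x \<otimes> h'"
proof -
  have eq: "(n \<otimes> inv n') \<otimes> (n' \<otimes> x \<otimes> h') \<otimes> (inv h' \<otimes> h) = n \<otimes> x \<otimes> h" using assms by (simp add: m_assoc)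
  then show ?thesis
    using Bl_free[of "n' \<otimes> x \<otimes> h'" "n \<otimes> inv n'" "inv h' \<otimes> h"] assms closed by simp
qed

section \<open>Finiteness and counting of orbits\<close>

definition horb :: "'a \<Rightarrow> 'a set set" where "horb x = {Bl (x \<otimes> h) | h. h \<in> H}"

lemma horbI: "h \<in> H \<Longrightarrow> Bl (x \<otimes> h) \<in> horb x"
  by (auto simp: horb_def)

lemma horb_eqI:
  assumes "x \<in> carrier G" "y \<in> carrier G" "h \<in> H" "Bl y = Bl (x \<otimes> h)"
  shows "horb y = horb x"
proof
  show "horb y \<subseteq> horb x"
  proof
    fix b assume "b \<in> horb y"
    then obtain k where m: "k \<in> H" "b = Bl (y \<otimes> k)" by (auto simp: horb_def)
    have "b = Bl ((x \<otimes> h) \<otimes> k)" using m assms by (simp only: Bl_right in_carrier m_closed)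
    also have "(x \<otimes> h) \<otimes> k = x \<otimes> (h \<otimes> k)" using m assms by (simp add: m_assoc)
    finally show "b \<in> horb x" by (elim ssubst) (intro horbI closed; use m assms in auto)
  qed
  show "horb x \<subseteq> horb y"
  proof
    fix b assume "b \<in> horb x"
    then obtain k where m: "k \<in> H" "b = Bl (x \<otimes> k)" by (auto simp: horb_def)
    have "x \<otimes> k = (x \<otimes> h) \<otimes> (inv h \<otimes> k)" using m assms by (simp add: m_assoc)
    then have "b = Bl ((x \<otimes> h) \<otimes> (inv h \<otimes> k))" using m by simp
    also have "\<dots> = Bl (y \<otimes> (inv h \<otimes> k))"
      using m assms closed by (simp only: Bl_right in_carrier m_closed)
    finally show "b \<in> horb y" by (elim ssubst) (intro horbI closed; use m assms in auto)
  qed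
qed

text \<open>Each of the finitely many double cosets \<open>P c H\<close> contributes finitely many
  \<open>H\<close>-orbits, by \<open>Bl_cofinite\<close>.\<close>

lemma finite_horb: "finite (horb ` region)"
proof -
  obtain T where T: "\<And>x. x \<in> carrier G \<Longrightarrow> finite (T x) \<and> T x \<subseteq> P \<and> (\<forall>p\<in>P. \<exists>t\<in>T x. \<exists>h\<in>H. Bl (p \<otimes> x) = Bl (t \<otimes> x \<otimes> h))"
    using Bl_cofinite by metis
  have "horb ` region \<subseteq> (\<Union>c\<in>C. (\<lambda>t. horb (t \<otimes> c)) ` T c)"
  proof
    fix \<omega> assume "\<omega> \<in> horb ` region"
    then obtain p c h where pch: "p \<in> P" "c \<in> C" "h \<in> H" "\<omega> = horb (p \<otimes> c \<otimes> h)" by (auto simp: region_def)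
    have "\<omega> = horb (p \<otimes> c)" unfolding pch(4) by (rule horb_eqI[OF _ _ pch(3)]) (use pch in auto)
    moreover obtain t k where t: "t \<in> T c" "k \<in> H" "Bl (p \<otimes> c) = Bl (t \<otimes> c \<otimes> k)"
      using T[of c] pch by auto
    moreover have "t \<in> P" using t T[of c] pch by auto
    ultimately have "\<omega> = horb (t \<otimes> c)"
      using horb_eqI[of "t \<otimes> c" "p \<otimes> c" k] pch by simp
    then show "\<omega> \<in> (\<Union>c\<in>C. (\<lambda>t. horb (t \<otimes> c)) ` T c)" using t pch by blast
  qed
  moreover have "finite (\<Union>c\<in>C. (\<lambda>t. horb (t \<otimes> c)) ` T c)" using T C by auto
  ultimately show ?thesis by (rule finite_subset)
qed

lemma orb_horb: 
  assumes "x \<in> carrier G" "y \<in> carrier G" "horb x = horb y" shows "orb x = orb y"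
proof -
  have "Bl y = Bl (y \<otimes> \<one>)" using assms by simp
  then have "Bl y \<in> horb x" unfolding assms(3) using horbI closed by metis
  then obtain h where "h \<in> H" "Bl y = Bl (\<one> \<otimes> x \<otimes> h)" using assms by (auto simp: horb_def)
  then show ?thesis using orb_eqI[of x y \<one> h] assms closed by simp
qed

lemma finite_orb: "finite (orb ` region)"
proof -
  have "orb ` region \<subseteq> (\<lambda>\<omega>. orb (SOME x. x \<in> region \<and> horb x = \<omega>)) ` horb ` region"
  proof
    fix \<omega> assume "\<omega> \<in> orb ` region"
    then obtain x where x: "x \<in> region" "\<omega> = orb x" by blast
    let ?y = "SOME y. y \<in> region \<and> horb y = horb x"
    have "?y \<in> region \<and> horb ?y = horb x" by (rule someI[of _ x]) (use x in simp)
    then have "orb ?y = orb x" using orb_horb region_carrier x by blast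
    then show "\<omega> \<in> (\<lambda>\<omega>. orb (SOME x. x \<in> region \<and> horb x = \<omega>)) ` horb ` region" using x by force
  qed
  then show ?thesis using finite_horb by (meson finite_surj)
qed

lemma finite_orbits: "finite (orbits \<tau>)"
  by (rule finite_subset[OF _ finite_orb]) (auto simp: orbits_def)

definition cnt :: "'a set \<Rightarrow> nat" where "cnt \<tau> = card (orbits \<tau>)"

text \<open>\<open>C\<close> meets every type and lies in the region, so no type is missing on
  either side; a count of zero could not be balanced by repetition.\<close>

lemma cnt_pos: "x \<in> carrier G \<Longrightarrow> cnt (dcoset x) > 0"
proof -
  assume x: "x \<in> carrier G"
  obtain c l h where c: "c \<in> C" "l \<in> L" "h \<in> H" "x = l \<otimes> c \<otimes> h" using C(3)[OF x] by blast
  then have "dcoset x = dcoset c" using dcoset_mult by simp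
  then have "orb c \<in> orbits (dcoset x)" using core_region[OF c(1)] by (auto simp: orbits_def)
  then show ?thesis unfolding cnt_def using finite_orbits by (auto simp: card_gt_0_iff)
qed

lemma orb_left:
  assumes "x \<in> carrier G" "p \<in> P" shows "orb (p \<otimes> x) = (\<lambda>b. p <# b) ` orb x"
proof
  show "orb (p \<otimes> x) \<subseteq> (\<lambda>b. p <# b) ` orb x"
  proof
    fix b assume "b \<in> orb (p \<otimes> x)"
    then obtain n h where nh: "n \<in> N" "h \<in> H" "b = Bl (n \<otimes> (p \<otimes> x) \<otimes> h)" by (auto simp: orb_def)
    have "inv p \<otimes> n \<otimes> p \<in> N" using normal.inv_op_closed1[OF N(1)] nh assms by simp
    moreover have "n \<otimes> (p \<otimes> x) \<otimes> h = p \<otimes> ((inv p \<otimes> n \<otimes> p) \<otimes> x \<otimes> h)" using nh assms by (simp add: m_assoc)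
    then have "b = p <# Bl ((inv p \<otimes> n \<otimes> p) \<otimes> x \<otimes> h)" unfolding nh(3) using nh assms Bl_left by simp
    ultimately show "b \<in> (\<lambda>b. p <# b) ` orb x" unfolding orb_def using nh by blast
  qed
  show "(\<lambda>b. p <# b) ` orb x \<subseteq> orb (p \<otimes> x)"
  proof
    fix b assume "b \<in> (\<lambda>b. p <# b) ` orb x"
    then obtain n h where nh: "n \<in> N" "h \<in> H" "b = p <# Bl (n \<otimes> x \<otimes> h)" by (auto simp: orb_def)
    have "p \<otimes> n \<otimes> inv p \<in> N" using normal.inv_op_closed2[OF N(1)] nh assms by simp
    moreover have "p \<otimes> (n \<otimes> x \<otimes> h) = (p \<otimes> n \<otimes> inv p) \<otimes> (p \<otimes> x) \<otimes> h" using nh assms by (simp add: m_assoc)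
    then have "b = Bl ((p \<otimes> n \<otimes> inv p) \<otimes> (p \<otimes> x) \<otimes> h)" unfolding nh(3) using nh assms Bl_left[of "n \<otimes> x \<otimes> h" p] by simp
    ultimately show "b \<in> orb (p \<otimes> x)" unfolding orb_def using nh by blast
  qed
qed

text \<open>Left multiplication by \<open>p\<close> maps the orbits of the type of \<open>x\<close>
  onto those of the type of \<open>p \<otimes> x\<close>, as \<open>N\<close> is normal and the
  region is \<open>P\<close>-invariant. Hence counts are constant along a double coset of
  \<open>P\<close> and \<open>H\<close> even where the type varies, and the repeated blocks still
  carry an action of \<open>P\<close>.\<close>

lemma cnt_left: 
  assumes "x \<in> carrier G" "p \<in> P" shows "cnt (dcoset (p \<otimes> x)) = cnt (dcoset x)"
proof -
  have le: "cnt (dcoset (p \<otimes> x)) \<le> cnt (dcoset x)" if xp: "x \<in> carrier G" "p \<in> P" for x p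
  proof -
    have "orbits (dcoset (p \<otimes> x)) \<subseteq> (\<lambda>\<omega>. (\<lambda>b. p <# b) ` \<omega>) ` orbits (dcoset x)"
    proof
      fix \<omega> assume "\<omega> \<in> orbits (dcoset (p \<otimes> x))"
      then obtain y where y: "y \<in> region" "dcoset y = dcoset (p \<otimes> x)" "\<omega> = orb y" by (auto simp: orbits_def)
      define z where "z = inv p \<otimes> y"
      have yc: "y \<in> carrier G" using y region_carrier by blast
      have z: "z \<in> region" "y = p \<otimes> z" "z \<in> carrier G"
        using region_left[OF y(1)] closed(5)[OF xp(2)] yc xp by (auto simp: z_def)
      have "dcoset z = dcoset (inv p \<otimes> (p \<otimes> x))" unfolding z_def using y yc xp by (intro dcoset_left_cong) auto
      then have "dcoset z = dcoset x" using xp by simp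
      then have "orb z \<in> orbits (dcoset x)" using z by (auto simp: orbits_def)
      moreover have "\<omega> = (\<lambda>b. p <# b) ` orb z" unfolding y(3) z(2) by (rule orb_left[OF z(3) xp(2)])
      ultimately show "\<omega> \<in> (\<lambda>\<omega>. (\<lambda>b. p <# b) ` \<omega>) ` orbits (dcoset x)" by blast
    qed
    then show ?thesis unfolding cnt_def by (rule surj_card_le[OF finite_orbits])
  qed
  have "cnt (dcoset (inv p \<otimes> (p \<otimes> x))) \<le> cnt (dcoset (p \<otimes> x))" by (rule le) (use assms closed in auto)
  then have "cnt (dcoset x) \<le> cnt (dcoset (p \<otimes> x))" using assms by simp
  then show ?thesis using le[OF assms] by simp
qed

end

section \<open>Matching the blocks on both sides\<close>

definition lshift :: "('a, 'm) monoid_scheme \<Rightarrow> 'a \<Rightarrow> 'a set \<times> nat \<Rightarrow> 'a set \<times> nat" where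
  "lshift G g p = (g <#\<^bsub>G\<^esub> fst p, snd p)"

definition rshift :: "('a, 'm) monoid_scheme \<Rightarrow> 'a \<Rightarrow> 'a set \<times> nat \<Rightarrow> 'a set \<times> nat" where
  "rshift G h p = (fst p #>\<^bsub>G\<^esub> h, snd p)"

context block_system
begin

text \<open>The second component numbers the copies of a block. With \<open>d\<close> a multiple of
  every count, each type receives exactly \<open>d\<close> orbits: \<open>cnt\<close> of them, each
  in \<open>d div cnt\<close> copies.\<close>

definition points :: "nat \<Rightarrow> ('a set \<times> nat) set" where
  "points d = {(Bl x, i) | x i. x \<in> region \<and> i < d div cnt (dcoset x)}"

lemma pointsI: "x \<in> region \<Longrightarrow> i < d div cnt (dcoset x) \<Longrightarrow> (Bl x, i) \<in> points d"
  by (auto simp: points_def)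

lemma points_left:
  assumes "y \<in> points d" "p \<in> P" shows "lshift G p y \<in> points d"
proof -
  obtain x i where x: "x \<in> region" "i < d div cnt (dcoset x)" "y = (Bl x, i)" using assms by (auto simp: points_def)
  have "lshift G p y = (Bl (p \<otimes> x), i)" using x region_carrier Bl_left assms by (simp add: lshift_def)
  moreover have "p \<otimes> x \<in> region" using region_left x assms by blast
  moreover have "cnt (dcoset (p \<otimes> x)) = cnt (dcoset x)" using cnt_left x region_carrier assms by blast
  ultimately show ?thesis using x unfolding points_def by auto
qed

lemma points_right:
  assumes "y \<in> points d" "h \<in> H" shows "rshift G h y \<in> points d"
proof -
  obtain x i where x: "x \<in> region" "i < d div cnt (dcoset x)" "y = (Bl x, i)" using assms by (auto simp: points_def)
  have "rshift G h y = (Bl (x \<otimes> h), i)" using x region_carrier Bl_right assms by (simp add: rshift_def)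
  moreover have "x \<otimes> h \<in> region" using region_right x assms by blast
  moreover have "dcoset (x \<otimes> h) = dcoset x" using dcoset_right x region_carrier assms by blast
  ultimately show ?thesis using x unfolding points_def by auto
qed

lemma points_carrier: "y \<in> points d \<Longrightarrow> fst y \<subseteq> carrier G"
proof -
  assume "y \<in> points d"
  then obtain x i where "x \<in> region" "y = (Bl x, i)" unfolding points_def by blast
  then show ?thesis using Bl_carrier[OF region_carrier] by simp
qed

lemma lshift_action: "action G P (points d) (lshift G)"
  unfolding action_def
proof (intro conjI ballI)
  fix x assume "x \<in> points d"
  then show "lshift G \<one> x = x" using points_carrier lcos_mult_one by (simp add: lshift_def)
next
  fix a b x assume "a \<in> P" "b \<in> P" "x \<in> points d"
  then show "lshift G (a \<otimes> b) x = lshift G a (lshift G b x)"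
    using points_carrier lcos_m_assoc[of "fst x" a b] by (simp add: lshift_def)
qed (rule points_left)

lemma lshift_rshift: "y \<in> points d \<Longrightarrow> p \<in> P \<Longrightarrow> h \<in> H \<Longrightarrow> lshift G p (rshift G h y) = rshift G h (lshift G p y)"
  using points_carrier[of y d] by (simp add: lshift_def rshift_def coset_assoc)

lemma rshift_rshift: "y \<in> points d \<Longrightarrow> h \<in> H \<Longrightarrow> k \<in> H \<Longrightarrow> rshift G k (rshift G h y) = rshift G (h \<otimes> k) y"
  using points_carrier[of y d] by (simp add: rshift_def coset_mult_assoc)

lemma rshift_one: "y \<in> points d \<Longrightarrow> rshift G \<one> y = y"
  using points_carrier[of y d] by (simp add: rshift_def)

lemma rshift_free: 
  assumes "x \<in> carrier G" "h \<in> H" "k \<in> H" "rshift G h (Bl x, i) = rshift G k (Bl x, j)" shows "h = k"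
proof -
  have "Bl (\<one> \<otimes> x \<otimes> h) = Bl (\<one> \<otimes> x \<otimes> k)" using assms Bl_right by (simp add: rshift_def)
  then have "\<one> \<otimes> x \<otimes> h = \<one> \<otimes> x \<otimes> k"
    by (intro Bl_inj_orbit) (use assms closed in auto)
  then show ?thesis using assms by simp
qed

lemma finite_rshift_orbits: "finite ((\<lambda>y. (\<lambda>h. rshift G h y) ` H) ` points d)"
proof (rule finite_subset)
  show "(\<lambda>y. (\<lambda>h. rshift G h y) ` H) ` points d \<subseteq> (\<lambda>(\<omega>, i). \<omega> \<times> {i}) ` ((horb ` region) \<times> {..<d})"
  proof
    fix w assume "w \<in> (\<lambda>y. (\<lambda>h. rshift G h y) ` H) ` points d"
    then obtain x i where x: "x \<in> region" "i < d div cnt (dcoset x)" "w = (\<lambda>h. rshift G h (Bl x, i)) ` H"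
      by (auto simp: points_def)
    have "w = horb x \<times> {i}"
      unfolding x(3) horb_def using Bl_right region_carrier[OF x(1)] by (auto simp: rshift_def)
    moreover have "i < d" using x(2) div_le_dividend[of d "cnt (dcoset x)"] by linarith
    ultimately show "w \<in> (\<lambda>(\<omega>, i). \<omega> \<times> {i}) ` ((horb ` region) \<times> {..<d})" using x(1) by auto
  qed
  show "finite ((\<lambda>(\<omega>, i). \<omega> \<times> {i}) ` ((horb ` region) \<times> {..<d}))" using finite_horb by auto
qed

end

text \<open>\<open>split\<close> places \<open>L\<close> in the product of \<open>N\<close> with its
  centralizer. It is what turns equality of types into an isomorphism of
  \<open>(N, H)\<close>-orbits.\<close>

locale two_blocks = A: block_system G N H A L C BA + B: block_system G N H B L C BB
  for G (structure) and N H A B L C BA BB +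
  assumes split: "\<And>l. l \<in> L \<Longrightarrow> \<exists>n\<in>N. \<exists>z\<in>carrier G. (\<forall>m\<in>N. z \<otimes> m = m \<otimes> z) \<and> l = n \<otimes> z"
begin

definition types :: "'a set set" where "types = A.dcoset ` carrier G"

text \<open>A common multiple of all counts on both sides, positive because every type occurs on
  both.\<close>

definition d :: nat where "d = (\<Prod>\<tau>\<in>types. A.cnt \<tau> * B.cnt \<tau>)"

lemma d: "d > 0" "\<tau> \<in> types \<Longrightarrow> A.cnt \<tau> dvd d" "\<tau> \<in> types \<Longrightarrow> B.cnt \<tau> dvd d"
    "\<tau> \<in> types \<Longrightarrow> A.cnt \<tau> > 0" "\<tau> \<in> types \<Longrightarrow> B.cnt \<tau> > 0"
proof -
  have fin: "finite types" unfolding types_def by (rule A.types_finite)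
  show pos: "\<tau> \<in> types \<Longrightarrow> A.cnt \<tau> > 0" "\<tau> \<in> types \<Longrightarrow> B.cnt \<tau> > 0" for \<tau>
    using A.cnt_pos B.cnt_pos by (auto simp: types_def)
  show "d > 0" unfolding d_def using pos by (intro prod_pos) auto
  have "A.cnt \<tau> * B.cnt \<tau> dvd d" if "\<tau> \<in> types" for \<tau> unfolding d_def using fin that by (rule dvd_prodI)
  then show "\<tau> \<in> types \<Longrightarrow> A.cnt \<tau> dvd d" "\<tau> \<in> types \<Longrightarrow> B.cnt \<tau> dvd d" by (auto intro: dvd_mult_left dvd_mult_right)
qed

text \<open>A slot is one orbit of points: an orbit of blocks together with its copy number.\<close>

definition slotsA :: "'a set \<Rightarrow> ('a set set \<times> nat) set" where
  "slotsA \<tau> = A.orbits \<tau> \<times> {..<d div A.cnt \<tau>}"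

definition slotsB :: "'a set \<Rightarrow> ('a set set \<times> nat) set" where
  "slotsB \<tau> = B.orbits \<tau> \<times> {..<d div B.cnt \<tau>}"

text \<open>Every type occurs equally often among the \<open>A\<close>- and the \<open>B\<close>-blocks once each of them is
  repeated with the right multiplicity.\<close>

lemma slot_matching:
  assumes "\<tau> \<in> types"
  shows "\<exists>\<pi>. bij_betw \<pi> (slotsA \<tau>) (slotsB \<tau>) \<and> (\<forall>c\<in>{c\<in>C. A.dcoset c = \<tau>}. \<pi> (A.orb c, 0) = (B.orb c, 0))"
proof (rule bij_extending)
  show "finite (slotsA \<tau>)" "finite (slotsB \<tau>)"
    using A.finite_orbits B.finite_orbits by (auto simp: slotsA_def slotsB_def)
  show "card (slotsA \<tau>) = card (slotsB \<tau>)"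
    using d(1) d(2-5)[of \<tau>] assms by (simp add: slotsA_def slotsB_def card_cartesian_product A.cnt_def[symmetric] B.cnt_def[symmetric])
  \<comment> \<open>At least one copy of each orbit exists, so copy \<open>0\<close> is available
    for the core.\<close>
  have "d div A.cnt \<tau> > 0" "d div B.cnt \<tau> > 0"
    using d(1) d(2-5)[of \<tau>] assms by (auto simp: div_greater_zero_iff dvd_imp_le)
  then show "(\<lambda>c. (A.orb c, 0)) ` {c\<in>C. A.dcoset c = \<tau>} \<subseteq> slotsA \<tau>"
    "(\<lambda>c. (B.orb c, 0)) ` {c\<in>C. A.dcoset c = \<tau>} \<subseteq> slotsB \<tau>"
    using A.core_region B.core_region by (auto simp: slotsA_def slotsB_def A.orbits_def B.orbits_def)
qed (use A.core_orb_eq B.core_orb_eq in auto)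

text \<open>Left multiplication by an element centralizing \<open>N\<close> is an isomorphism of \<open>(N, H)\<close>-orbits; up to
  \<open>N\<close> and \<open>H\<close> any two elements of the same double coset differ by such an element.\<close>

lemma representatives:
  assumes \<pi>: "bij_betw \<pi> (slotsA \<tau>) (slotsB \<tau>)" "\<forall>c\<in>{c\<in>C. A.dcoset c = \<tau>}. \<pi> (A.orb c, 0) = (B.orb c, 0)"
    and s: "s \<in> slotsA \<tau>"
  shows "\<exists>u v. u \<in> A.region \<and> A.dcoset u = \<tau> \<and> A.orb u = fst s \<and> v \<in> B.region \<and> A.dcoset v = \<tau> \<and> B.orb v = fst (\<pi> s) \<and>
    (\<exists>z\<in>carrier G. (\<forall>m\<in>N. z \<otimes> m = m \<otimes> z) \<and> v = z \<otimes> u) \<and>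
    ((\<exists>c\<in>C. A.dcoset c = \<tau> \<and> s = (A.orb c, 0)) \<longrightarrow> u = v \<and> u \<in> C)"
proof (cases "\<exists>c\<in>C. A.dcoset c = \<tau> \<and> s = (A.orb c, 0)")
  case True
  \<comment> \<open>For a core slot both representatives are taken equal, with
    \<open>z = \<one>\<close>; this is what will carry \<open>BA c\<close> to
    \<open>BB c\<close>.\<close>
  then obtain c where c: "c \<in> C" "A.dcoset c = \<tau>" "s = (A.orb c, 0)" by blast
  then have "\<pi> s = (B.orb c, 0)" using \<pi> by simp
  moreover have "c = \<one> \<otimes> c" using c by simp
  moreover have "\<forall>m\<in>N. \<one> \<otimes> m = m \<otimes> \<one>" by simp
  ultimately show ?thesis
    using c A.core_region B.core_region by (intro exI[of _ c]) (auto intro!: bexI[of _ \<one>])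
next
  case False
  obtain u where u: "u \<in> A.region" "A.dcoset u = \<tau>" "A.orb u = fst s"
    using s by (auto simp: slotsA_def A.orbits_def)
  have "\<pi> s \<in> slotsB \<tau>" using \<pi>(1) s by (auto simp: bij_betw_def)
  then obtain v0 where v0: "v0 \<in> B.region" "A.dcoset v0 = \<tau>" "B.orb v0 = fst (\<pi> s)"
    by (auto simp: slotsB_def B.orbits_def)
  have c: "u \<in> carrier G" "v0 \<in> carrier G" using u v0 A.region_carrier B.region_carrier by auto
  obtain l h where lh: "l \<in> L" "h \<in> H" "v0 = l \<otimes> u \<otimes> h" using A.dcoset_eqD[OF c] u v0 by auto
  obtain n z where nz: "n \<in> N" "z \<in> carrier G" "\<forall>m\<in>N. z \<otimes> m = m \<otimes> z" "l = n \<otimes> z"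
    using split[OF lh(1)] by blast
  \<comment> \<open>Splitting off the \<open>N\<close>-part of \<open>l\<close> and the factor
    \<open>h\<close> moves \<open>v0\<close> within its orbit to
    \<open>z \<otimes> u\<close>.\<close>
  have eq: "z \<otimes> u = inv n \<otimes> v0 \<otimes> inv h" using lh nz c by (simp add: A.m_assoc)
  have cl: "inv n \<in> N" "inv h \<in> H" using nz lh A.closed by auto
  have "z \<otimes> u \<in> B.region" unfolding eq using B.region_mult[OF v0(1) B.NP[OF cl(1)] cl(2)] .
  moreover have "A.dcoset (z \<otimes> u) = \<tau>" unfolding eq using A.dcoset_mult[OF c(2) A.NL[OF cl(1)] cl(2)] v0 by simp
  moreover have "B.orb (z \<otimes> u) = fst (\<pi> s)" unfolding eq using B.orb_mult[OF c(2) cl] v0 by simp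
  ultimately show ?thesis using u nz False by (intro exI[of _ u] exI[of _ "z \<otimes> u"]) auto
qed

text \<open>With \<open>v = z u\<close> and \<open>z\<close> centralizing \<open>N\<close>, one has
  \<open>n v h = z (n u h)\<close>, so \<open>n u h\<close> and \<open>n v h\<close> coincide for
  the same pairs of parameters. The matching sends the block of \<open>n u h\<close> to that of
  \<open>n v h\<close>; it commutes with \<open>N\<close> and \<open>H\<close> because both act on
  the parameters only.\<close>

lemma point_matching:
  "\<exists>f. bij_betw f (A.points d) (B.points d) \<and>
    (\<forall>n\<in>N. \<forall>y\<in>A.points d. f (lshift G n y) = lshift G n (f y)) \<and>
    (\<forall>h\<in>H. \<forall>y\<in>A.points d. f (rshift G h y) = rshift G h (f y)) \<and>
    (\<forall>c\<in>C. f (BA c, 0) = (BB c, 0))"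
proof -
  have ex: "\<forall>\<tau>\<in>types. \<exists>\<pi>. bij_betw \<pi> (slotsA \<tau>) (slotsB \<tau>) \<and>
      (\<forall>c\<in>{c\<in>C. A.dcoset c = \<tau>}. \<pi> (A.orb c, 0) = (B.orb c, 0))"
    by (intro ballI slot_matching)
  obtain \<pi> where \<pi>0: "\<forall>\<tau>\<in>types. bij_betw (\<pi> \<tau>) (slotsA \<tau>) (slotsB \<tau>) \<and>
      (\<forall>c\<in>{c\<in>C. A.dcoset c = \<tau>}. \<pi> \<tau> (A.orb c, 0) = (B.orb c, 0))"
    using bchoice[OF ex] by (elim exE) (rule that)
  then have \<pi>: "\<And>\<tau>. \<tau> \<in> types \<Longrightarrow> bij_betw (\<pi> \<tau>) (slotsA \<tau>) (slotsB \<tau>)"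
    "\<And>\<tau>. \<tau> \<in> types \<Longrightarrow> \<forall>c\<in>{c\<in>C. A.dcoset c = \<tau>}. \<pi> \<tau> (A.orb c, 0) = (B.orb c, 0)"
    by simp_all
  define Q where "Q \<tau> s u v \<longleftrightarrow> u \<in> A.region \<and> A.dcoset u = \<tau> \<and> A.orb u = fst s \<and> v \<in> B.region \<and> A.dcoset v = \<tau> \<and>
    B.orb v = fst (\<pi> \<tau> s) \<and> (\<exists>z\<in>carrier G. (\<forall>m\<in>N. z \<otimes> m = m \<otimes> z) \<and> v = z \<otimes> u) \<and>
    ((\<exists>c\<in>C. A.dcoset c = \<tau> \<and> s = (A.orb c, 0)) \<longrightarrow> u = v \<and> u \<in> C)" for \<tau> s u v
  have Qex: "\<exists>u v. Q \<tau> s u v" if "\<tau> \<in> types" "s \<in> slotsA \<tau>" for \<tau> s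
    unfolding Q_def by (rule representatives[OF \<pi>(1,2)[OF that(1)] that(2)])
  \<comment> \<open>Both representatives are chosen as one pair, since they are tied together by
    \<open>z\<close>.\<close>
  define w where "w \<tau> s = (SOME p. Q \<tau> s (fst p) (snd p))" for \<tau> s
  define u where "u \<tau> s = fst (w \<tau> s)" for \<tau> s
  define v where "v \<tau> s = snd (w \<tau> s)" for \<tau> s
  have uv: "Q \<tau> s (u \<tau> s) (v \<tau> s)" if ts: "\<tau> \<in> types" "s \<in> slotsA \<tau>" for \<tau> s
  proof -
    obtain a b where "Q \<tau> s a b" using Qex[OF ts] by blast
    then have "Q \<tau> s (fst (a, b)) (snd (a, b))" by simp
    then show ?thesis unfolding u_def v_def w_def by (rule someI)
  qed
  define Z where "Z = (SIGMA \<tau>:types. slotsA \<tau> \<times> N \<times> H)"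
  define \<xi> where "\<xi> = (\<lambda>(\<tau>, s, n, h). (BA (n \<otimes> u \<tau> s \<otimes> h), snd s))"
  define \<eta> where "\<eta> = (\<lambda>(\<tau>, s, n, h). (BB (n \<otimes> v \<tau> s \<otimes> h), snd (\<pi> \<tau> s)))"
  have uf: "u \<tau> s \<in> A.region" "u \<tau> s \<in> carrier G" "A.dcoset (u \<tau> s) = \<tau>" "A.orb (u \<tau> s) = fst s"
    "v \<tau> s \<in> B.region" "v \<tau> s \<in> carrier G" "A.dcoset (v \<tau> s) = \<tau>" "B.orb (v \<tau> s) = fst (\<pi> \<tau> s)"
    "\<exists>z\<in>carrier G. (\<forall>m\<in>N. z \<otimes> m = m \<otimes> z) \<and> v \<tau> s = z \<otimes> u \<tau> s"
    if ts: "\<tau> \<in> types" "s \<in> slotsA \<tau>" for \<tau> s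
    using uv[OF ts] A.region_carrier B.region_carrier unfolding Q_def by blast+
  have \<pi>s: "\<pi> \<tau> s \<in> slotsB \<tau>" if "\<tau> \<in> types" "s \<in> slotsA \<tau>" for \<tau> s
    using \<pi>(1)[OF that(1)] that(2) by (auto simp: bij_betw_def)
  have \<xi>img: "\<xi> ` Z = A.points d"
  proof
    show "\<xi> ` Z \<subseteq> A.points d"
    proof
      fix y assume "y \<in> \<xi> ` Z"
      then obtain \<tau> s n h where z: "\<tau> \<in> types" "s \<in> slotsA \<tau>" "n \<in> N" "h \<in> H" "y = (BA (n \<otimes> u \<tau> s \<otimes> h), snd s)"
        by (auto simp: Z_def \<xi>_def)
      have "n \<otimes> u \<tau> s \<otimes> h \<in> A.region" using A.region_mult[OF uf(1)[OF z(1,2)] A.NP[OF z(3)] z(4)] .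
      moreover have "A.dcoset (n \<otimes> u \<tau> s \<otimes> h) = \<tau>"
        using A.dcoset_mult[OF uf(2)[OF z(1,2)] A.NL[OF z(3)] z(4)] uf(3)[OF z(1,2)] by simp
      moreover have "snd s < d div A.cnt \<tau>" using z(2) by (auto simp: slotsA_def)
      ultimately show "y \<in> A.points d" unfolding z(5) by (intro A.pointsI) simp_all
    qed
    show "A.points d \<subseteq> \<xi> ` Z"
    proof
      fix y assume "y \<in> A.points d"
      then obtain x i where x: "x \<in> A.region" "i < d div A.cnt (A.dcoset x)" "y = (BA x, i)" by (auto simp: A.points_def)
      have xc: "x \<in> carrier G" using x A.region_carrier by blast
      have t: "A.dcoset x \<in> types" using xc by (simp add: types_def)
      have s: "(A.orb x, i) \<in> slotsA (A.dcoset x)" using x by (auto simp: slotsA_def A.orbits_def)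
      obtain n h where "n \<in> N" "h \<in> H" "BA x = BA (n \<otimes> u (A.dcoset x) (A.orb x, i) \<otimes> h)"
        using A.orb_eqD[OF uf(2)[OF t s] xc] uf(4)[OF t s] by auto
      then show "y \<in> \<xi> ` Z" using t s x
        by (intro image_eqI[of _ _ "(A.dcoset x, (A.orb x, i), n, h)"]) (auto simp: Z_def \<xi>_def)
    qed
  qed
  have \<eta>img: "\<eta> ` Z = B.points d"
  proof
    show "\<eta> ` Z \<subseteq> B.points d"
    proof
      fix y assume "y \<in> \<eta> ` Z"
      then obtain \<tau> s n h where z: "\<tau> \<in> types" "s \<in> slotsA \<tau>" "n \<in> N" "h \<in> H" "y = (BB (n \<otimes> v \<tau> s \<otimes> h), snd (\<pi> \<tau> s))"
        by (auto simp: Z_def \<eta>_def)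
      have "n \<otimes> v \<tau> s \<otimes> h \<in> B.region" using B.region_mult[OF uf(5)[OF z(1,2)] B.NP[OF z(3)] z(4)] .
      moreover have "A.dcoset (n \<otimes> v \<tau> s \<otimes> h) = \<tau>"
        using A.dcoset_mult[OF uf(6)[OF z(1,2)] A.NL[OF z(3)] z(4)] uf(7)[OF z(1,2)] by simp
      moreover have "snd (\<pi> \<tau> s) < d div B.cnt \<tau>" using \<pi>s[OF z(1,2)] by (auto simp: slotsB_def)
      ultimately show "y \<in> B.points d" unfolding z(5) by (intro B.pointsI) simp_all
    qed
    show "B.points d \<subseteq> \<eta> ` Z"
    proof
      fix y assume "y \<in> B.points d"
      then obtain x i where x: "x \<in> B.region" "i < d div B.cnt (A.dcoset x)" "y = (BB x, i)" by (auto simp: B.points_def)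
      have xc: "x \<in> carrier G" using x B.region_carrier by blast
      have t: "A.dcoset x \<in> types" using xc by (simp add: types_def)
      have "(B.orb x, i) \<in> slotsB (A.dcoset x)" using x by (auto simp: slotsB_def B.orbits_def)
      then obtain s where s: "s \<in> slotsA (A.dcoset x)" "\<pi> (A.dcoset x) s = (B.orb x, i)"
        using \<pi>(1)[OF t] unfolding bij_betw_def by (metis imageE)
      obtain n h where "n \<in> N" "h \<in> H" "BB x = BB (n \<otimes> v (A.dcoset x) s \<otimes> h)"
        using B.orb_eqD[OF uf(6)[OF t s(1)] xc] uf(8)[OF t s(1)] s(2) by auto
      then show "y \<in> \<eta> ` Z" using t s x
        by (intro image_eqI[of _ _ "(A.dcoset x, s, n, h)"]) (simp_all add: Z_def \<eta>_def)
    qed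
  qed
  have key: "n \<otimes> v \<tau> s \<otimes> h = n' \<otimes> v \<tau> s \<otimes> h' \<longleftrightarrow> n \<otimes> u \<tau> s \<otimes> h = n' \<otimes> u \<tau> s \<otimes> h'"
    if ts: "\<tau> \<in> types" "s \<in> slotsA \<tau>" and nh: "n \<in> N" "h \<in> H" "n' \<in> N" "h' \<in> H" for \<tau> s n h n' h'
  proof -
    obtain z where z: "z \<in> carrier G" "\<forall>m\<in>N. z \<otimes> m = m \<otimes> z" "v \<tau> s = z \<otimes> u \<tau> s" using uf(9)[OF ts] by blast
    have "m \<otimes> v \<tau> s \<otimes> k = z \<otimes> (m \<otimes> u \<tau> s \<otimes> k)" if mk: "m \<in> N" "k \<in> H" for m k
    proof -
      have "m \<otimes> v \<tau> s \<otimes> k = (m \<otimes> z) \<otimes> u \<tau> s \<otimes> k" unfolding z(3) using mk z(1) uf(2)[OF ts] by (simp add: A.m_assoc)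
      also have "m \<otimes> z = z \<otimes> m" using z mk by simp
      finally show ?thesis using mk z(1) uf(2)[OF ts] by (simp add: A.m_assoc)
    qed
    then show ?thesis using nh z(1) uf(2)[OF ts] by simp
  qed
  have \<xi>eq: "(BA (n \<otimes> u \<tau> s \<otimes> h), snd s) = (BA (n' \<otimes> u \<tau>' s' \<otimes> h'), snd s') \<longleftrightarrow>
      \<tau> = \<tau>' \<and> s = s' \<and> n \<otimes> u \<tau> s \<otimes> h = n' \<otimes> u \<tau> s \<otimes> h'" (is "?L \<longleftrightarrow> ?R")
    if ts: "\<tau> \<in> types" "s \<in> slotsA \<tau>" "n \<in> N" "h \<in> H" and ts': "\<tau>' \<in> types" "s' \<in> slotsA \<tau>'" "n' \<in> N" "h' \<in> H"
    for \<tau> s n h \<tau>' s' n' h'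
  proof
    assume l: ?L
    have "A.orb (n \<otimes> u \<tau> s \<otimes> h) = A.orb (n' \<otimes> u \<tau>' s' \<otimes> h')"
      by (rule A.orb_eqI[of _ _ \<one> \<one>]) (use l ts ts' uf(2) A.closed in auto)
    then have o: "A.orb (u \<tau> s) = A.orb (u \<tau>' s')" using A.orb_mult uf(2) ts ts' by simp
    then have t: "\<tau> = \<tau>'" using A.orb_eq_dcoset[OF _ _ o] uf(2,3) ts ts' by auto
    have s: "s = s'" using o uf(4)[OF ts(1,2)] uf(4)[OF ts'(1,2)] l by (auto simp: prod_eq_iff)
    show ?R using A.Bl_inj_orbit[OF uf(2)[OF ts(1,2)] ts(3,4) ts'(3,4)] l t s by auto
  qed auto
  have \<eta>eq: "(BB (n \<otimes> v \<tau> s \<otimes> h), snd (\<pi> \<tau> s)) = (BB (n' \<otimes> v \<tau>' s' \<otimes> h'), snd (\<pi> \<tau>' s')) \<longleftrightarrow>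
      \<tau> = \<tau>' \<and> s = s' \<and> n \<otimes> v \<tau> s \<otimes> h = n' \<otimes> v \<tau> s \<otimes> h'" (is "?L \<longleftrightarrow> ?R")
    if ts: "\<tau> \<in> types" "s \<in> slotsA \<tau>" "n \<in> N" "h \<in> H" and ts': "\<tau>' \<in> types" "s' \<in> slotsA \<tau>'" "n' \<in> N" "h' \<in> H"
    for \<tau> s n h \<tau>' s' n' h'
  proof
    assume l: ?L
    have "B.orb (n \<otimes> v \<tau> s \<otimes> h) = B.orb (n' \<otimes> v \<tau>' s' \<otimes> h')"
      by (rule B.orb_eqI[of _ _ \<one> \<one>]) (use l ts ts' uf(6) A.closed in auto)
    then have o: "B.orb (v \<tau> s) = B.orb (v \<tau>' s')" using B.orb_mult uf(6) ts ts' by simp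
    then have t: "\<tau> = \<tau>'" using B.orb_eq_dcoset[OF _ _ o] uf(6,7) ts ts' by auto
    have "\<pi> \<tau> s = \<pi> \<tau> s'" using o uf(8)[OF ts(1,2)] uf(8)[OF ts'(1,2)] l t by (auto simp: prod_eq_iff)
    then have s: "s = s'" using \<pi>(1)[OF ts(1)] ts(2) ts'(2) t by (auto simp: bij_betw_def dest: inj_onD)
    show ?R using B.Bl_inj_orbit[OF uf(6)[OF ts(1,2)] ts(3,4) ts'(3,4)] l t s by auto
  qed auto
  have "\<xi> z = \<xi> z' \<longleftrightarrow> \<eta> z = \<eta> z'" if "z \<in> Z" "z' \<in> Z" for z z'
  proof -
    obtain \<tau> s n h where z: "z = (\<tau>, s, n, h)" "\<tau> \<in> types" "s \<in> slotsA \<tau>" "n \<in> N" "h \<in> H"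
      using \<open>z \<in> Z\<close> by (auto simp: Z_def)
    obtain \<tau>' s' n' h' where z': "z' = (\<tau>', s', n', h')" "\<tau>' \<in> types" "s' \<in> slotsA \<tau>'" "n' \<in> N" "h' \<in> H"
      using \<open>z' \<in> Z\<close> by (auto simp: Z_def)
    show ?thesis unfolding z(1) z'(1) \<xi>_def \<eta>_def prod.case \<xi>eq[OF z(2-5) z'(2-5)] \<eta>eq[OF z(2-5) z'(2-5)]
      using key[OF z(2-5) z'(4,5)] by simp
  qed
  then obtain f where f: "bij_betw f (A.points d) (B.points d)" "\<forall>z\<in>Z. f (\<xi> z) = \<eta> z"
    using bij_of_parametrizations[OF \<xi>img \<eta>img] by blast
  have feq: "f (BA (n \<otimes> u \<tau> s \<otimes> h), snd s) = (BB (n \<otimes> v \<tau> s \<otimes> h), snd (\<pi> \<tau> s))"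
    if "\<tau> \<in> types" "s \<in> slotsA \<tau>" "n \<in> N" "h \<in> H" for \<tau> s n h
    using bspec[OF f(2), of "(\<tau>, s, n, h)"] that by (auto simp: Z_def \<xi>_def \<eta>_def)
  have pt: "\<exists>\<tau> s n h. \<tau> \<in> types \<and> s \<in> slotsA \<tau> \<and> n \<in> N \<and> h \<in> H \<and> y = (BA (n \<otimes> u \<tau> s \<otimes> h), snd s)"
    if "y \<in> A.points d" for y
  proof -
    obtain z where z: "z \<in> Z" "y = \<xi> z" using \<open>y \<in> A.points d\<close> unfolding \<xi>img[symmetric] by blast
    obtain \<tau> s n h where t: "z = (\<tau>, s, n, h)" by (cases z) auto
    show ?thesis using z unfolding t by (intro exI[of _ \<tau>] exI[of _ s] exI[of _ n] exI[of _ h]) (simp add: Z_def \<xi>_def)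
  qed
  have f1: "f (lshift G m y) = lshift G m (f y)" if m: "m \<in> N" and y: "y \<in> A.points d" for m y
  proof -
    obtain \<tau> s n h where z: "\<tau> \<in> types" "s \<in> slotsA \<tau>" "n \<in> N" "h \<in> H" "y = (BA (n \<otimes> u \<tau> s \<otimes> h), snd s)"
      using pt[OF y] by blast
    note c = uf(2)[OF z(1,2)] uf(6)[OF z(1,2)]
    have "lshift G m y = (BA ((m \<otimes> n) \<otimes> u \<tau> s \<otimes> h), snd s)"
      using A.Bl_left[of "n \<otimes> u \<tau> s \<otimes> h" m] m z c A.NP by (simp add: lshift_def A.m_assoc)
    then have "f (lshift G m y) = (BB ((m \<otimes> n) \<otimes> v \<tau> s \<otimes> h), snd (\<pi> \<tau> s))"
      using feq[OF z(1,2) _ z(4)] m z A.closed by simp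
    also have "\<dots> = lshift G m (f y)"
      using B.Bl_left[of "n \<otimes> v \<tau> s \<otimes> h" m] m z c B.NP feq[OF z(1-4)] by (simp add: lshift_def A.m_assoc)
    finally show ?thesis .
  qed
  have f2: "f (rshift G k y) = rshift G k (f y)" if m: "k \<in> H" and y: "y \<in> A.points d" for k y
  proof -
    obtain \<tau> s n h where z: "\<tau> \<in> types" "s \<in> slotsA \<tau>" "n \<in> N" "h \<in> H" "y = (BA (n \<otimes> u \<tau> s \<otimes> h), snd s)"
      using pt[OF y] by blast
    note c = uf(2)[OF z(1,2)] uf(6)[OF z(1,2)]
    have "rshift G k y = (BA (n \<otimes> u \<tau> s \<otimes> (h \<otimes> k)), snd s)"
      using A.Bl_right[of "n \<otimes> u \<tau> s \<otimes> h" k] m z c by (simp add: rshift_def A.m_assoc)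
    then have "f (rshift G k y) = (BB (n \<otimes> v \<tau> s \<otimes> (h \<otimes> k)), snd (\<pi> \<tau> s))"
      using feq[OF z(1,2,3), of "h \<otimes> k"] m z A.closed by simp
    also have "\<dots> = rshift G k (f y)"
      using B.Bl_right[of "n \<otimes> v \<tau> s \<otimes> h" k] m z c feq[OF z(1-4)] by (simp add: rshift_def A.m_assoc)
    finally show ?thesis .
  qed
  have f3: "f (BA c, 0) = (BB c, 0)" if c: "c \<in> C" for c
  proof -
    \<comment> \<open>The representative of the orbit of \<open>c\<close> may be another core
      element \<open>u\<close>, but then \<open>c = n u h\<close> for some \<open>n\<close> and
      \<open>h\<close>. As \<open>u\<close> serves on both sides, the two blocks of \<open>c\<close>
      have the same parameters.\<close>
    define \<tau> where "\<tau> = A.dcoset c"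
    define s where "s = (A.orb c, 0::nat)"
    have t: "\<tau> \<in> types" using c by (auto simp: \<tau>_def types_def)
    have s: "s \<in> slotsA \<tau>"
      using A.core_region[OF c] d(1) d(2-5)[OF t] by (auto simp: slotsA_def A.orbits_def \<tau>_def s_def div_greater_zero_iff dvd_imp_le)
    have core: "u \<tau> s = v \<tau> s" "u \<tau> s \<in> C" using uv[OF t s] c by (auto simp: Q_def \<tau>_def s_def)
    have "A.orb (u \<tau> s) = A.orb c" using uf(4)[OF t s] by (simp add: s_def)
    then obtain n h where nh: "n \<in> N" "h \<in> H" "c = n \<otimes> u \<tau> s \<otimes> h" using A.core_orb_eq[OF core(2) c] by blast
    have e: "n \<otimes> u \<tau> s \<otimes> h = c" "n \<otimes> v \<tau> s \<otimes> h = c" using nh(3) core(1) by metis+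
    have "\<pi> \<tau> s = (B.orb c, 0)" using \<pi>(2)[OF t] c by (simp add: \<tau>_def s_def)
    moreover have "snd s = 0" by (simp add: s_def)
    ultimately show ?thesis using feq[OF t s nh(1,2)] unfolding e by simp
  qed
  show ?thesis by (intro exI[of _ f] conjI ballI f(1) f1 f2 f3)
qed

end

section \<open>Retractions from glued actions\<close>

definition word_prod :: "('a, 'm) monoid_scheme \<Rightarrow> 'a list \<Rightarrow> 'a" where
  "word_prod G w = foldr (\<lambda>a b. a \<otimes>\<^bsub>G\<^esub> b) w \<one>\<^bsub>G\<^esub>"

text \<open>The universal property of the amalgam, for permutation actions only. The type arguments are those of the
  sets acted on, over which a hypothesis cannot quantify.\<close>

definition glues :: "('a, 'm) monoid_scheme \<Rightarrow> 'a set \<Rightarrow> 'a set \<Rightarrow> 'a set \<Rightarrow> 'x itself \<Rightarrow> 'y itself \<Rightarrow> bool" where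
  "glues G A B N _ _ \<longleftrightarrow> (\<forall>(S :: 'x set) (T :: 'y set) \<alpha> \<beta> f.
     action G A S \<alpha> \<and> action G B T \<beta> \<and> bij_betw f S T \<and> (\<forall>n\<in>N. \<forall>x\<in>S. f (\<alpha> n x) = \<beta> n (f x)) \<longrightarrow>
     (\<exists>\<theta>. action G (carrier G) S \<theta> \<and> (\<forall>a\<in>A. \<forall>x\<in>S. \<theta> a x = \<alpha> a x) \<and> (\<forall>b\<in>B. \<forall>x\<in>S. f (\<theta> b x) = \<beta> b (f x))))"

context group
begin

lemma word_prod_Cons [simp]: "word_prod G (a # w) = a \<otimes> word_prod G w"
  and word_prod_Nil [simp]: "word_prod G [] = \<one>"
  by (simp_all add: word_prod_def)

lemma word_prod_closed: "set w \<subseteq> carrier G \<Longrightarrow> word_prod G w \<in> carrier G"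
  by (induction w) auto

lemma word_prod_append: "set v \<subseteq> carrier G \<Longrightarrow> set w \<subseteq> carrier G \<Longrightarrow> word_prod G (v @ w) = word_prod G v \<otimes> word_prod G w"
  by (induction v) (auto simp: m_assoc word_prod_closed)

lemma generate_word:
  assumes "subgroup A G" "subgroup B G" "g \<in> generate G (A \<union> B)"
  shows "\<exists>w. set w \<subseteq> A \<union> B \<and> word_prod G w = g"
proof -
  have c: "A \<union> B \<subseteq> carrier G" using subgroup.subset[OF assms(1)] subgroup.subset[OF assms(2)] by blast
  show ?thesis using assms(3)
  proof (induction rule: generate.induct)
    case one
    show ?case by (rule exI[of _ "[]"]) simp
  next
    case (incl h)
    then show ?case using c by (intro exI[of _ "[h]"]) auto
  next
    case (inv h)
    then have "inv h \<in> A \<union> B" using subgroup.m_inv_closed[OF assms(1)] subgroup.m_inv_closed[OF assms(2)] by blast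
    then show ?case using c inv by (intro exI[of _ "[inv h]"]) auto
  next
    case (eng g h)
    then obtain v w where "set v \<subseteq> A \<union> B" "word_prod G v = g" "set w \<subseteq> A \<union> B" "word_prod G w = h" by blast
    moreover from this have "set v \<subseteq> carrier G" "set w \<subseteq> carrier G" using c by blast+
    ultimately show ?case using word_prod_append by (intro exI[of _ "v @ w"]) auto
  qed
qed

lemma action_inv:
  assumes "action G (carrier G) S \<theta>" "g \<in> carrier G" "x \<in> S"
  shows "\<theta> (inv g) (\<theta> g x) = x" "\<theta> g (\<theta> (inv g) x) = x"
  using assms unfolding action_def by (metis inv_closed l_inv r_inv)+

end

section \<open>Reading off the retraction\<close>

context two_blocks
begin

text \<open>The base point \<open>x0\<close> is copy \<open>0\<close> of the block of
  \<open>\<one>\<close>. Every suffix of a word for a generator lies in \<open>C\<close>, where the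
  matching identifies the blocks of both factors, so applying the letters one after the other moves
  \<open>x0\<close> exactly as left multiplication would. Hence \<open>s x0 = x0 s\<close> for the
  generators \<open>s\<close>, and then on all of \<open>H\<close>.\<close>

lemma virtual_retract_core:
  assumes gen: "generate G (A \<union> B) = carrier G"
    and glue: "glues G A B N TYPE('a set \<times> nat) TYPE('a set \<times> nat)"
    and S: "S \<subseteq> carrier G" "generate G S = H" and one: "\<one> \<in> C"
    and words: "\<And>s. s \<in> S \<Longrightarrow> \<exists>w. set w \<subseteq> A \<union> B \<and> word_prod G w = s \<and> (\<forall>k. word_prod G (drop k w) \<in> C)"
  shows "virtual_retract H G"
proof -
  let ?S = "A.points d" and ?T = "B.points d"
  obtain f where f: "bij_betw f ?S ?T" "\<forall>n\<in>N. \<forall>y\<in>?S. f (lshift G n y) = lshift G n (f y)"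
    "\<forall>h\<in>H. \<forall>y\<in>?S. f (rshift G h y) = rshift G h (f y)" "\<forall>c\<in>C. f (BA c, 0) = (BB c, 0)"
    using point_matching by (elim exE conjE) (rule that)
  obtain \<theta> where \<theta>: "action G (carrier G) ?S \<theta>" "\<forall>a\<in>A. \<forall>x\<in>?S. \<theta> a x = lshift G a x"
    "\<forall>b\<in>B. \<forall>x\<in>?S. f (\<theta> b x) = lshift G b (f x)"
    using glue[unfolded glues_def, rule_format, of ?S "lshift G" ?T "lshift G" f] A.lshift_action B.lshift_action f(1,2) by auto
  have inj: "inj_on f ?S" and fT: "\<And>x. x \<in> ?S \<Longrightarrow> f x \<in> ?T" using f(1) by (auto simp: bij_betw_def)
  have \<theta>S: "\<theta> g x \<in> ?S" if "g \<in> carrier G" "x \<in> ?S" for g x using \<theta>(1) that by (auto simp: action_def)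
  have \<theta>m: "\<theta> (g \<otimes> h) x = \<theta> g (\<theta> h x)" if "g \<in> carrier G" "h \<in> carrier G" "x \<in> ?S" for g h x
    using \<theta>(1) that by (auto simp: action_def)
  have \<theta>1: "\<theta> \<one> x = x" if "x \<in> ?S" for x using \<theta>(1) that by (auto simp: action_def)
  have AB: "A \<union> B \<subseteq> carrier G" using A.subsets B.subsets by blast
  have comm_gen: "\<theta> g (rshift G h x) = rshift G h (\<theta> g x)" if g: "g \<in> A \<union> B" and h: "h \<in> H" and x: "x \<in> ?S" for g h x
  proof (cases "g \<in> A")
    case True
    then show ?thesis using \<theta>(2) A.lshift_rshift[OF x True h] A.points_right[OF x h] x by simp
  next
    case False
    then have gB: "g \<in> B" "g \<in> carrier G" using g AB by auto
    have "f (\<theta> g (rshift G h x)) = lshift G g (rshift G h (f x))"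
      using \<theta>(3) gB A.points_right[OF x h] f(3) h x by simp
    also have "\<dots> = rshift G h (lshift G g (f x))" using B.lshift_rshift[OF fT[OF x] gB(1) h] .
    also have "\<dots> = f (rshift G h (\<theta> g x))" using \<theta>(3) gB x f(3) h \<theta>S[OF gB(2) x] by simp
    finally show ?thesis
      using inj \<theta>S[OF gB(2) A.points_right[OF x h]] A.points_right[OF \<theta>S[OF gB(2) x] h] by (auto dest: inj_onD)
  qed
  have comm: "\<theta> g (rshift G h x) = rshift G h (\<theta> g x)" if g: "g \<in> carrier G" and h: "h \<in> H" and x: "x \<in> ?S" for g h x
  proof -
    obtain w where w: "set w \<subseteq> A \<union> B" "word_prod G w = g"
      using A.generate_word[OF A.P B.P] g gen by blast
    have "\<theta> (word_prod G w) (rshift G h x) = rshift G h (\<theta> (word_prod G w) x)" using w(1)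
    proof (induction w)
      case Nil
      then show ?case using \<theta>1 A.points_right[OF x h] x by simp
    next
      case (Cons a w)
      have c: "a \<in> carrier G" "word_prod G w \<in> carrier G" using Cons.prems AB A.word_prod_closed[of w] by auto
      then show ?case using Cons comm_gen[OF _ h \<theta>S[OF c(2) x]] \<theta>m A.points_right[OF x h] x by simp
    qed
    then show ?thesis using w by simp
  qed
  have core: "(BA c, 0) \<in> ?S" if c: "c \<in> C" for c
  proof (rule A.pointsI[OF A.core_region[OF c]])
    have t: "A.dcoset c \<in> types" using c by (auto simp: types_def)
    show "0 < d div A.cnt (A.dcoset c)" using d(1) d(2-5)[OF t] by (auto simp: div_greater_zero_iff dvd_imp_le)
  qed
  \<comment> \<open>A letter from \<open>B\<close> acts on the other side of the matching; both
    \<open>c\<close> and \<open>a \<otimes> c\<close> have to be core elements for the passage there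
    and back.\<close>
  have step: "\<theta> a (BA c, 0) = (BA (a \<otimes> c), 0)" if a: "a \<in> A \<union> B" and c: "c \<in> C" "a \<otimes> c \<in> C" for a c
  proof (cases "a \<in> A")
    case True
    then show ?thesis using \<theta>(2) core[OF c(1)] A.Bl_left[of c a] c by (simp add: lshift_def)
  next
    case False
    then have aB: "a \<in> B" using a by blast
    then have "f (\<theta> a (BA c, 0)) = lshift G a (BB c, 0)" using \<theta>(3) core[OF c(1)] f(4) c by simp
    also have "\<dots> = (BB (a \<otimes> c), 0)" using B.Bl_left[of c a] aB c by (simp add: lshift_def)
    also have "\<dots> = f (BA (a \<otimes> c), 0)" using f(4) c by simp
    finally show ?thesis using inj core c \<theta>S[OF _ core[OF c(1)]] aB by (auto dest: inj_onD)
  qed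
  define x0 where "x0 = (BA \<one>, 0::nat)"
  have x0: "x0 \<in> ?S" unfolding x0_def by (rule core[OF one])
  have path: "\<theta> (word_prod G w) x0 = (BA (word_prod G w), 0)"
    if "set w \<subseteq> A \<union> B" "\<forall>k. word_prod G (drop k w) \<in> C" for w
    using that
  proof (induction w)
    case Nil
    then show ?case using \<theta>1 x0 by (simp add: x0_def)
  next
    case (Cons a w)
    have d: "word_prod G (drop k w) \<in> C" for k using Cons.prems(2)[rule_format, of "Suc k"] by simp
    have wC: "word_prod G w \<in> C" using d[of 0] by simp
    have "a \<otimes> word_prod G w \<in> C" using Cons.prems(2)[rule_format, of 0] by simp
    then have "\<theta> a (BA (word_prod G w), 0) = (BA (a \<otimes> word_prod G w), 0)" using Cons.prems(1) wC by (intro step) auto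
    moreover have "a \<in> carrier G" using Cons.prems(1) AB by auto
    ultimately show ?case using Cons.IH Cons.prems(1) d wC \<theta>m x0 by simp
  qed
  have genH: "\<theta> s x0 = rshift G s x0" if s: "s \<in> S" for s
  proof -
    obtain w where w: "set w \<subseteq> A \<union> B" "word_prod G w = s" "\<forall>k. word_prod G (drop k w) \<in> C" using words[OF s] by blast
    have sH: "s \<in> H" using s S generate.incl by metis
    have "\<theta> s x0 = (BA s, 0)" using path[OF w(1,3)] w(2) by simp
    also have "\<dots> = rshift G s x0" using A.Bl_right[of \<one> s] sH by (simp add: rshift_def x0_def)
    finally show ?thesis .
  qed
  have Hact: "h \<in> H \<and> \<theta> h x0 = rshift G h x0" if "h \<in> generate G S" for h
    using that
  proof (induction rule: generate.induct)
    case one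
    then show ?case using \<theta>1 x0 A.rshift_one[OF x0] A.closed by simp
  next
    case (incl h)
    then show ?case using genH S generate.incl by metis
  next
    case (inv h)
    have hH: "h \<in> H" "inv h \<in> H" "h \<in> carrier G" using inv S generate.incl[of h S G] A.closed by auto
    \<comment> \<open>Both sides of \<open>h x0 = x0 h\<close> are multiplied by
      \<open>inv h\<close> from the left and from the right, which is legitimate as the two actions
      commute.\<close>
    have "rshift G (inv h) (\<theta> (inv h) (\<theta> h x0)) = \<theta> (inv h) (rshift G (inv h) (rshift G h x0))"
      using comm[of "inv h" "inv h" "rshift G h x0"] hH A.points_right[OF x0 hH(1)] genH[OF inv] by simp
    then show ?case
      using A.action_inv(1)[OF \<theta>(1) hH(3) x0] A.rshift_rshift[OF x0 hH(1,2)] A.rshift_one[OF x0] hH by simp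
  next
    case (eng g h)
    have c: "g \<in> H" "h \<in> H" "g \<in> carrier G" "h \<in> carrier G" using eng by auto
    have "\<theta> (g \<otimes> h) x0 = \<theta> g (rshift G h x0)" using \<theta>m[OF c(3,4) x0] eng by simp
    also have "\<dots> = rshift G h (rshift G g x0)" using comm[OF c(3,2) x0] eng by simp
    also have "\<dots> = rshift G (g \<otimes> h) x0" using A.rshift_rshift[OF x0 c(1,2)] .
    finally show ?case using c A.closed by simp
  qed
  have H0: "\<theta> h x0 = rshift G h x0" if "h \<in> H" for h using Hact that S by blast
  define K where "K = {g \<in> carrier G. \<exists>h\<in>H. \<theta> g x0 = rshift G h x0}"
  have uniq: "h = k" if "h \<in> H" "k \<in> H" "rshift G h x0 = rshift G k x0" for h k
    using A.rshift_free[of \<one> h k] that by (simp add: x0_def)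
  \<comment> \<open>Well defined because \<open>H\<close> acts freely on the right.\<close>
  define \<rho> where "\<rho> g = (THE h. h \<in> H \<and> \<theta> g x0 = rshift G h x0)" for g
  have \<rho>I: "\<rho> g = h" if "h \<in> H" "\<theta> g x0 = rshift G h x0" for g h
    unfolding \<rho>_def by (rule the_equality) (use that uniq in auto)
  have \<rho>: "\<rho> g \<in> H" "\<theta> g x0 = rshift G (\<rho> g) x0" if "g \<in> K" for g
    using that \<rho>I by (auto simp: K_def)
  have mult: "g \<otimes> k \<in> K \<and> \<rho> (g \<otimes> k) = \<rho> g \<otimes> \<rho> k" if gk: "g \<in> K" "k \<in> K" for g k
  proof -
    have c: "g \<in> carrier G" "k \<in> carrier G" using gk by (auto simp: K_def)
    have "\<theta> (g \<otimes> k) x0 = \<theta> g (rshift G (\<rho> k) x0)" using \<theta>m[OF c x0] \<rho>[OF gk(2)] by simp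
    also have "\<dots> = rshift G (\<rho> k) (rshift G (\<rho> g) x0)" using comm[OF c(1) \<rho>(1)[OF gk(2)] x0] \<rho>[OF gk(1)] by simp
    also have "\<dots> = rshift G (\<rho> g \<otimes> \<rho> k) x0" using A.rshift_rshift[OF x0 \<rho>(1)[OF gk(1)] \<rho>(1)[OF gk(2)]] .
    finally have e: "\<theta> (g \<otimes> k) x0 = rshift G (\<rho> g \<otimes> \<rho> k) x0" .
    have rH: "\<rho> g \<otimes> \<rho> k \<in> H" using A.closed(2)[OF \<rho>(1)[OF gk(1)] \<rho>(1)[OF gk(2)]] .
    have "g \<otimes> k \<in> K" unfolding K_def using rH e c by blast
    then show ?thesis using \<rho>I[OF rH e] by simp
  qed
  have Ks: "subgroup K G"
  proof (rule A.subgroupI)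
    show "K \<subseteq> carrier G" by (auto simp: K_def)
    have "\<one> \<in> K" unfolding K_def using H0 A.closed by blast
    then show "K \<noteq> {}" by blast
    fix g assume g: "g \<in> K"
    have c: "g \<in> carrier G" using g by (simp add: K_def)
    have h: "\<rho> g \<in> H" "inv (\<rho> g) \<in> H" using \<rho>(1)[OF g] A.closed by auto
    have "\<theta> (inv g) (rshift G (inv (\<rho> g)) (\<theta> g x0)) = rshift G (inv (\<rho> g)) x0"
      using comm[OF _ h(2) \<theta>S[OF c x0]] A.action_inv(1)[OF \<theta>(1) c x0] c by simp
    then have "\<theta> (inv g) x0 = rshift G (inv (\<rho> g)) x0"
      using \<rho>(2)[OF g] A.rshift_rshift[OF x0 h] A.rshift_one[OF x0] h by simp
    then show "inv g \<in> K" unfolding K_def using c h by auto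
  qed (use mult in blast)
  \<comment> \<open>The coset of \<open>g\<close> is detected by the \<open>H\<close>-orbit of
    \<open>inv g\<close> applied to \<open>x0\<close>; the inverse appears because the cosets are
    \<open>K g\<close> with \<open>K\<close> the stabilizer of the orbit of
    \<open>x0\<close>.\<close>
  have fin: "fidx G K (carrier G)"
  proof (rule A.fidx_by_map[OF Ks, where \<phi> = "\<lambda>g. (\<lambda>h. rshift G h (\<theta> (inv g) x0)) ` H"])
    have "(\<lambda>g. (\<lambda>h. rshift G h (\<theta> (inv g) x0)) ` H) ` carrier G \<subseteq> (\<lambda>y. (\<lambda>h. rshift G h y) ` H) ` ?S"
    proof (rule image_subsetI)
      fix g assume "g \<in> carrier G"
      then have "\<theta> (inv g) x0 \<in> ?S" using \<theta>S x0 by simp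
      then show "(\<lambda>h. rshift G h (\<theta> (inv g) x0)) ` H \<in> (\<lambda>y. (\<lambda>h. rshift G h y) ` H) ` ?S" by (rule imageI)
    qed
    then show "finite ((\<lambda>g. (\<lambda>h. rshift G h (\<theta> (inv g) x0)) ` H) ` carrier G)"
      using A.finite_rshift_orbits by (rule finite_subset)
    fix x y assume xy: "x \<in> carrier G" "y \<in> carrier G"
      "(\<lambda>h. rshift G h (\<theta> (inv x) x0)) ` H = (\<lambda>h. rshift G h (\<theta> (inv y) x0)) ` H"
    have yi: "\<theta> (inv y) x0 \<in> ?S" "\<theta> (inv x) x0 \<in> ?S" using \<theta>S x0 xy by auto
    have "rshift G \<one> (\<theta> (inv y) x0) \<in> (\<lambda>h. rshift G h (\<theta> (inv x) x0)) ` H" unfolding xy(3) using A.closed by blast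
    then obtain h where h: "h \<in> H" "\<theta> (inv y) x0 = rshift G h (\<theta> (inv x) x0)" using A.rshift_one[OF yi(1)] by auto
    have "\<theta> (x \<otimes> inv y) x0 = \<theta> x (rshift G h (\<theta> (inv x) x0))" using \<theta>m[of x "inv y" x0] xy x0 h by simp
    also have "\<dots> = rshift G h x0" using comm[OF xy(1) h(1) yi(2)] A.action_inv(2)[OF \<theta>(1) xy(1) x0] by simp
    finally show "x \<otimes> inv y \<in> K" unfolding K_def using h xy by auto
  qed auto
  have HK: "H \<subseteq> K" using H0 by (auto simp: K_def)
  have "\<rho> h = h" if "h \<in> H" for h using \<rho>I[OF that H0[OF that]] .
  moreover have "\<rho> \<in> hom (G\<lparr>carrier := K\<rparr>) (G\<lparr>carrier := H\<rparr>)"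
    using \<rho>(1) mult by (auto simp: hom_def)
  ultimately show ?thesis unfolding virtual_retract_def A.finite_index_subgroup_iff
    using Ks fin HK A.H by blast
qed

end

section \<open>Reduction to the case where \<open>H\<close> contains a finite index subgroup of
  \<open>N\<close>\<close>

context group
begin

text \<open>A retraction of \<open>U\<close> onto \<open>H\<close> composes with a virtual
  retraction onto \<open>U\<close>, and the finite index subgroup stays the same.\<close>

lemma virtual_retract_trans:
  assumes H: "subgroup H G" and U: "virtual_retract U G" "H \<subseteq> U"
    and \<sigma>: "\<sigma> \<in> hom (G\<lparr>carrier := U\<rparr>) (G\<lparr>carrier := H\<rparr>)" "\<And>h. h \<in> H \<Longrightarrow> \<sigma> h = h"
  shows "virtual_retract H G"
proof -
  obtain K \<rho> where K: "finite_index_subgroup K G" "U \<subseteq> K"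
    "\<rho> \<in> hom (G\<lparr>carrier := K\<rparr>) (G\<lparr>carrier := U\<rparr>)" "\<forall>u\<in>U. \<rho> u = u"
    using U(1) unfolding virtual_retract_def by blast
  have "\<sigma> \<circ> \<rho> \<in> hom (G\<lparr>carrier := K\<rparr>) (G\<lparr>carrier := H\<rparr>)"
    using K(3) \<sigma>(1) by (auto simp: hom_def Pi_def)
  moreover have "\<forall>h\<in>H. (\<sigma> \<circ> \<rho>) h = h" using K(4) U(2) \<sigma>(2) by auto
  ultimately show ?thesis unfolding virtual_retract_def using H K U(2) by blast
qed

text \<open>\<open>U\<close> is the semidirect product of \<open>R\<close> by \<open>H\<close>, and
  the retraction is the quotient map that kills \<open>R\<close>.\<close>

lemma retract_of_product:
  assumes H: "subgroup H G" and R: "subgroup R G" "\<And>h r. \<lbrakk>h \<in> H; r \<in> R\<rbrakk> \<Longrightarrow> h \<otimes> r \<otimes> inv h \<in> R" "R \<inter> H = {\<one>}"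
    and "fg_subgroup H G" "fg_subgroup R G"
  defines "U \<equiv> {r \<otimes> h | r h. r \<in> R \<and> h \<in> H}"
  shows "fg_subgroup U G" "subgroup U G" "H \<subseteq> U" "R \<subseteq> U"
    "\<exists>\<sigma>\<in>hom (G\<lparr>carrier := U\<rparr>) (G\<lparr>carrier := H\<rparr>). \<forall>h\<in>H. \<sigma> h = h"
proof -
  have Hc: "H \<subseteq> carrier G" and Rc: "R \<subseteq> carrier G" using subgroup.subset[OF H] subgroup.subset[OF R(1)] .
  have UI: "r \<otimes> h \<in> U" if "r \<in> R" "h \<in> H" for r h using that by (auto simp: U_def)
  have mult: "(r \<otimes> h) \<otimes> (r' \<otimes> h') = (r \<otimes> (h \<otimes> r' \<otimes> inv h)) \<otimes> (h \<otimes> h')"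
    if "r \<in> R" "h \<in> H" "r' \<in> R" "h' \<in> H" for r h r' h'
  proof -
    have "r \<in> carrier G" "h \<in> carrier G" "r' \<in> carrier G" "h' \<in> carrier G" using that Hc Rc by auto
    then show ?thesis by (simp add: m_assoc)
  qed
  show HU: "H \<subseteq> U"
  proof
    fix h assume "h \<in> H"
    then show "h \<in> U" using UI[OF subgroup.one_closed[OF R(1)], of h] Hc by auto
  qed
  show RU: "R \<subseteq> U"
  proof
    fix r assume "r \<in> R"
    then show "r \<in> U" using UI[OF _ subgroup.one_closed[OF H], of r] Rc by auto
  qed
  show Us: "subgroup U G"
  proof (rule subgroupI)
    show "U \<subseteq> carrier G" using Hc Rc by (auto simp: U_def)
    show "U \<noteq> {}" using HU subgroup.one_closed[OF H] by blast
    fix a b assume "a \<in> U" "b \<in> U"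
    then obtain r h r' h' where ab: "r \<in> R" "h \<in> H" "a = r \<otimes> h" "r' \<in> R" "h' \<in> H" "b = r' \<otimes> h'"
      by (auto simp: U_def)
    then have "a \<otimes> b = (r \<otimes> (h \<otimes> r' \<otimes> inv h)) \<otimes> (h \<otimes> h')" using mult by simp
    moreover have "r \<otimes> (h \<otimes> r' \<otimes> inv h) \<in> R" using ab R(2) subgroup.m_closed[OF R(1)] by blast
    moreover have "h \<otimes> h' \<in> H" using ab subgroup.m_closed[OF H] by blast
    ultimately show "a \<otimes> b \<in> U" using UI by simp
  next
    fix a assume "a \<in> U"
    then obtain r h where ab: "r \<in> R" "h \<in> H" "a = r \<otimes> h" by (auto simp: U_def)
    have c: "r \<in> carrier G" "h \<in> carrier G" using ab Hc Rc by auto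
    have hi: "inv h \<in> H" "inv r \<in> R" using ab subgroup.m_inv_closed[OF H] subgroup.m_inv_closed[OF R(1)] by auto
    have "inv a = (inv h \<otimes> inv r \<otimes> inv (inv h)) \<otimes> inv h" using ab c by (simp add: group_normalize)
    then show "inv a \<in> U" using UI[OF R(2)[OF hi] hi(1)] by simp
  qed
  obtain S where S: "finite S" "S \<subseteq> carrier G" "generate G S = H" using assms(5) unfolding fg_subgroup_def by blast
  obtain T where T: "finite T" "T \<subseteq> carrier G" "generate G T = R" using assms(6) unfolding fg_subgroup_def by blast
  have "generate G (S \<union> T) = U"
  proof
    have "S \<union> T \<subseteq> U" using HU RU S T generate.incl[of _ S G] generate.incl[of _ T G] by blast
    then show "generate G (S \<union> T) \<subseteq> U" using generate_subgroup_incl Us by blast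
    show "U \<subseteq> generate G (S \<union> T)"
    proof
      fix a assume "a \<in> U"
      then obtain r h where ab: "r \<in> R" "h \<in> H" "a = r \<otimes> h" by (auto simp: U_def)
      have "r \<in> generate G (S \<union> T)" "h \<in> generate G (S \<union> T)"
        using ab S T mono_generate[of S "S \<union> T"] mono_generate[of T "S \<union> T"] by auto
      then show "a \<in> generate G (S \<union> T)" unfolding ab(3) by (rule generate.eng)
    qed
  qed
  then show "fg_subgroup U G" unfolding fg_subgroup_def using S T by (intro exI[of _ "S \<union> T"]) auto
  define \<sigma> where "\<sigma> a = (THE h. h \<in> H \<and> a \<otimes> inv h \<in> R)" for a
  have \<sigma>: "\<sigma> (r \<otimes> h) = h" if rh: "r \<in> R" "h \<in> H" for r h
    unfolding \<sigma>_def
  proof (rule the_equality)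
    have c: "r \<in> carrier G" "h \<in> carrier G" using rh Hc Rc by auto
    show "h \<in> H \<and> (r \<otimes> h) \<otimes> inv h \<in> R" using rh c by (simp add: m_assoc)
    fix k assume k: "k \<in> H \<and> (r \<otimes> h) \<otimes> inv k \<in> R"
    have kc: "k \<in> carrier G" using k Hc by auto
    have "inv r \<otimes> ((r \<otimes> h) \<otimes> inv k) \<in> R" using k rh subgroup.m_closed[OF R(1)] subgroup.m_inv_closed[OF R(1)] by blast
    then have "h \<otimes> inv k \<in> R" using c kc by (simp add: m_assoc)
    moreover have "h \<otimes> inv k \<in> H" using k rh subgroup.m_closed[OF H] subgroup.m_inv_closed[OF H] by blast
    ultimately have "h \<otimes> inv k = \<one>" using R(3) by blast
    then show "k = h" using c kc inv_equality[of h "inv k"] by simp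
  qed
  have "\<sigma> \<in> hom (G\<lparr>carrier := U\<rparr>) (G\<lparr>carrier := H\<rparr>)"
  proof (rule homI)
    fix a assume "a \<in> carrier (G\<lparr>carrier := U\<rparr>)"
    then show "\<sigma> a \<in> carrier (G\<lparr>carrier := H\<rparr>)" using \<sigma> by (auto simp: U_def)
  next
    fix a b assume "a \<in> carrier (G\<lparr>carrier := U\<rparr>)" "b \<in> carrier (G\<lparr>carrier := U\<rparr>)"
    then obtain r h r' h' where ab: "r \<in> R" "h \<in> H" "a = r \<otimes> h" "r' \<in> R" "h' \<in> H" "b = r' \<otimes> h'"
      by (auto simp: U_def)
    have "\<sigma> (a \<otimes> b) = h \<otimes> h'"
      unfolding ab mult[OF ab(1,2,4,5)]
      by (rule \<sigma>) (use ab R(2) subgroup.m_closed[OF R(1)] subgroup.m_closed[OF H] in blast)+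
    then show "\<sigma> (a \<otimes>\<^bsub>G\<lparr>carrier := U\<rparr>\<^esub> b) = \<sigma> a \<otimes>\<^bsub>G\<lparr>carrier := H\<rparr>\<^esub> \<sigma> b"
      using ab \<sigma> by simp
  qed
  moreover have "\<sigma> h = h" if "h \<in> H" for h
    using \<sigma>[OF subgroup.one_closed[OF R(1)] that] that Hc by auto
  ultimately show "\<exists>\<sigma>\<in>hom (G\<lparr>carrier := U\<rparr>) (G\<lparr>carrier := H\<rparr>). \<forall>h\<in>H. \<sigma> h = h" by blast
qed

text \<open>Passing from \<open>M\<close> to \<open>L\<close> makes the two factors comparable: the
  lattice \<open>M\<close> belongs to \<open>P\<close>, while \<open>L\<close> is shared.\<close>

lemma block_system_exists:
  assumes P: "subgroup P G" and N: "N \<lhd> G" "N \<subseteq> P" "N \<subseteq> L" and H: "subgroup H G"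
    and D: "D \<lhd> G" "D \<subseteq> N" "D \<subseteq> H" "fidx G D N"
    and M: "lattice_in M P" "M \<subseteq> L" and L: "L \<lhd> G"
    and C: "finite C" "C \<subseteq> carrier G" "\<And>x. x \<in> carrier G \<Longrightarrow> \<exists>c\<in>C. \<exists>l\<in>L. \<exists>h\<in>H. x = l \<otimes> c \<otimes> h"
  shows "\<exists>Bl. block_system G N H P L C Bl"
proof -
  interpret bd: block_data G N H D P M C
    by (rule block_data.intro[OF group_axioms block_data_axioms.intro[OF P N(1,2) H D M(1) C(1,2)]])
  obtain Bl where bm: "bd.block_map Bl" using bd.block_map_exists by blast
  have b: "\<forall>x\<in>carrier G. Bl x \<subseteq> carrier G"
    "\<forall>x\<in>carrier G. \<forall>p\<in>P. Bl (p \<otimes> x) = p <# Bl x"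
    "\<forall>x\<in>carrier G. \<forall>h\<in>H. Bl (x \<otimes> h) = Bl x #> h"
    "\<forall>x\<in>carrier G. \<forall>y\<in>carrier G. Bl x = Bl y \<longrightarrow> y \<otimes> inv x \<in> M"
    "\<forall>x\<in>carrier G. \<forall>n\<in>N. \<forall>h\<in>H. Bl (n \<otimes> x \<otimes> h) = Bl x \<longrightarrow> n \<otimes> x \<otimes> h = x"
    "\<forall>c\<in>C. \<forall>c'\<in>C. \<forall>n\<in>N. \<forall>h\<in>H. Bl (n \<otimes> c \<otimes> h) = Bl c' \<longrightarrow> n \<otimes> c \<otimes> h = c'"
    "\<forall>x\<in>carrier G. \<exists>T. finite T \<and> T \<subseteq> P \<and> (\<forall>p\<in>P. \<exists>t\<in>T. \<exists>h\<in>H. Bl (p \<otimes> x) = Bl (t \<otimes> x \<otimes> h))"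
    by ((insert bm[unfolded bd.block_map_def], elim conjE, assumption)+)
  have b': "\<And>x. x \<in> carrier G \<Longrightarrow> Bl x \<subseteq> carrier G"
    "\<And>x p. \<lbrakk>x \<in> carrier G; p \<in> P\<rbrakk> \<Longrightarrow> Bl (p \<otimes> x) = p <# Bl x"
    "\<And>x h. \<lbrakk>x \<in> carrier G; h \<in> H\<rbrakk> \<Longrightarrow> Bl (x \<otimes> h) = Bl x #> h"
    "\<And>x y. \<lbrakk>x \<in> carrier G; y \<in> carrier G; Bl x = Bl y\<rbrakk> \<Longrightarrow> y \<otimes> inv x \<in> L"
    "\<And>x n h. \<lbrakk>x \<in> carrier G; n \<in> N; h \<in> H; Bl (n \<otimes> x \<otimes> h) = Bl x\<rbrakk> \<Longrightarrow> n \<otimes> x \<otimes> h = x"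
    "\<And>c c' n h. \<lbrakk>c \<in> C; c' \<in> C; n \<in> N; h \<in> H; Bl (n \<otimes> c \<otimes> h) = Bl c'\<rbrakk> \<Longrightarrow> n \<otimes> c \<otimes> h = c'"
    "\<And>x. x \<in> carrier G \<Longrightarrow> \<exists>T. finite T \<and> T \<subseteq> P \<and> (\<forall>p\<in>P. \<exists>t\<in>T. \<exists>h\<in>H. Bl (p \<otimes> x) = Bl (t \<otimes> x \<otimes> h))"
    subgoal using b(1) by simp
    subgoal using b(2) by simp
    subgoal using b(3) by simp
    subgoal using b(4) M(2) by blast
    subgoal using b(5) by simp
    subgoal using b(6) by simp
    subgoal using b(7) by simp
    done
  have "block_system G N H P L C Bl"
    by (rule block_system.intro[OF group_axioms], rule block_system_axioms.intro)
      ((rule P N H L C b'; assumption)+)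
  then show ?thesis by blast
qed

text \<open>Finite generation of \<open>N\<close> comes last, as a finite extension of the finitely
  generated group \<open>M \<inter> N\<close>.\<close>

lemma lattice_restrict:
  assumes M: "lattice_in M P" and N: "subgroup N G" "N \<subseteq> P"
  shows "subgroup (M \<inter> N) G" "commuting G (M \<inter> N)" "torsion_free G (M \<inter> N)" "fg_subgroup (M \<inter> N) G"
    "fidx G (M \<inter> N) N" "fg_subgroup N G"
proof -
  have Mf: "subgroup M G" "commuting G M" "fg_subgroup M G" "torsion_free G M" "fidx G M P"
    using M by (auto simp: lattice_in_def)
  show s: "subgroup (M \<inter> N) G" by (rule subgroups_Inter_pair[OF Mf(1) N(1)])
  show "commuting G (M \<inter> N)" using commuting_subset[OF Mf(2)] by blast
  show "torsion_free G (M \<inter> N)" using torsion_free_subset[OF Mf(4)] by blast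
  show fg: "fg_subgroup (M \<inter> N) G" by (rule abelian_subgroup_fg[OF Mf(1-3) s]) blast
  show fin: "fidx G (M \<inter> N) N" by (rule fidx_inter_restrict[OF Mf(1) N Mf(5)])
  show "fg_subgroup N G" by (rule fg_subgroup_fidx_extend[OF N(1) fg _ fin]) blast
qed

text \<open>The given \<open>V\<close> need not be normal in \<open>G\<close>. The
  \<open>e\<close>-th powers of all of \<open>N\<close>, not only of \<open>V\<close>, generate a
  subgroup invariant under every automorphism of \<open>N\<close>, hence normal in \<open>G\<close>;
  the choice of \<open>e\<close> keeps it inside \<open>V\<close>.\<close>

lemma normal_lattice:
  assumes N: "N \<lhd> G" and V: "subgroup V G" "V \<subseteq> N" "commuting G V" "torsion_free G V" "fg_subgroup V G" "fidx G V N"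
  shows "\<exists>M. M \<lhd> G \<and> M \<subseteq> N \<and> commuting G M \<and> torsion_free G M \<and> fg_subgroup M G \<and> fidx G M N"
proof -
  have Ns: "subgroup N G" using N by (rule normal_imp_subgroup)
  have Nc: "N \<subseteq> carrier G" using subgroup.subset[OF Ns] .
  obtain e where e: "e > 0" "\<And>n. n \<in> N \<Longrightarrow> n [^] (e::nat) \<in> V"
    using fidx_common_power[OF V(1) Ns V(6)] by blast
  define M where "M = generate G (powers G e N)"
  have pV: "powers G e N \<subseteq> V" using e by (auto simp: powers_def)
  have in_carrier: "powers G e N \<subseteq> carrier G" using pV V(2) Nc by blast
  have MV: "M \<subseteq> V" unfolding M_def by (rule generate_subgroup_incl[OF pV V(1)])
  have Mn: "M \<lhd> G" unfolding M_def
  proof (rule normal_generateI[OF in_carrier])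
    fix h g assume h: "h \<in> powers G e N" and g: "g \<in> carrier G"
    show "g \<otimes> h \<otimes> inv g \<in> powers G e N"
      by (rule powers_conj_closed[OF Nc g _ h]) (rule normal.inv_op_closed2[OF N g])
  qed
  have Ms: "subgroup M G" using Mn by (rule normal_imp_subgroup)
  have "fidx G M V"
  proof (rule abelian_power_fidx[OF V(1,3,5) Ms MV e(1)])
    fix v assume "v \<in> V"
    then have "v [^] e \<in> powers G e N" using V(2) by (auto simp: powers_def)
    then show "v [^] e \<in> M" unfolding M_def by (rule generate.incl)
  qed
  then have "fidx G M N" using fidx_trans[OF Ms V(1) Nc _ V(6)] by blast
  moreover have "fg_subgroup M G" by (rule abelian_subgroup_fg[OF V(1,3,5) Ms MV])
  ultimately show ?thesis
    using Mn MV V(2) commuting_subset[OF V(3) MV] torsion_free_subset[OF V(4) MV] by blast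
qed

text \<open>Up to finitely many coset representatives of \<open>L\<close>, only products
  \<open>n \<otimes> z\<close> with \<open>z\<close> centralizing \<open>N\<close> have to be
  considered. Here \<open>z\<close> acts trivially on \<open>M\<close>, and \<open>n\<close> acts
  through the finite quotient of \<open>N\<close> by the abelian group \<open>M\<close>.\<close>

lemma finite_conj_action:
  assumes N: "N \<lhd> G" and M: "M \<lhd> G" "M \<subseteq> N" "commuting G M" "fidx G M N"
    and L: "subgroup L G" "fidx G L (carrier G)"
      "\<And>l. l \<in> L \<Longrightarrow> \<exists>n\<in>N. \<exists>z\<in>carrier G. (\<forall>m\<in>N. z \<otimes> m = m \<otimes> z) \<and> l = n \<otimes> z"
  shows "finite ((\<lambda>g. \<lambda>m\<in>M. g \<otimes> m \<otimes> inv g) ` carrier G)"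
proof -
  have Ns: "subgroup N G" and Ms: "subgroup M G" using N M normal_imp_subgroup by auto
  have Nc: "N \<subseteq> carrier G" and Mc: "M \<subseteq> carrier G" using subgroup.subset[OF Ns] subgroup.subset[OF Ms] .
  obtain F where F: "finite F" "F \<subseteq> carrier G" "\<forall>v\<in>carrier G. \<exists>f\<in>F. v \<otimes> inv f \<in> L"
    using fidx_transversal[OF L(1) subset_refl L(2)] by blast
  obtain E where E: "finite E" "E \<subseteq> N" "\<forall>v\<in>N. \<exists>f\<in>E. v \<otimes> inv f \<in> M"
    using fidx_transversal[OF Ms Nc M(4)] by blast
  let ?\<phi> = "\<lambda>g. \<lambda>m\<in>M. g \<otimes> m \<otimes> inv g"
  have "?\<phi> ` carrier G \<subseteq> (\<lambda>(e, f). ?\<phi> (e \<otimes> f)) ` (E \<times> F)"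
  proof
    fix y assume "y \<in> ?\<phi> ` carrier G"
    then obtain g where g: "g \<in> carrier G" "y = ?\<phi> g" by blast
    obtain f where f: "f \<in> F" "g \<otimes> inv f \<in> L" using F g by blast
    obtain n z where nz: "n \<in> N" "z \<in> carrier G" "\<forall>m\<in>N. z \<otimes> m = m \<otimes> z" "g \<otimes> inv f = n \<otimes> z" using L(3)[OF f(2)] by blast
    obtain e where e: "e \<in> E" "n \<otimes> inv e \<in> M" using E nz by blast
    have "g \<otimes> m \<otimes> inv g = (e \<otimes> f) \<otimes> m \<otimes> inv (e \<otimes> f)" if m: "m \<in> M" for m
    proof -
      have c: "f \<in> carrier G" "n \<in> carrier G" "e \<in> carrier G" "m \<in> carrier G" "z \<in> carrier G"
        using f F nz e E Nc m Mc by auto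
      have geq: "g = (n \<otimes> inv e) \<otimes> e \<otimes> z \<otimes> f"
      proof -
        have "g = (g \<otimes> inv f) \<otimes> f" using g c by (simp add: m_assoc)
        then show ?thesis unfolding nz(4) using c by (simp add: m_assoc)
      qed
      have fm: "f \<otimes> m \<otimes> inv f \<in> M" using normal.inv_op_closed2[OF M(1) c(1) m] .
      then have "z \<otimes> (f \<otimes> m \<otimes> inv f) = (f \<otimes> m \<otimes> inv f) \<otimes> z" using nz(3) M(2) by blast
      then have 1: "z \<otimes> (f \<otimes> m \<otimes> inv f) \<otimes> inv z = f \<otimes> m \<otimes> inv f" using c by (simp add: m_assoc)
      have efm: "e \<otimes> (f \<otimes> m \<otimes> inv f) \<otimes> inv e \<in> M" using normal.inv_op_closed2[OF M(1) c(3) fm] .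
      have "(n \<otimes> inv e) \<otimes> (e \<otimes> (f \<otimes> m \<otimes> inv f) \<otimes> inv e) = (e \<otimes> (f \<otimes> m \<otimes> inv f) \<otimes> inv e) \<otimes> (n \<otimes> inv e)"
        using commutingD[OF M(3) e(2) efm] .
      then have 2: "(n \<otimes> inv e) \<otimes> (e \<otimes> (f \<otimes> m \<otimes> inv f) \<otimes> inv e) \<otimes> inv (n \<otimes> inv e) = e \<otimes> (f \<otimes> m \<otimes> inv f) \<otimes> inv e"
        using c by (simp add: group_normalize)
      have "g \<otimes> m \<otimes> inv g = (n \<otimes> inv e) \<otimes> (e \<otimes> (z \<otimes> (f \<otimes> m \<otimes> inv f) \<otimes> inv z) \<otimes> inv e) \<otimes> inv (n \<otimes> inv e)"
        unfolding geq using c by (simp add: group_normalize)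
      also have "\<dots> = (e \<otimes> f) \<otimes> m \<otimes> inv (e \<otimes> f)" unfolding 1 2 using c by (simp add: group_normalize)
      finally show ?thesis .
    qed
    then have "y = ?\<phi> (e \<otimes> f)" unfolding g(2) by (intro restrict_ext)
    then show "y \<in> (\<lambda>(e, f). ?\<phi> (e \<otimes> f)) ` (E \<times> F)" using e f
      by (intro image_eqI[of _ _ "(e, f)"]) simp_all
  qed
  then show ?thesis by (rule finite_surj[rotated]) (simp add: E(1) F(1))
qed

lemma powers_normal:
  assumes "M \<lhd> G" "commuting G M"
  shows "powers G n M \<lhd> G"
proof (rule normal_invI)
  have Ms: "subgroup M G" using assms(1) by (rule normal_imp_subgroup)
  show "subgroup (powers G n M) G" by (rule powers_subgroup(1)[OF Ms assms(2)])
  fix x h assume "x \<in> carrier G" "h \<in> powers G n M"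
  then show "x \<otimes> h \<otimes> inv x \<in> powers G n M"
    using powers_conj_closed[OF subgroup.subset[OF Ms]] normal.inv_op_closed2[OF assms(1)] by blast
qed

text \<open>\<open>A\<close> and \<open>B\<close> are subgroups generating \<open>G\<close>; that
  \<open>G\<close> is their amalgam enters only through \<open>glue\<close>.\<close>

theorem property_LR_of_glue:
  assumes A: "subgroup A G" "fg_subgroup A G" and KA: "subgroup KA G" "KA \<subseteq> A" "commuting G KA" "fidx G KA A"
    and B: "subgroup B G" "fg_subgroup B G" and KB: "subgroup KB G" "KB \<subseteq> B" "commuting G KB" "fidx G KB B"
    and N: "N \<lhd> G" "N \<subseteq> A" "N \<subseteq> B" and gen: "generate G (A \<union> B) = carrier G"
    and glue: "glues G A B N TYPE('a set \<times> nat) TYPE('a set \<times> nat)"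
    and L: "L \<lhd> G" "N \<subseteq> L" "fidx G L (carrier G)"
      "\<And>l. l \<in> L \<Longrightarrow> \<exists>n\<in>N. \<exists>z\<in>carrier G. (\<forall>m\<in>N. z \<otimes> m = m \<otimes> z) \<and> l = n \<otimes> z"
  shows "property_LR G"
  unfolding property_LR_def
proof (intro allI impI)
  fix H assume Hfg: "fg_subgroup H G"
  have Hs: "subgroup H G" using Hfg generate_is_subgroup unfolding fg_subgroup_def by blast
  have Ns: "subgroup N G" and Ls: "subgroup L G" by (rule normal_imp_subgroup[OF N(1)], rule normal_imp_subgroup[OF L(1)])
  have Hc: "H \<subseteq> carrier G" and Nc: "N \<subseteq> carrier G" using subgroup.subset[OF Hs] subgroup.subset[OF Ns] .
  \<comment> \<open>The lattices are taken inside \<open>L\<close>, so that collapsing never changes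
    the type.\<close>
  obtain MA where MA: "lattice_in MA A" "MA \<subseteq> L"
    using lattice_in_exists[OF A KA Ls fidx_subset[OF L(3) subgroup.subset[OF A(1)]]] by blast
  obtain MB where MB: "lattice_in MB B" "MB \<subseteq> L"
    using lattice_in_exists[OF B KB Ls fidx_subset[OF L(3) subgroup.subset[OF B(1)]]] by blast
  note V = lattice_restrict[OF MA(1) Ns N(2)]
  obtain M where M: "M \<lhd> G" "M \<subseteq> N" "commuting G M" "torsion_free G M" "fg_subgroup M G" "fidx G M N"
    using normal_lattice[OF N(1) V(1) _ V(2,3,4,5)] by blast
  have Ms: "subgroup M G" using M(1) by (rule normal_imp_subgroup)
  have Mc: "M \<subseteq> carrier G" using subgroup.subset[OF Ms] .
  have "finite ((\<lambda>s. \<lambda>m\<in>M. s \<otimes> m \<otimes> inv s) ` H)"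
    using finite_conj_action[OF N(1) M(1,2,3,6) Ls L(3,4)] Hc by (meson finite_subset image_mono)
  then obtain R where R: "subgroup R G" "R \<subseteq> M" "\<forall>s\<in>H. \<forall>r\<in>R. s \<otimes> r \<otimes> inv s \<in> R" "R \<inter> H = {\<one>}"
    "\<exists>k>0. \<forall>m\<in>M. \<exists>r\<in>R. \<exists>w\<in>H \<inter> M. m [^] (k::nat) = r \<otimes> w"
    using invariant_complement[OF Ms M(3,5,4) Hs] normal.inv_op_closed2[OF M(1)] Hc by blast
  obtain k where k: "k > 0" "\<forall>m\<in>M. \<exists>r\<in>R. \<exists>w\<in>H \<inter> M. m [^] (k::nat) = r \<otimes> w" using R(5) by blast
  have Rfg: "fg_subgroup R G" by (rule abelian_subgroup_fg[OF Ms M(3,5) R(1,2)])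
  define U where "U = {r \<otimes> h | r h. r \<in> R \<and> h \<in> H}"
  have R3: "\<And>h r. \<lbrakk>h \<in> H; r \<in> R\<rbrakk> \<Longrightarrow> h \<otimes> r \<otimes> inv h \<in> R" using R(3) by blast
  note U = retract_of_product[OF Hs R(1) R3 R(4) Hfg Rfg, folded U_def]
  \<comment> \<open>All \<open>k\<close>-th powers from \<open>M\<close> lie in
    \<open>R (H \<inter> M)\<close>, hence in \<open>U\<close>. They form a subgroup normal in
    \<open>G\<close> and of finite index in \<open>N\<close>, as the collapse demands of
    \<open>D\<close>.\<close>
  define D where "D = powers G k M"
  have Dn: "D \<lhd> G" unfolding D_def by (rule powers_normal[OF M(1,3)])
  have Ds: "subgroup D G" "D \<subseteq> M" unfolding D_def using powers_subgroup[OF Ms M(3)] by auto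
  have DU: "D \<subseteq> U"
  proof
    fix x assume "x \<in> D"
    then obtain m where m: "m \<in> M" "x = m [^] k" by (auto simp: D_def powers_def)
    then obtain r w where "r \<in> R" "w \<in> H" "x = r \<otimes> w" using k(2) by blast
    then show "x \<in> U" by (auto simp: U_def)
  qed
  have "fidx G D M"
    by (rule abelian_power_fidx[OF Ms M(3,5) Ds k(1)]) (auto simp: D_def powers_def)
  then have DN: "fidx G D N" by (rule fidx_trans[OF Ds(1) Ms Nc _ M(6)])
  obtain S where S: "finite S" "S \<subseteq> carrier G" "generate G S = U" using U(1) unfolding fg_subgroup_def by blast
  have "\<exists>w. set w \<subseteq> A \<union> B \<and> word_prod G w = s" if "s \<in> S" for s
    using generate_word[OF A(1) B(1)] gen S(2) that by blast
  then obtain word where word: "\<And>s. s \<in> S \<Longrightarrow> set (word s) \<subseteq> A \<union> B \<and> word_prod G (word s) = s" by metis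
  obtain F where F: "finite F" "F \<subseteq> carrier G" "\<forall>v\<in>carrier G. \<exists>f\<in>F. v \<otimes> inv f \<in> L"
    using fidx_transversal[OF Ls subset_refl L(3)] by blast
  \<comment> \<open>The core holds the base point \<open>\<one>\<close>, a transversal of
    \<open>L\<close> so that every type occurs, and all suffixes of the words for the generators of
    \<open>U\<close>.\<close>
  define C where "C = insert \<one> F \<union> (\<Union>s\<in>S. (\<lambda>k. word_prod G (drop k (word s))) ` {..length (word s)})"
  have Cfin: "finite C" unfolding C_def using F S by auto
  have AB: "A \<union> B \<subseteq> carrier G" using subgroup.subset[OF A(1)] subgroup.subset[OF B(1)] by blast
  have wc: "word_prod G (drop k (word s)) \<in> carrier G" if "s \<in> S" for k s
  proof (rule word_prod_closed)
    show "set (drop k (word s)) \<subseteq> carrier G" using word[OF that] AB set_drop_subset[of k "word s"] by blast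
  qed
  have Cc: "C \<subseteq> carrier G" unfolding C_def using F wc by auto
  have Ctypes: "\<exists>c\<in>C. \<exists>l\<in>L. \<exists>h\<in>U. x = l \<otimes> c \<otimes> h" if x: "x \<in> carrier G" for x
  proof -
    obtain f where f: "f \<in> F" "x \<otimes> inv f \<in> L" using F x by blast
    have fc: "f \<in> carrier G" using f F by blast
    have "x = (x \<otimes> inv f) \<otimes> f \<otimes> \<one>" using x fc by (simp add: m_assoc)
    then show ?thesis using f subgroup.one_closed[OF U(2)] unfolding C_def by blast
  qed
  have drops: "word_prod G (drop k (word s)) \<in> C" if "s \<in> S" for k s
  proof (cases "k \<le> length (word s)")
    case True
    then show ?thesis using that unfolding C_def by blast
  next
    case False
    then show ?thesis by (simp add: C_def)
  qed
  have DN2: "D \<subseteq> N" using Ds(2) M(2) by blast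
  obtain BA where BA: "block_system G N U A L C BA"
    using block_system_exists[OF A(1) N(1,2) L(2) U(2) Dn DN2 DU DN MA L(1) Cfin Cc Ctypes] by blast
  obtain BB where BB: "block_system G N U B L C BB"
    using block_system_exists[OF B(1) N(1,3) L(2) U(2) Dn DN2 DU DN MB L(1) Cfin Cc Ctypes] by blast
  interpret tb: two_blocks G N U A B L C BA BB
    by (rule two_blocks.intro[OF BA BB two_blocks_axioms.intro[OF L(4)]])
  have "virtual_retract U G"
  proof (rule tb.virtual_retract_core[OF gen glue S(2,3)])
    show "\<one> \<in> C" by (simp add: C_def)
    fix s assume "s \<in> S"
    then show "\<exists>w. set w \<subseteq> A \<union> B \<and> word_prod G w = s \<and> (\<forall>k. word_prod G (drop k w) \<in> C)"
      using word drops by blast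
  qed
  then show "virtual_retract H G" using virtual_retract_trans[OF Hs _ U(3)] U(5) by blast
qed

end

section \<open>Universal property of the amalgamated product\<close>

locale amalgam = A: group A + B: group B + N: group N
  for A :: "('a, 'm) monoid_scheme" and B :: "('b, 'l) monoid_scheme" and N :: "('n, 'k) monoid_scheme" +
  fixes \<phi> :: "'n \<Rightarrow> 'a" and \<psi> :: "'n \<Rightarrow> 'b"
  assumes \<phi>: "\<phi> \<in> mon N A" "\<phi> ` carrier N \<lhd> A" and \<psi>: "\<psi> \<in> mon N B" "\<psi> ` carrier N \<lhd> B"
begin

abbreviation P where "P \<equiv> amalg_product N A B \<phi> \<psi>"
abbreviation cong where "cong \<equiv> amalg_cong N A B \<phi> \<psi>"
abbreviation words where "words \<equiv> amalg_words A B"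

definition cls :: "('a + 'b) list \<Rightarrow> ('a + 'b) list set" where "cls u = cong `` {u}"

lemma \<phi>_closed [simp]: "n \<in> carrier N \<Longrightarrow> \<phi> n \<in> carrier A"
  and \<psi>_closed [simp]: "n \<in> carrier N \<Longrightarrow> \<psi> n \<in> carrier B"
  using \<phi> \<psi> by (auto simp: mon_def hom_def)

lemma rel_words: "amalg_rel N A B \<phi> \<psi> r s \<Longrightarrow> r \<in> words \<and> s \<in> words"
  by (induction rule: amalg_rel.induct) auto

lemma cong_words: "(u, v) \<in> cong \<Longrightarrow> u \<in> words \<and> v \<in> words"
  by (induction rule: amalg_cong.induct) (use rel_words in auto)

lemma equiv_cong: "equiv words cong"
proof (rule equivI)
  show "cong \<subseteq> words \<times> words" using cong_words by auto
  show "refl_on words cong" by (auto intro!: refl_onI amalg_cong.refl)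
  show "sym cong" by (auto intro!: symI amalg_cong.sym)
  show "trans cong" by (auto intro!: transI intro: amalg_cong.trans)
qed

lemma cong_context: "(u, v) \<in> cong \<Longrightarrow> a \<in> words \<Longrightarrow> b \<in> words \<Longrightarrow> (a @ u @ b, a @ v @ b) \<in> cong"
proof (induction rule: amalg_cong.induct)
  case (rel r s u v)
  have "((a @ u) @ r @ (v @ b), (a @ u) @ s @ (v @ b)) \<in> cong"
    by (rule amalg_cong.rel) (use rel in auto)
  then show ?case by simp
next
  case (refl w)
  then show ?case by (intro amalg_cong.refl) auto
qed (blast intro: amalg_cong.sym amalg_cong.trans)+

lemma cong_append:
  assumes "(u, u') \<in> cong" "(v, v') \<in> cong" shows "(u @ v, u' @ v') \<in> cong"
proof -
  have w: "u \<in> words" "u' \<in> words" "v \<in> words" "v' \<in> words" using cong_words assms by auto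
  have "([] @ u @ v, [] @ u' @ v) \<in> cong" using cong_context[OF assms(1)] w by blast
  moreover have "(u' @ v @ [], u' @ v' @ []) \<in> cong" using cong_context[OF assms(2)] w by blast
  ultimately show ?thesis using amalg_cong.trans by force
qed

lemma cls_eq_iff: "u \<in> words \<Longrightarrow> v \<in> words \<Longrightarrow> cls u = cls v \<longleftrightarrow> (u, v) \<in> cong"
  unfolding cls_def using eq_equiv_class_iff[OF equiv_cong] by blast

lemma cls_eqI: "(u, v) \<in> cong \<Longrightarrow> cls u = cls v"
  unfolding cls_def using equiv_class_eq[OF equiv_cong] by blast

lemma carrier_P: "carrier P = cls ` words"
  by (auto simp: amalg_product_def quotient_def cls_def)

lemma one_P: "\<one>\<^bsub>P\<^esub> = cls []"
  by (simp add: amalg_product_def cls_def)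

lemma mult_P:
  assumes "u \<in> words" "v \<in> words" shows "cls u \<otimes>\<^bsub>P\<^esub> cls v = cls (u @ v)"
proof -
  have m: "cls u \<otimes>\<^bsub>P\<^esub> cls v = (\<Union>a\<in>cls u. \<Union>b\<in>cls v. cls (a @ b))"
    by (simp add: amalg_product_def cls_def)
  have c: "cls (a @ b) = cls (u @ v)" if "a \<in> cls u" "b \<in> cls v" for a b
    using cls_eqI[OF cong_append[of u a v b]] that by (simp add: cls_def)
  have "u \<in> cls u" "v \<in> cls v" using assms by (auto simp: cls_def intro: amalg_cong.refl)
  then show ?thesis unfolding m using c by blast
qed

definition winv :: "('a + 'b) list \<Rightarrow> ('a + 'b) list" where
  "winv w = rev (map (map_sum (m_inv A) (m_inv B)) w)"

lemma winv_words: "w \<in> words \<Longrightarrow> winv w \<in> words"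
  by (induction w) (auto simp: winv_def)

lemma cong_inv:
  assumes "w \<in> words" shows "(winv w @ w, []) \<in> cong"
  using assms
proof (induction w)
  case Nil
  then show ?case by (auto simp: winv_def intro: amalg_cong.refl)
next
  case (Cons a w)
  then have w: "w \<in> words" "a \<in> carrier A <+> carrier B" by auto
  have "([map_sum (m_inv A) (m_inv B) a, a], []) \<in> cong"
  proof (cases a)
    case (Inl x)
    then have x: "x \<in> carrier A" using w by auto
    have "([] @ [Inl (inv\<^bsub>A\<^esub> x), Inl x] @ [], [] @ [Inl (inv\<^bsub>A\<^esub> x \<otimes>\<^bsub>A\<^esub> x)] @ []) \<in> cong"
      by (intro amalg_cong.rel amalg_rel.multA) (use x in auto)
    moreover have "([] @ [Inl \<one>\<^bsub>A\<^esub>] @ [], [] @ [] @ []) \<in> cong"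
      by (intro amalg_cong.rel amalg_rel.oneA) auto
    ultimately show ?thesis using Inl x by (auto intro: amalg_cong.trans)
  next
    case (Inr x)
    then have x: "x \<in> carrier B" using w by auto
    have "([] @ [Inr (inv\<^bsub>B\<^esub> x), Inr x] @ [], [] @ [Inr (inv\<^bsub>B\<^esub> x \<otimes>\<^bsub>B\<^esub> x)] @ []) \<in> cong"
      by (intro amalg_cong.rel amalg_rel.multB) (use x in auto)
    moreover have "([] @ [Inr \<one>\<^bsub>B\<^esub>] @ [], [] @ [] @ []) \<in> cong"
      by (intro amalg_cong.rel amalg_rel.oneB) auto
    ultimately show ?thesis using Inr x by (auto intro: amalg_cong.trans)
  qed
  then have "(winv w @ [map_sum (m_inv A) (m_inv B) a, a] @ w, winv w @ [] @ w) \<in> cong"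
    using cong_context w winv_words by blast
  then show ?case using Cons.IH w by (auto simp: winv_def intro: amalg_cong.trans)
qed

lemma group_P: "group P"
proof (rule groupI)
  show "\<one>\<^bsub>P\<^esub> \<in> carrier P" unfolding one_P carrier_P by auto
  fix x assume "x \<in> carrier P"
  then obtain u where u: "u \<in> words" "x = cls u" by (auto simp: carrier_P)
  show "\<one>\<^bsub>P\<^esub> \<otimes>\<^bsub>P\<^esub> x = x" unfolding one_P u(2) using mult_P[of "[]" u] u by simp
  have "cls (winv u) \<otimes>\<^bsub>P\<^esub> x = \<one>\<^bsub>P\<^esub>"
    unfolding u(2) one_P mult_P[OF winv_words[OF u(1)] u(1)] by (rule cls_eqI[OF cong_inv[OF u(1)]])
  then show "\<exists>y\<in>carrier P. y \<otimes>\<^bsub>P\<^esub> x = \<one>\<^bsub>P\<^esub>" using winv_words[OF u(1)] by (auto simp: carrier_P)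
next
  fix x y assume "x \<in> carrier P" "y \<in> carrier P"
  then obtain u v where u: "u \<in> words" "x = cls u" "v \<in> words" "y = cls v" by (auto simp: carrier_P)
  have "u @ v \<in> words" using u by auto
  then show "x \<otimes>\<^bsub>P\<^esub> y \<in> carrier P" unfolding u(2,4) mult_P[OF u(1,3)] carrier_P by (rule imageI)
  fix z assume "z \<in> carrier P"
  then obtain w where w: "w \<in> words" "z = cls w" by (auto simp: carrier_P)
  have "u @ v \<in> words" "v @ w \<in> words" using u w by auto
  then show "x \<otimes>\<^bsub>P\<^esub> y \<otimes>\<^bsub>P\<^esub> z = x \<otimes>\<^bsub>P\<^esub> (y \<otimes>\<^bsub>P\<^esub> z)"
    unfolding u(2,4) w(2) by (simp add: mult_P u w)
qed

definition \<iota>A :: "'a \<Rightarrow> ('a + 'b) list set" where "\<iota>A a = cls [Inl a]"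
definition \<iota>B :: "'b \<Rightarrow> ('a + 'b) list set" where "\<iota>B b = cls [Inr b]"

lemma \<iota>A_hom: "\<iota>A \<in> hom A P"
proof (rule homI)
  fix x y assume xy: "x \<in> carrier A" "y \<in> carrier A"
  have "([] @ [Inl x, Inl y] @ [], [] @ [Inl (x \<otimes>\<^bsub>A\<^esub> y)] @ []) \<in> cong"
    by (intro amalg_cong.rel amalg_rel.multA) (use xy in auto)
  then show "\<iota>A (x \<otimes>\<^bsub>A\<^esub> y) = \<iota>A x \<otimes>\<^bsub>P\<^esub> \<iota>A y" unfolding \<iota>A_def using xy by (subst mult_P) (auto dest: cls_eqI)
qed (auto simp: \<iota>A_def carrier_P)

lemma \<iota>B_hom: "\<iota>B \<in> hom B P"
proof (rule homI)
  fix x y assume xy: "x \<in> carrier B" "y \<in> carrier B"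
  have "([] @ [Inr x, Inr y] @ [], [] @ [Inr (x \<otimes>\<^bsub>B\<^esub> y)] @ []) \<in> cong"
    by (intro amalg_cong.rel amalg_rel.multB) (use xy in auto)
  then show "\<iota>B (x \<otimes>\<^bsub>B\<^esub> y) = \<iota>B x \<otimes>\<^bsub>P\<^esub> \<iota>B y" unfolding \<iota>B_def using xy by (subst mult_P) (auto dest: cls_eqI)
qed (auto simp: \<iota>B_def carrier_P)

lemma \<iota>_glue: "n \<in> carrier N \<Longrightarrow> \<iota>A (\<phi> n) = \<iota>B (\<psi> n)"
proof -
  assume n: "n \<in> carrier N"
  have "([] @ [Inl (\<phi> n)] @ [], [] @ [Inr (\<psi> n)] @ []) \<in> cong"
    by (intro amalg_cong.rel amalg_rel.glue) (use n in auto)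
  then show ?thesis by (auto simp: \<iota>A_def \<iota>B_def dest: cls_eqI)
qed

sublocale P: group P by (rule group_P)
sublocale iA: group_hom A P \<iota>A by unfold_locales (rule \<iota>A_hom)
sublocale iB: group_hom B P \<iota>B by unfold_locales (rule \<iota>B_hom)

lemma P_generated: "generate P (\<iota>A ` carrier A \<union> \<iota>B ` carrier B) = carrier P"
proof
  have c: "\<iota>A ` carrier A \<union> \<iota>B ` carrier B \<subseteq> carrier P" by auto
  show "generate P (\<iota>A ` carrier A \<union> \<iota>B ` carrier B) \<subseteq> carrier P" by (rule P.generate_incl[OF c])
  have "cls w \<in> generate P (\<iota>A ` carrier A \<union> \<iota>B ` carrier B)" if "w \<in> words" for w
    using that
  proof (induction w)
    case Nil
    then show ?case using generate.one[of P] one_P by simp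
  next
    case (Cons a w)
    then have w: "w \<in> words" "a \<in> carrier A <+> carrier B" by auto
    have "cls (a # w) = cls [a] \<otimes>\<^bsub>P\<^esub> cls w" using mult_P[of "[a]" w] w by simp
    moreover have "cls [a] \<in> \<iota>A ` carrier A \<union> \<iota>B ` carrier B" using w(2) by (auto simp: \<iota>A_def \<iota>B_def)
    ultimately show ?case using Cons.IH w(1) by (metis generate.incl generate.eng)
  qed
  then show "carrier P \<subseteq> generate P (\<iota>A ` carrier A \<union> \<iota>B ` carrier B)" unfolding carrier_P by blast
qed

lemma universal_property:
  assumes E: "group E" and f: "f \<in> hom A E" and g: "g \<in> hom B E" and glue: "\<And>n. n \<in> carrier N \<Longrightarrow> f (\<phi> n) = g (\<psi> n)"
  shows "\<exists>h\<in>hom P E. (\<forall>a\<in>carrier A. h (\<iota>A a) = f a) \<and> (\<forall>b\<in>carrier B. h (\<iota>B b) = g b)"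
proof -
  interpret E: group E by fact
  interpret f: group_hom A E f by unfold_locales fact
  interpret g: group_hom B E g by unfold_locales fact
  define ev where "ev w = word_prod E (map (case_sum f g) w)" for w
  have letters: "set (map (case_sum f g) w) \<subseteq> carrier E" if "w \<in> words" for w
    using that by (auto simp: in_lists_conv_set split: sum.splits)
  have evc: "ev w \<in> carrier E" if "w \<in> words" for w unfolding ev_def by (rule E.word_prod_closed[OF letters[OF that]])
  have eva: "ev (u @ v) = ev u \<otimes>\<^bsub>E\<^esub> ev v" if "u \<in> words" "v \<in> words" for u v
    unfolding ev_def map_append by (rule E.word_prod_append[OF letters[OF that(1)] letters[OF that(2)]])
  have evr: "ev r = ev s" if "amalg_rel N A B \<phi> \<psi> r s" for r s
    using that by cases (auto simp: ev_def glue E.m_assoc)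
  have evcong: "ev u = ev v" if "(u, v) \<in> cong" for u v
    using that
  proof (induction rule: amalg_cong.induct)
    case (rel r s u v)
    then have "r \<in> words" "s \<in> words" using rel_words by auto
    then show ?case using rel evr[OF rel(1)] by (simp add: eva)
  qed auto
  define h where "h U = ev (SOME w. w \<in> words \<and> cls w = U)" for U
  have h: "h (cls w) = ev w" if "w \<in> words" for w
  proof -
    let ?v = "SOME v. v \<in> words \<and> cls v = cls w"
    have "?v \<in> words \<and> cls ?v = cls w" by (rule someI[of _ w]) (use that in simp)
    then show ?thesis unfolding h_def using evcong cls_eq_iff that by blast
  qed
  have "h \<in> hom P E"
  proof (rule homI)
    fix x assume "x \<in> carrier P"
    then obtain u where "u \<in> words" "x = cls u" by (auto simp: carrier_P)
    then show "h x \<in> carrier E" using h evc by simp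
  next
    fix x y assume "x \<in> carrier P" "y \<in> carrier P"
    then obtain u v where u: "u \<in> words" "x = cls u" "v \<in> words" "y = cls v" by (auto simp: carrier_P)
    moreover have "u @ v \<in> words" using u by auto
    ultimately show "h (x \<otimes>\<^bsub>P\<^esub> y) = h x \<otimes>\<^bsub>E\<^esub> h y" by (simp add: mult_P h eva)
  qed
  moreover have "h (\<iota>A a) = f a" if "a \<in> carrier A" for a
    unfolding \<iota>A_def using that by (subst h) (auto simp: ev_def)
  moreover have "h (\<iota>B b) = g b" if "b \<in> carrier B" for b
    unfolding \<iota>B_def using that by (subst h) (auto simp: ev_def)
  ultimately show ?thesis by blast
qed

text \<open>Transporting the action of \<open>B\<close> along \<open>f\<close> gives two actions on
  the same set \<open>S\<close> that agree on \<open>N\<close>, that is, two homomorphisms into its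
  symmetric group; the universal property combines them.\<close>

lemma glue_actions:
  assumes \<alpha>: "action A (carrier A) S \<alpha>" and \<beta>: "action B (carrier B) T \<beta>" and f: "bij_betw f S T"
    and eq: "\<And>n x. n \<in> carrier N \<Longrightarrow> x \<in> S \<Longrightarrow> f (\<alpha> (\<phi> n) x) = \<beta> (\<psi> n) (f x)"
  shows "\<exists>\<theta>. action P (carrier P) S \<theta> \<and> (\<forall>a\<in>carrier A. \<forall>x\<in>S. \<theta> (\<iota>A a) x = \<alpha> a x) \<and>
    (\<forall>b\<in>carrier B. \<forall>x\<in>S. f (\<theta> (\<iota>B b) x) = \<beta> b (f x))"
proof -
  have inj: "inj_on f S" and img: "f ` S = T" using f by (auto simp: bij_betw_def)
  define \<gamma> where "\<gamma> b x = inv_into S f (\<beta> b (f x))" for b x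
  have f\<gamma>: "\<gamma> b x \<in> S" "f (\<gamma> b x) = \<beta> b (f x)" if "b \<in> carrier B" "x \<in> S" for b x
  proof -
    have "\<beta> b (f x) \<in> f ` S" using \<beta> that unfolding action_def img[symmetric] by blast
    then show "\<gamma> b x \<in> S" "f (\<gamma> b x) = \<beta> b (f x)" unfolding \<gamma>_def by (auto intro: inv_into_into f_inv_into_f)
  qed
  have \<gamma>: "action B (carrier B) S \<gamma>"
    unfolding action_def
  proof (intro conjI ballI)
    fix x assume x: "x \<in> S"
    then have "f x \<in> T" using img by blast
    then have "f (\<gamma> \<one>\<^bsub>B\<^esub> x) = f x" using f\<gamma>(2)[OF _ x] \<beta> by (simp add: action_def)
    then show "\<gamma> \<one>\<^bsub>B\<^esub> x = x" using inj f\<gamma>(1)[OF _ x] x by (simp add: inj_on_eq_iff)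
    fix a b assume ab: "a \<in> carrier B" "b \<in> carrier B"
    have "f (\<gamma> (a \<otimes>\<^bsub>B\<^esub> b) x) = \<beta> a (\<beta> b (f x))" using f\<gamma>(2)[OF _ x] \<beta> ab \<open>f x \<in> T\<close> by (simp add: action_def)
    also have "\<dots> = f (\<gamma> a (\<gamma> b x))" using f\<gamma> ab x by simp
    finally show "\<gamma> (a \<otimes>\<^bsub>B\<^esub> b) x = \<gamma> a (\<gamma> b x)" using inj f\<gamma>(1) ab x by (simp add: inj_on_eq_iff)
  qed (use f\<gamma> in blast)
  have hom: "(\<lambda>g. restrict (\<delta> g) S) \<in> hom H (BijGroup S)" if H: "group H" and \<delta>: "action H (carrier H) S \<delta>"
    for H :: "('h, 'i) monoid_scheme" and \<delta>
  proof -
    interpret H: group H by fact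
    have bij: "restrict (\<delta> g) S \<in> Bij S" if g: "g \<in> carrier H" for g
    proof -
      have "bij_betw (\<delta> g) S S"
        by (rule bij_betw_byWitness[of _ "\<delta> (inv\<^bsub>H\<^esub> g)"])
          (use H.action_inv[OF \<delta> g] \<delta> g in \<open>auto simp: action_def\<close>)
      then show ?thesis by (simp add: Bij_def)
    qed
    show ?thesis
    proof (rule homI)
      fix g assume "g \<in> carrier H"
      then show "restrict (\<delta> g) S \<in> carrier (BijGroup S)" using bij by (simp add: BijGroup_def)
    next
      fix g h assume gh: "g \<in> carrier H" "h \<in> carrier H"
      show "restrict (\<delta> (g \<otimes>\<^bsub>H\<^esub> h)) S = restrict (\<delta> g) S \<otimes>\<^bsub>BijGroup S\<^esub> restrict (\<delta> h) S"
        using bij[OF gh(1)] bij[OF gh(2)] \<delta> gh by (auto simp: BijGroup_def compose_def action_def)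
    qed
  qed
  have "restrict (\<alpha> (\<phi> n)) S = restrict (\<gamma> (\<psi> n)) S" if n: "n \<in> carrier N" for n
  proof (rule restrict_ext)
    fix x assume x: "x \<in> S"
    have "f (\<alpha> (\<phi> n) x) = f (\<gamma> (\<psi> n) x)" using eq[OF n x] f\<gamma>(2)[of "\<psi> n" x] n x by simp
    moreover have "\<alpha> (\<phi> n) x \<in> S" using \<alpha> n x by (simp add: action_def)
    ultimately show "\<alpha> (\<phi> n) x = \<gamma> (\<psi> n) x" using inj f\<gamma>(1)[of "\<psi> n" x] n x by (simp add: inj_on_eq_iff)
  qed
  then obtain h where h: "h \<in> hom P (BijGroup S)" "\<forall>a\<in>carrier A. h (\<iota>A a) = restrict (\<alpha> a) S"
    "\<forall>b\<in>carrier B. h (\<iota>B b) = restrict (\<gamma> b) S"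
    using universal_property[OF group_BijGroup hom[OF A.group_axioms \<alpha>] hom[OF B.group_axioms \<gamma>]] by blast
  interpret h: group_hom P "BijGroup S" h
    by (rule group_hom.intro[OF group_P group_BijGroup group_hom_axioms.intro[OF h(1)]])
  have hB: "h g \<in> Bij S" if "g \<in> carrier P" for g using h.hom_closed[OF that] by (simp add: BijGroup_def)
  have "action P (carrier P) S h"
    unfolding action_def
  proof (intro conjI ballI)
    fix g x assume "g \<in> carrier P" "x \<in> S"
    then show "h g x \<in> S" using Bij_imp_funcset[OF hB] by blast
  next
    fix x assume "x \<in> S"
    then show "h \<one>\<^bsub>P\<^esub> x = x" using h.hom_one by (simp add: BijGroup_def)
  next
    fix g k x assume "g \<in> carrier P" "k \<in> carrier P" "x \<in> S"
    then show "h (g \<otimes>\<^bsub>P\<^esub> k) x = h g (h k x)" using h.hom_mult[of g k] hB by (simp add: BijGroup_def compose_def)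
  qed
  moreover have "\<forall>a\<in>carrier A. \<forall>x\<in>S. h (\<iota>A a) x = \<alpha> a x" using h(2) by simp
  moreover have "\<forall>b\<in>carrier B. \<forall>x\<in>S. f (h (\<iota>B b) x) = \<beta> b (f x)" using h(3) f\<gamma> by simp
  ultimately show ?thesis by blast
qed

definition \<nu> :: "'n \<Rightarrow> ('a + 'b) list set" where "\<nu> n = \<iota>A (\<phi> n)"

lemma glues_P: "glues P (\<iota>A ` carrier A) (\<iota>B ` carrier B) (\<nu> ` carrier N) TYPE('x) TYPE('y)"
  unfolding glues_def
proof (intro allI impI, elim conjE)
  fix S :: "'x set" and T :: "'y set" and \<alpha> \<beta> f
  assume \<alpha>: "action P (\<iota>A ` carrier A) S \<alpha>" and \<beta>: "action P (\<iota>B ` carrier B) T \<beta>" and f: "bij_betw f S T"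
    and eq: "\<forall>n\<in>\<nu> ` carrier N. \<forall>x\<in>S. f (\<alpha> n x) = \<beta> n (f x)"
  have 1: "action A (carrier A) S (\<lambda>a. \<alpha> (\<iota>A a))" using \<alpha> by (auto simp: action_def)
  have 2: "action B (carrier B) T (\<lambda>a. \<beta> (\<iota>B a))" using \<beta> by (auto simp: action_def)
  have "\<exists>\<theta>. action P (carrier P) S \<theta> \<and> (\<forall>a\<in>carrier A. \<forall>x\<in>S. \<theta> (\<iota>A a) x = \<alpha> (\<iota>A a) x) \<and>
    (\<forall>b\<in>carrier B. \<forall>x\<in>S. f (\<theta> (\<iota>B b) x) = \<beta> (\<iota>B b) (f x))"
    by (rule glue_actions[OF 1 2 f]) (use eq \<iota>_glue in \<open>auto simp: \<nu>_def\<close>)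
  then show "\<exists>\<theta>. action P (carrier P) S \<theta> \<and> (\<forall>a\<in>\<iota>A ` carrier A. \<forall>x\<in>S. \<theta> a x = \<alpha> a x) \<and>
    (\<forall>b\<in>\<iota>B ` carrier B. \<forall>x\<in>S. f (\<theta> b x) = \<beta> b (f x))"
    by auto
qed

end

text \<open>As a set with left multiplication by \<open>N\<close>, the group \<open>G\<close> is
  \<open>N\<close> times the set of right cosets: \<open>c\<close> is the equivariant coordinate in
  \<open>N\<close>, and \<open>r\<close> the invariant coset representative.\<close>

lemma transversal_decomposition:
  fixes G :: "('g, 'm) monoid_scheme" and N :: "('n, 'k) monoid_scheme"
  assumes "group G" "group N" and \<chi>: "\<chi> \<in> mon N G"
  shows "\<exists>c r. (\<forall>x\<in>carrier G. c x \<in> carrier N \<and> r x \<in> carrier G \<and> x = \<chi> (c x) \<otimes>\<^bsub>G\<^esub> r x) \<and>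
    (\<forall>n\<in>carrier N. \<forall>x\<in>carrier G. c (\<chi> n \<otimes>\<^bsub>G\<^esub> x) = n \<otimes>\<^bsub>N\<^esub> c x \<and> r (\<chi> n \<otimes>\<^bsub>G\<^esub> x) = r x) \<and>
    (\<forall>x\<in>carrier G. c (r x) = \<one>\<^bsub>N\<^esub> \<and> r (r x) = r x)"
proof -
  interpret G: group G by fact
  interpret N: group N by fact
  interpret \<chi>: group_hom N G \<chi> by unfold_locales (use \<chi> in \<open>auto simp: mon_def\<close>)
  have inj: "inj_on \<chi> (carrier N)" using \<chi> by (simp add: mon_def)
  define I where "I = \<chi> ` carrier N"
  have I: "subgroup I G" unfolding I_def by (rule \<chi>.img_is_subgroup)
  define r where "r x = (SOME y. y \<in> I #>\<^bsub>G\<^esub> x)" for x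
  define c where "c x = inv_into (carrier N) \<chi> (x \<otimes>\<^bsub>G\<^esub> inv\<^bsub>G\<^esub> r x)" for x
  have r: "r x \<in> I #>\<^bsub>G\<^esub> x" if "x \<in> carrier G" for x
    unfolding r_def by (rule someI[of _ x]) (rule G.rcos_self[OF that I])
  have rc: "r x \<in> carrier G" if "x \<in> carrier G" for x
    using r[OF that] G.r_coset_subset_G[OF subgroup.subset[OF I] that] by blast
  have cr: "c x \<in> carrier N" "\<chi> (c x) = x \<otimes>\<^bsub>G\<^esub> inv\<^bsub>G\<^esub> r x" if x: "x \<in> carrier G" for x
  proof -
    have "I #>\<^bsub>G\<^esub> r x = I #>\<^bsub>G\<^esub> x" using G.repr_independence[OF r[OF x] x I] by simp
    then have "x \<otimes>\<^bsub>G\<^esub> inv\<^bsub>G\<^esub> r x \<in> \<chi> ` carrier N"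
      using G.rcoset_eq_iff[OF I x rc[OF x]] by (simp add: I_def)
    then show "c x \<in> carrier N" "\<chi> (c x) = x \<otimes>\<^bsub>G\<^esub> inv\<^bsub>G\<^esub> r x"
      unfolding c_def by (auto intro: inv_into_into f_inv_into_f)
  qed
  have dec: "x = \<chi> (c x) \<otimes>\<^bsub>G\<^esub> r x" if x: "x \<in> carrier G" for x
    using cr[OF x] rc[OF x] x by (simp add: G.m_assoc)
  have trans: "c (\<chi> n \<otimes>\<^bsub>G\<^esub> x) = n \<otimes>\<^bsub>N\<^esub> c x \<and> r (\<chi> n \<otimes>\<^bsub>G\<^esub> x) = r x" if n: "n \<in> carrier N" and x: "x \<in> carrier G" for n x
  proof
    have nx: "\<chi> n \<otimes>\<^bsub>G\<^esub> x \<in> carrier G" using n x by simp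
    have "I #>\<^bsub>G\<^esub> (\<chi> n \<otimes>\<^bsub>G\<^esub> x) = I #>\<^bsub>G\<^esub> x"
      using G.rcoset_eq_iff[OF I nx x] n x by (simp add: I_def G.m_assoc)
    then show req: "r (\<chi> n \<otimes>\<^bsub>G\<^esub> x) = r x" by (simp add: r_def)
    have "\<chi> (c (\<chi> n \<otimes>\<^bsub>G\<^esub> x)) = \<chi> (n \<otimes>\<^bsub>N\<^esub> c x)"
      using cr[OF nx] cr[OF x] req n x rc[OF x] by (simp add: G.m_assoc)
    then show "c (\<chi> n \<otimes>\<^bsub>G\<^esub> x) = n \<otimes>\<^bsub>N\<^esub> c x" by (rule inj_onD[OF inj _ cr(1)[OF nx]]) (use n cr(1)[OF x] in simp)
  qed
  have "c (r x) = \<one>\<^bsub>N\<^esub> \<and> r (r x) = r x" if x: "x \<in> carrier G" for x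
  proof -
    have "r x = \<chi> (inv\<^bsub>N\<^esub> c x) \<otimes>\<^bsub>G\<^esub> x" using cr[OF x] rc[OF x] x by (simp add: G.inv_mult_group G.m_assoc)
    then show ?thesis using trans[of "inv\<^bsub>N\<^esub> c x" x] cr(1)[OF x] x by simp
  qed
  then show ?thesis
    by (intro exI[of _ c] exI[of _ r] conjI ballI cr(1) rc dec conjunct1[OF trans] conjunct2[OF trans]) auto
qed

context amalgam
begin

text \<open>As \<open>N\<close>-sets, \<open>A \<times> (N\<bar>B)\<close> and \<open>B \<times> (N\<bar>A)\<close> are both \<open>N \<times> (N\<bar>A) \<times> (N\<bar>B)\<close>, so that the
  free actions of \<open>A\<close> and \<open>B\<close> on them glue to an action of the amalgam in which \<open>N\<close> acts freely.\<close>

lemma \<nu>_inj: "inj_on \<nu> (carrier N)"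
proof -
  obtain cA rA where A1: "\<forall>x\<in>carrier A. cA x \<in> carrier N \<and> rA x \<in> carrier A \<and> x = \<phi> (cA x) \<otimes>\<^bsub>A\<^esub> rA x"
    "\<forall>n\<in>carrier N. \<forall>x\<in>carrier A. cA (\<phi> n \<otimes>\<^bsub>A\<^esub> x) = n \<otimes>\<^bsub>N\<^esub> cA x \<and> rA (\<phi> n \<otimes>\<^bsub>A\<^esub> x) = rA x"
    "\<forall>x\<in>carrier A. cA (rA x) = \<one>\<^bsub>N\<^esub> \<and> rA (rA x) = rA x"
    using transversal_decomposition[OF A.group_axioms N.group_axioms \<phi>(1)] by (elim exE conjE) (rule that)
  obtain cB rB where B1: "\<forall>x\<in>carrier B. cB x \<in> carrier N \<and> rB x \<in> carrier B \<and> x = \<psi> (cB x) \<otimes>\<^bsub>B\<^esub> rB x"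
    "\<forall>n\<in>carrier N. \<forall>x\<in>carrier B. cB (\<psi> n \<otimes>\<^bsub>B\<^esub> x) = n \<otimes>\<^bsub>N\<^esub> cB x \<and> rB (\<psi> n \<otimes>\<^bsub>B\<^esub> x) = rB x"
    "\<forall>x\<in>carrier B. cB (rB x) = \<one>\<^bsub>N\<^esub> \<and> rB (rB x) = rB x"
    using transversal_decomposition[OF B.group_axioms N.group_axioms \<psi>(1)] by (elim exE conjE) (rule that)
  interpret \<phi>: group_hom N A \<phi> by unfold_locales (use \<phi> in \<open>auto simp: mon_def\<close>)
  interpret \<psi>: group_hom N B \<psi> by unfold_locales (use \<psi> in \<open>auto simp: mon_def\<close>)
  define S where "S = carrier A \<times> rB ` carrier B"
  define T where "T = carrier B \<times> rA ` carrier A"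
  \<comment> \<open>\<open>f\<close> moves the coordinate in \<open>N\<close> from the
    \<open>A\<close>-part to the \<open>B\<close>-part; the coset representatives are carried along
    unchanged.\<close>
  define f where "f = (\<lambda>(a, t). (\<psi> (cA a) \<otimes>\<^bsub>B\<^esub> t, rA a))"
  define g where "g = (\<lambda>(b, s). (\<phi> (cB b) \<otimes>\<^bsub>A\<^esub> s, rB b))"
  have f: "bij_betw f S T"
  proof (rule bij_betw_byWitness[where f' = g])
    show "\<forall>x\<in>S. g (f x) = x" using A1 B1 by (auto simp: S_def f_def g_def)
    show "\<forall>y\<in>T. f (g y) = y" using A1 B1 by (auto simp: T_def f_def g_def)
    show "f ` S \<subseteq> T" using A1 B1 by (auto simp: S_def T_def f_def)
    show "g ` T \<subseteq> S" using A1 B1 by (auto simp: S_def T_def g_def)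
  qed
  define \<alpha> where "\<alpha> a p = (a \<otimes>\<^bsub>A\<^esub> fst p, snd p)" for a and p :: "'a \<times> 'b"
  define \<beta> where "\<beta> b p = (b \<otimes>\<^bsub>B\<^esub> fst p, snd p)" for b and p :: "'b \<times> 'a"
  have \<alpha>: "action A (carrier A) S \<alpha>" by (auto simp: action_def S_def \<alpha>_def A.m_assoc)
  have \<beta>: "action B (carrier B) T \<beta>" by (auto simp: action_def T_def \<beta>_def B.m_assoc)
  have eq: "f (\<alpha> (\<phi> n) x) = \<beta> (\<psi> n) (f x)" if "n \<in> carrier N" "x \<in> S" for n x
    using that A1 B1 by (auto simp: S_def f_def \<alpha>_def \<beta>_def B.m_assoc)
  obtain \<theta> where \<theta>: "\<forall>a\<in>carrier A. \<forall>x\<in>S. \<theta> (\<iota>A a) x = \<alpha> a x"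
    using glue_actions[OF \<alpha> \<beta> f eq] by blast
  show ?thesis
  proof (rule inj_onI)
    fix n m assume nm: "n \<in> carrier N" "m \<in> carrier N" "\<nu> n = \<nu> m"
    \<comment> \<open>\<open>A\<close> acts by left multiplication in the first coordinate, so
      evaluating at this single point recovers \<open>\<phi> n\<close> from its class in the
      amalgam.\<close>
    have x: "(\<one>\<^bsub>A\<^esub>, rB \<one>\<^bsub>B\<^esub>) \<in> S" by (simp add: S_def)
    have "\<alpha> (\<phi> n) (\<one>\<^bsub>A\<^esub>, rB \<one>\<^bsub>B\<^esub>) = \<alpha> (\<phi> m) (\<one>\<^bsub>A\<^esub>, rB \<one>\<^bsub>B\<^esub>)"
      using \<theta> x nm by (metis \<nu>_def \<phi>_closed)
    then have "\<phi> n = \<phi> m" using nm by (simp add: \<alpha>_def)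
    then show "n = m" using nm \<phi>(1) by (auto simp: mon_def inj_on_eq_iff)
  qed
qed

end

section \<open>Action on the amalgamated subgroup\<close>

locale normal_embedding = A: group A + N: group N
  for A :: "('a, 'm) monoid_scheme" and N :: "('n, 'k) monoid_scheme" +
  fixes \<phi> :: "'n \<Rightarrow> 'a"
  assumes \<phi>: "\<phi> \<in> mon N A" "\<phi> ` carrier N \<lhd> A"
begin

sublocale \<phi>: group_hom N A \<phi> by unfold_locales (use \<phi> in \<open>auto simp: mon_def\<close>)

lemma inj: "inj_on \<phi> (carrier N)"
  using \<phi> by (simp add: mon_def)

lemma conj_aut_closed: "a \<in> carrier A \<Longrightarrow> n \<in> carrier N \<Longrightarrow> conj_aut N A \<phi> a n \<in> carrier N"
  and conj_aut_eq: "a \<in> carrier A \<Longrightarrow> n \<in> carrier N \<Longrightarrow> \<phi> (conj_aut N A \<phi> a n) = a \<otimes>\<^bsub>A\<^esub> \<phi> n \<otimes>\<^bsub>A\<^esub> inv\<^bsub>A\<^esub> a"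
proof -
  assume an: "a \<in> carrier A" "n \<in> carrier N"
  have "a \<otimes>\<^bsub>A\<^esub> \<phi> n \<otimes>\<^bsub>A\<^esub> inv\<^bsub>A\<^esub> a \<in> \<phi> ` carrier N"
    using normal.inv_op_closed2[OF \<phi>(2) an(1)] an by blast
  then show "conj_aut N A \<phi> a n \<in> carrier N" "\<phi> (conj_aut N A \<phi> a n) = a \<otimes>\<^bsub>A\<^esub> \<phi> n \<otimes>\<^bsub>A\<^esub> inv\<^bsub>A\<^esub> a"
    using an by (auto simp: conj_aut_def intro: inv_into_into f_inv_into_f)
qed

lemma conj_aut_eqI:
  assumes "a \<in> carrier A" "n \<in> carrier N" "m \<in> carrier N" "\<phi> m = a \<otimes>\<^bsub>A\<^esub> \<phi> n \<otimes>\<^bsub>A\<^esub> inv\<^bsub>A\<^esub> a"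
  shows "conj_aut N A \<phi> a n = m"
  by (rule inj_onD[OF inj]) (use assms conj_aut_closed conj_aut_eq in auto)

lemma conj_aut_mult:
  assumes "a \<in> carrier A" "b \<in> carrier A" "n \<in> carrier N"
  shows "conj_aut N A \<phi> (a \<otimes>\<^bsub>A\<^esub> b) n = conj_aut N A \<phi> a (conj_aut N A \<phi> b n)"
  by (rule conj_aut_eqI) (use assms conj_aut_closed conj_aut_eq in \<open>auto simp: A.group_normalize\<close>)

lemma conj_aut_one: "n \<in> carrier N \<Longrightarrow> conj_aut N A \<phi> \<one>\<^bsub>A\<^esub> n = n"
  by (rule conj_aut_eqI) auto

lemma conj_aut_image:
  assumes "m \<in> carrier N" shows "conj_aut N A \<phi> (\<phi> m) = (\<lambda>n\<in>carrier N. m \<otimes>\<^bsub>N\<^esub> n \<otimes>\<^bsub>N\<^esub> inv\<^bsub>N\<^esub> m)"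
proof
  fix n show "conj_aut N A \<phi> (\<phi> m) n = (\<lambda>n\<in>carrier N. m \<otimes>\<^bsub>N\<^esub> n \<otimes>\<^bsub>N\<^esub> inv\<^bsub>N\<^esub> m) n"
  proof (cases "n \<in> carrier N")
    case True
    then show ?thesis using assms by (simp add: conj_aut_eqI)
  next
    case False
    then show ?thesis by (simp add: conj_aut_def)
  qed
qed

lemma conj_aut_auto: assumes a: "a \<in> carrier A" shows "conj_aut N A \<phi> a \<in> auto N"
proof -
  have "conj_aut N A \<phi> a \<in> hom N N"
  proof (rule homI)
    fix x y assume xy: "x \<in> carrier N" "y \<in> carrier N"
    show "conj_aut N A \<phi> a (x \<otimes>\<^bsub>N\<^esub> y) = conj_aut N A \<phi> a x \<otimes>\<^bsub>N\<^esub> conj_aut N A \<phi> a y"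
      by (rule conj_aut_eqI) (use a xy conj_aut_closed conj_aut_eq in \<open>auto simp: A.group_normalize\<close>)
  qed (rule conj_aut_closed[OF a])
  moreover have "bij_betw (conj_aut N A \<phi> a) (carrier N) (carrier N)"
  proof (rule bij_betw_byWitness[where f' = "conj_aut N A \<phi> (inv\<^bsub>A\<^esub> a)"])
    show "\<forall>n\<in>carrier N. conj_aut N A \<phi> (inv\<^bsub>A\<^esub> a) (conj_aut N A \<phi> a n) = n"
      "\<forall>n\<in>carrier N. conj_aut N A \<phi> a (conj_aut N A \<phi> (inv\<^bsub>A\<^esub> a) n) = n"
      using a conj_aut_mult[of "inv\<^bsub>A\<^esub> a" a] conj_aut_mult[of a "inv\<^bsub>A\<^esub> a"] conj_aut_one by auto
  qed (use a conj_aut_closed in auto)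
  moreover have "conj_aut N A \<phi> a \<in> extensional (carrier N)" by (simp add: conj_aut_def)
  ultimately show ?thesis by (simp add: auto_def Bij_def)
qed

lemma conj_aut_hom: "conj_aut N A \<phi> \<in> hom A (AutoGroup N)"
proof (rule homI)
  fix a assume "a \<in> carrier A"
  then show "conj_aut N A \<phi> a \<in> carrier (AutoGroup N)" using conj_aut_auto by (simp add: AutoGroup_def)
next
  fix a b assume ab: "a \<in> carrier A" "b \<in> carrier A"
  have Bij: "conj_aut N A \<phi> a \<in> Bij (carrier N)" "conj_aut N A \<phi> b \<in> Bij (carrier N)"
    using conj_aut_auto ab by (auto simp: auto_def)
  have "conj_aut N A \<phi> (a \<otimes>\<^bsub>A\<^esub> b) n = compose (carrier N) (conj_aut N A \<phi> a) (conj_aut N A \<phi> b) n" for n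
    using conj_aut_mult[OF ab] by (cases "n \<in> carrier N") (auto simp: compose_def conj_aut_def[of _ _ _ "a \<otimes>\<^bsub>A\<^esub> b"])
  then show "conj_aut N A \<phi> (a \<otimes>\<^bsub>A\<^esub> b) = conj_aut N A \<phi> a \<otimes>\<^bsub>AutoGroup N\<^esub> conj_aut N A \<phi> b"
    using Bij by (auto simp: AutoGroup_def BijGroup_def)
qed

end

section \<open>Inner and outer automorphisms\<close>

context group
begin

lemma AutoGroup_mult:
  "f \<in> auto G \<Longrightarrow> g \<in> auto G \<Longrightarrow> x \<in> carrier G \<Longrightarrow> (f \<otimes>\<^bsub>AutoGroup G\<^esub> g) x = f (g x)"
  by (simp add: AutoGroup_def BijGroup_def auto_def compose_def)

lemma auto_eqI: "f \<in> auto G \<Longrightarrow> g \<in> auto G \<Longrightarrow> (\<And>x. x \<in> carrier G \<Longrightarrow> f x = g x) \<Longrightarrow> f = g"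
  by (rule extensionalityI[of _ "carrier G"]) (auto simp: auto_def Bij_def)

lemma carrier_AutoGroup: "carrier (AutoGroup G) = auto G"
  by (simp add: AutoGroup_def)

definition inner :: "'a \<Rightarrow> 'a \<Rightarrow> 'a" where
  "inner g = (\<lambda>n\<in>carrier G. g \<otimes> n \<otimes> inv g)"

text \<open>Conjugation in \<open>G\<close> is the conjugation action for the normal embedding of
  \<open>G\<close> in itself, so \<open>conj_aut_hom\<close> applies.\<close>

lemma inner_hom: "inner \<in> hom G (AutoGroup G)"
proof -
  have e: "normal_embedding G G (\<lambda>x. x)"
  proof (rule normal_embedding.intro[OF group_axioms group_axioms normal_embedding_axioms.intro])
    show "(\<lambda>x. x) \<in> mon G G" by (auto simp: mon_def hom_def)
    show "(\<lambda>x. x) ` carrier G \<lhd> G" using normal_self by simp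
  qed
  have "conj_aut G G (\<lambda>x. x) g = inner g" if "g \<in> carrier G" for g
    unfolding inner_def by (rule normal_embedding.conj_aut_image[OF e that])
  then show ?thesis using normal_embedding.conj_aut_hom[OF e] by (simp add: hom_def Pi_def)
qed

lemma Inn_eq: "Inn G = inner ` carrier G"
  by (simp add: Inn_def inner_def)

text \<open>Conjugating the inner automorphism of \<open>g\<close> by \<sigma> yields that of
  \<open>\<sigma> g\<close>.\<close>

lemma Inn_normal: "Inn G \<lhd> AutoGroup G"
proof -
  interpret Aut: group "AutoGroup G" by (rule AutoGroup)
  interpret h: group_hom G "AutoGroup G" inner by unfold_locales (rule inner_hom)
  have sub: "subgroup (Inn G) (AutoGroup G)" unfolding Inn_eq by (rule h.img_is_subgroup)
  show ?thesis
  proof (rule Aut.normal_invI[OF sub])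
    fix \<sigma> \<tau> assume \<sigma>: "\<sigma> \<in> carrier (AutoGroup G)" and \<tau>: "\<tau> \<in> Inn G"
    obtain g where g: "g \<in> carrier G" "\<tau> = inner g" using \<tau> unfolding Inn_eq by blast
    have \<sigma>a: "\<sigma> \<in> auto G" using \<sigma> by (simp add: carrier_AutoGroup)
    then have \<sigma>h: "\<sigma> \<in> hom G G" by (simp add: auto_def)
    then interpret \<sigma>: group_hom G G \<sigma> by unfold_locales
    have sg: "\<sigma> g \<in> carrier G" using g by simp
    have ia: "inner g \<in> auto G" "inner (\<sigma> g) \<in> auto G" using hom_in_carrier[OF inner_hom] g(1) sg by (auto simp: carrier_AutoGroup)
    have "\<sigma> \<otimes>\<^bsub>AutoGroup G\<^esub> inner g = inner (\<sigma> g) \<otimes>\<^bsub>AutoGroup G\<^esub> \<sigma>"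
    proof (rule auto_eqI)
      show "\<sigma> \<otimes>\<^bsub>AutoGroup G\<^esub> inner g \<in> auto G" "inner (\<sigma> g) \<otimes>\<^bsub>AutoGroup G\<^esub> \<sigma> \<in> auto G"
        using Aut.m_closed \<sigma>a ia by (auto simp: carrier_AutoGroup)
      fix x assume x: "x \<in> carrier G"
      show "(\<sigma> \<otimes>\<^bsub>AutoGroup G\<^esub> inner g) x = (inner (\<sigma> g) \<otimes>\<^bsub>AutoGroup G\<^esub> \<sigma>) x"
      proof -
        have "\<sigma> (inner g x) = \<sigma> g \<otimes> \<sigma> x \<otimes> inv (\<sigma> g)" using g(1) x by (simp add: inner_def)
        also have "\<dots> = inner (\<sigma> g) (\<sigma> x)" using x by (simp add: inner_def)
        finally show ?thesis using AutoGroup_mult[OF \<sigma>a ia(1) x] AutoGroup_mult[OF ia(2) \<sigma>a x] by (simp only:)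
      qed
    qed
    then have "\<sigma> \<otimes>\<^bsub>AutoGroup G\<^esub> inner g \<otimes>\<^bsub>AutoGroup G\<^esub> inv\<^bsub>AutoGroup G\<^esub> \<sigma> = inner (\<sigma> g)"
      using Aut.inv_solve_right[of "\<sigma> \<otimes>\<^bsub>AutoGroup G\<^esub> inner g" "inner (\<sigma> g)" \<sigma>] Aut.m_assoc \<sigma> ia
      by (simp add: carrier_AutoGroup[symmetric])
    moreover have "inner (\<sigma> g) \<in> Inn G" using sg unfolding Inn_eq by blast
    ultimately show "\<sigma> \<otimes>\<^bsub>AutoGroup G\<^esub> \<tau> \<otimes>\<^bsub>AutoGroup G\<^esub> inv\<^bsub>AutoGroup G\<^esub> \<sigma> \<in> Inn G"
      unfolding g(2) by simp
  qed
qed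

lemma group_Out: "group (Out G)"
  unfolding Out_def by (rule normal.factorgroup_is_group[OF Inn_normal])

lemma to_Out_hom: "(\<lambda>\<sigma>. Inn G #>\<^bsub>AutoGroup G\<^esub> \<sigma>) \<in> hom (AutoGroup G) (Out G)"
  unfolding Out_def by (rule normal.r_coset_hom_Mod[OF Inn_normal])

lemma one_Out: "\<one>\<^bsub>Out G\<^esub> = Inn G"
  by (simp add: Out_def)

lemma to_Out_trivial_iff:
  assumes "\<sigma> \<in> carrier (AutoGroup G)"
  shows "Inn G #>\<^bsub>AutoGroup G\<^esub> \<sigma> = \<one>\<^bsub>Out G\<^esub> \<longleftrightarrow> \<sigma> \<in> Inn G"
  unfolding one_Out using group.coset_join1[OF AutoGroup] group.coset_join2[OF AutoGroup] assms
    normal_imp_subgroup[OF Inn_normal] subgroup.subset by metis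

end

context normal_embedding
begin

lemma natural_hom: "natural_hom_Out N A \<phi> \<in> hom A (Out N)"
proof -
  have "(\<lambda>\<sigma>. Inn N #>\<^bsub>AutoGroup N\<^esub> \<sigma>) \<circ> conj_aut N A \<phi> \<in> hom A (Out N)"
    by (rule hom_compose[OF conj_aut_hom N.to_Out_hom])
  moreover have "(\<lambda>\<sigma>. Inn N #>\<^bsub>AutoGroup N\<^esub> \<sigma>) \<circ> conj_aut N A \<phi> = natural_hom_Out N A \<phi>"
    by (auto simp: natural_hom_Out_def)
  ultimately show ?thesis by simp
qed

lemma natural_image_subgroup: "subgroup (natural_image_Out N A \<phi>) (Out N)"
proof -
  interpret h: group_hom A "Out N" "natural_hom_Out N A \<phi>"
    by (rule group_hom.intro[OF A.group_axioms N.group_Out group_hom_axioms.intro[OF natural_hom]])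
  show ?thesis unfolding natural_image_Out_def by (rule h.img_is_subgroup)
qed

lemma natural_image_comm:
  assumes "comm_group A" shows "natural_image_Out N A \<phi> = {\<one>\<^bsub>Out N\<^esub>}"
proof -
  interpret A: comm_group A by fact
  have "conj_aut N A \<phi> a = (\<lambda>n\<in>carrier N. \<one>\<^bsub>N\<^esub> \<otimes>\<^bsub>N\<^esub> n \<otimes>\<^bsub>N\<^esub> inv\<^bsub>N\<^esub> \<one>\<^bsub>N\<^esub>)" if a: "a \<in> carrier A" for a
  proof
    fix n show "conj_aut N A \<phi> a n = (\<lambda>n\<in>carrier N. \<one>\<^bsub>N\<^esub> \<otimes>\<^bsub>N\<^esub> n \<otimes>\<^bsub>N\<^esub> inv\<^bsub>N\<^esub> \<one>\<^bsub>N\<^esub>) n"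
    proof (cases "n \<in> carrier N")
      case True
      have "a \<otimes>\<^bsub>A\<^esub> \<phi> n \<otimes>\<^bsub>A\<^esub> inv\<^bsub>A\<^esub> a = \<phi> n"
        using True a A.m_comm[of a "\<phi> n"] by (simp add: A.m_assoc)
      then show ?thesis using True a by (simp add: conj_aut_eqI)
    next
      case False
      then show ?thesis by (simp add: conj_aut_def)
    qed
  qed
  then have "conj_aut N A \<phi> a \<in> Inn N" if "a \<in> carrier A" for a using that unfolding Inn_def by blast
  then have "natural_hom_Out N A \<phi> a = \<one>\<^bsub>Out N\<^esub>" if "a \<in> carrier A" for a
    unfolding natural_hom_Out_def using that N.to_Out_trivial_iff conj_aut_auto by (simp add: N.carrier_AutoGroup)
  then show ?thesis unfolding natural_image_Out_def using A.one_closed by force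
qed

text \<open>A lattice \<open>M\<close> of \<open>A\<close> centralizes \<open>N\<close>: for
  \<open>k\<close> in \<open>M\<close> the commutator \<open>t\<close> of \<open>k\<close> and
  \<open>n\<close> lies in both \<open>M\<close> and \<open>N\<close>. A power \<open>n^j\<close>
  lies in \<open>M\<close> and so commutes with \<open>k\<close>; \<open>N\<close> being abelian,
  \<open>t^j = \<one>\<close>, and \<open>M\<close> is torsion free. Hence \<open>A\<close> acts on
  \<open>N\<close> through its finite quotient by \<open>M\<close>.\<close>

lemma natural_image_finite:
  assumes comm: "\<And>x y. \<lbrakk>x \<in> carrier N; y \<in> carrier N\<rbrakk> \<Longrightarrow> x \<otimes>\<^bsub>N\<^esub> y = y \<otimes>\<^bsub>N\<^esub> x"
    and A: "fg_group A" "virtually_abelian A"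
  shows "finite (natural_image_Out N A \<phi>)"
proof -
  obtain K where K: "subgroup K A" "fidx A K (carrier A)" "comm_group (A\<lparr>carrier := K\<rparr>)"
    using A(2) unfolding virtually_abelian_def A.finite_index_subgroup_iff by blast
  have Kc: "commuting A K" using comm_groupE(4)[OF K(3)] by (simp add: commuting_def)
  have fg: "fg_subgroup (carrier A) A" using A(1) by (simp add: fg_group_def)
  obtain M where M: "A.lattice_in M (carrier A)"
    using A.lattice_in_exists[OF A.subgroup_self fg K(1) subgroup.subset[OF K(1)] Kc K(2) K(1,2)] by blast
  have Mf: "subgroup M A" "commuting A M" "torsion_free A M" "fidx A M (carrier A)"
    "\<And>p m. p \<in> carrier A \<Longrightarrow> m \<in> M \<Longrightarrow> p \<otimes>\<^bsub>A\<^esub> m \<otimes>\<^bsub>A\<^esub> inv\<^bsub>A\<^esub> p \<in> M"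
    using M by (auto simp: A.lattice_in_def)
  have Mc: "M \<subseteq> carrier A" using subgroup.subset[OF Mf(1)] .
  obtain j where j: "j > 0" "\<And>v. v \<in> carrier A \<Longrightarrow> v [^]\<^bsub>A\<^esub> (j::nat) \<in> M"
    using A.fidx_common_power[OF Mf(1) A.subgroup_self Mf(4)] by blast
  have triv: "k \<otimes>\<^bsub>A\<^esub> \<phi> n \<otimes>\<^bsub>A\<^esub> inv\<^bsub>A\<^esub> k = \<phi> n" if k: "k \<in> M" and n: "n \<in> carrier N" for k n
  proof -
    have kc: "k \<in> carrier A" using k Mc by blast
    define m where "m = conj_aut N A \<phi> k n"
    have m: "m \<in> carrier N" "\<phi> m = k \<otimes>\<^bsub>A\<^esub> \<phi> n \<otimes>\<^bsub>A\<^esub> inv\<^bsub>A\<^esub> k"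
      using conj_aut_closed conj_aut_eq kc n by (auto simp: m_def)
    define t where "t = m \<otimes>\<^bsub>N\<^esub> inv\<^bsub>N\<^esub> n"
    have t: "t \<in> carrier N" using m n by (simp add: t_def)
    have "\<phi> t = k \<otimes>\<^bsub>A\<^esub> (\<phi> n \<otimes>\<^bsub>A\<^esub> inv\<^bsub>A\<^esub> k \<otimes>\<^bsub>A\<^esub> inv\<^bsub>A\<^esub> \<phi> n)"
      using m n kc by (simp add: t_def A.m_assoc)
    moreover have "\<phi> n \<otimes>\<^bsub>A\<^esub> inv\<^bsub>A\<^esub> k \<otimes>\<^bsub>A\<^esub> inv\<^bsub>A\<^esub> \<phi> n \<in> M"
      using Mf(5)[of "\<phi> n" "inv\<^bsub>A\<^esub> k"] subgroup.m_inv_closed[OF Mf(1) k] n by simp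
    ultimately have tM: "\<phi> t \<in> M" using subgroup.m_closed[OF Mf(1) k] by simp
    have "\<phi> m [^]\<^bsub>A\<^esub> j = k \<otimes>\<^bsub>A\<^esub> (\<phi> n [^]\<^bsub>A\<^esub> j) \<otimes>\<^bsub>A\<^esub> inv\<^bsub>A\<^esub> k"
      unfolding m(2) using A.conj_pow[OF kc, of "\<phi> n" j] n by simp
    also have "\<dots> = (\<phi> n [^]\<^bsub>A\<^esub> j) \<otimes>\<^bsub>A\<^esub> k \<otimes>\<^bsub>A\<^esub> inv\<^bsub>A\<^esub> k"
      using A.commutingD[OF Mf(2) k j(2)[of "\<phi> n"]] n by simp
    also have "\<dots> = \<phi> n [^]\<^bsub>A\<^esub> j" using kc n by (simp add: A.m_assoc)
    finally have "\<phi> (m [^]\<^bsub>N\<^esub> j) = \<phi> (n [^]\<^bsub>N\<^esub> j)" using m n by (simp add: \<phi>.hom_nat_pow)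
    then have "m [^]\<^bsub>N\<^esub> j = n [^]\<^bsub>N\<^esub> j" using inj m n by (auto dest: inj_onD)
    then have "t [^]\<^bsub>N\<^esub> j = \<one>\<^bsub>N\<^esub>"
      unfolding t_def using m n comm[of m "inv\<^bsub>N\<^esub> n"] by (simp add: N.pow_mult_distrib N.nat_pow_inv)
    then have "\<phi> t [^]\<^bsub>A\<^esub> j = \<one>\<^bsub>A\<^esub>" using \<phi>.hom_nat_pow[OF t, of j] by simp
    then have "\<phi> t = \<one>\<^bsub>A\<^esub>" using Mf(3) tM j(1) unfolding torsion_free_def by blast
    then have "\<phi> m = \<phi> n" using m(1) n by (simp add: t_def A.inv_solve_right' )
    then show ?thesis using m(2) by simp
  qed
  obtain F where F: "finite F" "F \<subseteq> carrier A" "\<forall>v\<in>carrier A. \<exists>f\<in>F. v \<otimes>\<^bsub>A\<^esub> inv\<^bsub>A\<^esub> f \<in> M"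
    using A.fidx_transversal[OF Mf(1) subset_refl Mf(4)] by blast
  have "natural_image_Out N A \<phi> \<subseteq> natural_hom_Out N A \<phi> ` F"
  proof
    fix y assume "y \<in> natural_image_Out N A \<phi>"
    then obtain a where a: "a \<in> carrier A" "y = natural_hom_Out N A \<phi> a" by (auto simp: natural_image_Out_def)
    obtain f where f: "f \<in> F" "a \<otimes>\<^bsub>A\<^esub> inv\<^bsub>A\<^esub> f \<in> M" using F a by blast
    have fc: "f \<in> carrier A" using f F by blast
    have "conj_aut N A \<phi> a n = conj_aut N A \<phi> f n" if n: "n \<in> carrier N" for n
    proof (rule conj_aut_eqI[OF a(1) n])
      have c: "conj_aut N A \<phi> f n \<in> carrier N" using conj_aut_closed fc n by blast
      then show "conj_aut N A \<phi> f n \<in> carrier N" .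
      have "a \<otimes>\<^bsub>A\<^esub> \<phi> n \<otimes>\<^bsub>A\<^esub> inv\<^bsub>A\<^esub> a = (a \<otimes>\<^bsub>A\<^esub> inv\<^bsub>A\<^esub> f) \<otimes>\<^bsub>A\<^esub> (f \<otimes>\<^bsub>A\<^esub> \<phi> n \<otimes>\<^bsub>A\<^esub> inv\<^bsub>A\<^esub> f) \<otimes>\<^bsub>A\<^esub> inv\<^bsub>A\<^esub> (a \<otimes>\<^bsub>A\<^esub> inv\<^bsub>A\<^esub> f)"
        using a fc n by (simp add: A.group_normalize)
      then show "\<phi> (conj_aut N A \<phi> f n) = a \<otimes>\<^bsub>A\<^esub> \<phi> n \<otimes>\<^bsub>A\<^esub> inv\<^bsub>A\<^esub> a"
        using triv[OF f(2) c] conj_aut_eq[OF fc n] by simp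
    qed
    then have "conj_aut N A \<phi> a = conj_aut N A \<phi> f"
      by (intro N.auto_eqI conj_aut_auto a(1) fc)
    then show "y \<in> natural_hom_Out N A \<phi> ` F" using a f by (auto simp: natural_hom_Out_def)
  qed
  then show ?thesis using F(1) by (rule finite_surj[rotated])
qed

end

section \<open>The conjugation action of the amalgam on \<open>N\<close>\<close>

context amalgam
begin

sublocale eA: normal_embedding A N \<phi>
  by (rule normal_embedding.intro[OF A.group_axioms N.group_axioms normal_embedding_axioms.intro[OF \<phi>]])

sublocale eB: normal_embedding B N \<psi>
  by (rule normal_embedding.intro[OF B.group_axioms N.group_axioms normal_embedding_axioms.intro[OF \<psi>]])

text \<open>An abelian \<open>A\<close> makes \<open>N\<close> abelian and its own natural image
  trivial, so everything generated lies in the natural image of \<open>B\<close>, which is then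
  finite.\<close>

lemma finite_natural_images_comm:
  assumes "comm_group A" "fg_group B" "virtually_abelian B"
  shows "finite (generate (Out N) (natural_image_Out N A \<phi> \<union> natural_image_Out N B \<psi>))"
proof -
  interpret Out: group "Out N" by (rule N.group_Out)
  have "x \<otimes>\<^bsub>N\<^esub> y = y \<otimes>\<^bsub>N\<^esub> x" if "x \<in> carrier N" "y \<in> carrier N" for x y
  proof (rule inj_onD[OF eA.inj])
    show "\<phi> (x \<otimes>\<^bsub>N\<^esub> y) = \<phi> (y \<otimes>\<^bsub>N\<^esub> x)"
      using that comm_groupE(4)[OF assms(1), of "\<phi> x" "\<phi> y"] by simp
  qed (use that in auto)
  then have fin: "finite (natural_image_Out N B \<psi>)" using eB.natural_image_finite assms(2,3) by blast
  note s = eB.natural_image_subgroup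
  have "natural_image_Out N A \<phi> \<union> natural_image_Out N B \<psi> \<subseteq> natural_image_Out N B \<psi>"
    using eA.natural_image_comm[OF assms(1)] subgroup.one_closed[OF s] by simp
  then have "generate (Out N) (natural_image_Out N A \<phi> \<union> natural_image_Out N B \<psi>) \<subseteq> natural_image_Out N B \<psi>"
    using Out.generate_subgroup_incl s by blast
  then show ?thesis using fin by (rule finite_subset)
qed

lemma \<nu>_hom: "\<nu> \<in> hom N P"
  by (auto simp: hom_def \<nu>_def)

sublocale \<nu>: group_hom N P \<nu> by unfold_locales (rule \<nu>_hom)

text \<open>Both conjugation actions restrict on \<open>N\<close> to the inner automorphisms of
  \<open>N\<close> itself, so they agree there and the universal property applies.\<close>

lemma conjugation_exists:
  "\<exists>\<Theta>\<in>hom P (AutoGroup N). (\<forall>a\<in>carrier A. \<Theta> (\<iota>A a) = conj_aut N A \<phi> a) \<and> (\<forall>b\<in>carrier B. \<Theta> (\<iota>B b) = conj_aut N B \<psi> b)"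
  by (rule universal_property[OF N.AutoGroup eA.conj_aut_hom eB.conj_aut_hom])
    (simp add: eA.conj_aut_image eB.conj_aut_image)

text \<open>The action comes from the universal property instead of pulling conjugation back along
  \<nu>, so its existence does not rest on injectivity of \<nu>; \<open>\<nu>_conj\<close> then
  relates it to conjugation.\<close>

definition \<Theta> :: "('a + 'b) list set \<Rightarrow> 'n \<Rightarrow> 'n" where
  "\<Theta> = (SOME \<Theta>. \<Theta> \<in> hom P (AutoGroup N) \<and> (\<forall>a\<in>carrier A. \<Theta> (\<iota>A a) = conj_aut N A \<phi> a) \<and>
     (\<forall>b\<in>carrier B. \<Theta> (\<iota>B b) = conj_aut N B \<psi> b))"

lemma \<Theta>_hom: "\<Theta> \<in> hom P (AutoGroup N)"
  and \<Theta>_A: "a \<in> carrier A \<Longrightarrow> \<Theta> (\<iota>A a) = conj_aut N A \<phi> a"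
  and \<Theta>_B: "b \<in> carrier B \<Longrightarrow> \<Theta> (\<iota>B b) = conj_aut N B \<psi> b"
proof -
  have "\<exists>\<Theta>. \<Theta> \<in> hom P (AutoGroup N) \<and> (\<forall>a\<in>carrier A. \<Theta> (\<iota>A a) = conj_aut N A \<phi> a) \<and>
     (\<forall>b\<in>carrier B. \<Theta> (\<iota>B b) = conj_aut N B \<psi> b)"
    using conjugation_exists by blast
  from someI_ex[OF this, folded \<Theta>_def] show "\<Theta> \<in> hom P (AutoGroup N)"
    "a \<in> carrier A \<Longrightarrow> \<Theta> (\<iota>A a) = conj_aut N A \<phi> a" "b \<in> carrier B \<Longrightarrow> \<Theta> (\<iota>B b) = conj_aut N B \<psi> b"
    by blast+
qed

sublocale \<Theta>: group_hom P "AutoGroup N" \<Theta>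
  by (rule group_hom.intro[OF group_P N.AutoGroup group_hom_axioms.intro[OF \<Theta>_hom]])

lemma \<Theta>_auto: "g \<in> carrier P \<Longrightarrow> \<Theta> g \<in> auto N"
  using \<Theta>.hom_closed by (simp add: N.carrier_AutoGroup)

lemma \<Theta>_closed: "g \<in> carrier P \<Longrightarrow> n \<in> carrier N \<Longrightarrow> \<Theta> g n \<in> carrier N"
  using \<Theta>_auto by (auto simp: auto_def hom_def)

lemma \<Theta>_mult: "g \<in> carrier P \<Longrightarrow> h \<in> carrier P \<Longrightarrow> n \<in> carrier N \<Longrightarrow> \<Theta> (g \<otimes>\<^bsub>P\<^esub> h) n = \<Theta> g (\<Theta> h n)"
  using N.AutoGroup_mult[OF \<Theta>_auto \<Theta>_auto] by simp

lemma \<nu>_conj: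
  assumes "g \<in> carrier P" "n \<in> carrier N"
  shows "\<nu> (\<Theta> g n) = g \<otimes>\<^bsub>P\<^esub> \<nu> n \<otimes>\<^bsub>P\<^esub> inv\<^bsub>P\<^esub> g"
proof -
  let ?S = "\<iota>A ` carrier A \<union> \<iota>B ` carrier B"
  have Sc: "?S \<subseteq> carrier P" by auto
  have gen: "\<nu> (\<Theta> s n) = s \<otimes>\<^bsub>P\<^esub> \<nu> n \<otimes>\<^bsub>P\<^esub> inv\<^bsub>P\<^esub> s" if s: "s \<in> ?S" and n: "n \<in> carrier N" for s n
  proof (cases "s \<in> \<iota>A ` carrier A")
    case True
    then obtain a where a: "a \<in> carrier A" "s = \<iota>A a" by blast
    then show ?thesis using \<Theta>_A[OF a(1)] eA.conj_aut_eq[OF a(1) n] n by (simp add: \<nu>_def)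
  next
    case False
    then obtain b where b: "b \<in> carrier B" "s = \<iota>B b" using s by blast
    have "\<nu> (\<Theta> s n) = \<iota>B (\<psi> (conj_aut N B \<psi> b n))"
      unfolding \<nu>_def b(2) \<Theta>_B[OF b(1)] by (rule \<iota>_glue[OF eB.conj_aut_closed[OF b(1) n]])
    then show ?thesis using eB.conj_aut_eq[OF b(1) n] n b \<iota>_glue[OF n] by (simp add: \<nu>_def)
  qed
  obtain w where w: "set w \<subseteq> ?S" "word_prod P w = g"
    using P.generate_word[OF iA.img_is_subgroup iB.img_is_subgroup, of g] P_generated assms(1) by auto
  have "\<nu> (\<Theta> (word_prod P w) n) = word_prod P w \<otimes>\<^bsub>P\<^esub> \<nu> n \<otimes>\<^bsub>P\<^esub> inv\<^bsub>P\<^esub> (word_prod P w)"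
    using w(1)
  proof (induction w)
    case Nil
    have "\<Theta> \<one>\<^bsub>P\<^esub> n = n" using \<Theta>.hom_one assms(2) by (simp add: AutoGroup_def BijGroup_def)
    then show ?case using assms by simp
  next
    case (Cons s w)
    have c: "s \<in> ?S" "s \<in> carrier P" "word_prod P w \<in> carrier P"
      using Cons.prems Sc P.word_prod_closed[of w] by auto
    have "\<nu> (\<Theta> (s \<otimes>\<^bsub>P\<^esub> word_prod P w) n) = s \<otimes>\<^bsub>P\<^esub> \<nu> (\<Theta> (word_prod P w) n) \<otimes>\<^bsub>P\<^esub> inv\<^bsub>P\<^esub> s"
      using gen[OF c(1) \<Theta>_closed[OF c(3) assms(2)]] \<Theta>_mult[OF c(2,3) assms(2)] by simp
    then show ?case using Cons c assms(2) by (simp add: P.group_normalize)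
  qed
  then show ?thesis using w by simp
qed

text \<open>Its image is the subgroup generated by both natural images, so finiteness of that
  subgroup amounts to finite index of the kernel.\<close>

definition \<Omega> :: "('a + 'b) list set \<Rightarrow> ('n \<Rightarrow> 'n) set" where "\<Omega> g = Inn N #>\<^bsub>AutoGroup N\<^esub> \<Theta> g"

lemma \<Omega>_hom: "\<Omega> \<in> hom P (Out N)"
proof -
  have "(\<lambda>\<sigma>. Inn N #>\<^bsub>AutoGroup N\<^esub> \<sigma>) \<circ> \<Theta> \<in> hom P (Out N)"
    by (rule hom_compose[OF \<Theta>_hom N.to_Out_hom])
  moreover have "(\<lambda>\<sigma>. Inn N #>\<^bsub>AutoGroup N\<^esub> \<sigma>) \<circ> \<Theta> = \<Omega>" by (auto simp: \<Omega>_def)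
  ultimately show ?thesis by simp
qed

sublocale \<Omega>: group_hom P "Out N" \<Omega>
  by (rule group_hom.intro[OF group_P N.group_Out group_hom_axioms.intro[OF \<Omega>_hom]])

lemma \<Omega>_image:
  "generate (Out N) (natural_image_Out N A \<phi> \<union> natural_image_Out N B \<psi>) = \<Omega> ` carrier P"
proof -
  have "natural_image_Out N A \<phi> \<union> natural_image_Out N B \<psi> = \<Omega> ` (\<iota>A ` carrier A \<union> \<iota>B ` carrier B)"
    unfolding natural_image_Out_def natural_hom_Out_def image_Un image_image \<Omega>_def
    by (intro arg_cong2[of _ _ _ _ "(\<union>)"] image_cong) (auto simp: \<Theta>_A \<Theta>_B)
  moreover have "\<iota>A ` carrier A \<union> \<iota>B ` carrier B \<subseteq> carrier P" by auto
  ultimately show ?thesis using \<Omega>.generate_img P_generated by simp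
qed

lemma \<Omega>_trivial_iff: "g \<in> carrier P \<Longrightarrow> \<Omega> g = \<one>\<^bsub>Out N\<^esub> \<longleftrightarrow> (\<exists>m\<in>carrier N. \<forall>n\<in>carrier N. \<Theta> g n = m \<otimes>\<^bsub>N\<^esub> n \<otimes>\<^bsub>N\<^esub> inv\<^bsub>N\<^esub> m)"
proof -
  assume g: "g \<in> carrier P"
  have "\<Theta> g = (\<lambda>n\<in>carrier N. m \<otimes>\<^bsub>N\<^esub> n \<otimes>\<^bsub>N\<^esub> inv\<^bsub>N\<^esub> m) \<longleftrightarrow> (\<forall>n\<in>carrier N. \<Theta> g n = m \<otimes>\<^bsub>N\<^esub> n \<otimes>\<^bsub>N\<^esub> inv\<^bsub>N\<^esub> m)" for m
  proof
    assume "\<forall>n\<in>carrier N. \<Theta> g n = m \<otimes>\<^bsub>N\<^esub> n \<otimes>\<^bsub>N\<^esub> inv\<^bsub>N\<^esub> m"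
    then show "\<Theta> g = (\<lambda>n\<in>carrier N. m \<otimes>\<^bsub>N\<^esub> n \<otimes>\<^bsub>N\<^esub> inv\<^bsub>N\<^esub> m)"
      using \<Theta>_auto[OF g] by (intro extensionalityI[of _ "carrier N"]) (auto simp: auto_def Bij_def)
  qed simp
  moreover have "\<Omega> g = \<one>\<^bsub>Out N\<^esub> \<longleftrightarrow> \<Theta> g \<in> Inn N"
    unfolding \<Omega>_def using N.to_Out_trivial_iff \<Theta>.hom_closed[OF g] by blast
  ultimately show ?thesis unfolding Inn_def image_iff by auto
qed

lemma \<nu>_image_normal: "\<nu> ` carrier N \<lhd> P"
proof (rule P.normal_invI[OF \<nu>.img_is_subgroup])
  fix x h assume x: "x \<in> carrier P" and "h \<in> \<nu> ` carrier N"
  then obtain n where n: "n \<in> carrier N" "h = \<nu> n" by blast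
  then have "x \<otimes>\<^bsub>P\<^esub> h \<otimes>\<^bsub>P\<^esub> inv\<^bsub>P\<^esub> x = \<nu> (\<Theta> x n)" using \<nu>_conj[OF x n(1)] by simp
  then show "x \<otimes>\<^bsub>P\<^esub> h \<otimes>\<^bsub>P\<^esub> inv\<^bsub>P\<^esub> x \<in> \<nu> ` carrier N" using \<Theta>_closed[OF x n(1)] by blast
qed

end

text \<open>Applied to the maps of \<open>A\<close> and \<open>B\<close> into the amalgam, this lets
  their images play the part of the factors.\<close>

lemma (in group_hom) image_virtually_abelian:
  assumes "fg_group G" "virtually_abelian G"
  shows "subgroup (h ` carrier G) H" "fg_subgroup (h ` carrier G) H"
    "\<exists>K. subgroup K H \<and> K \<subseteq> h ` carrier G \<and> commuting H K \<and> fidx H K (h ` carrier G)"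
proof -
  show "subgroup (h ` carrier G) H" by (rule img_is_subgroup)
  obtain S where S: "finite S" "S \<subseteq> carrier G" "generate G S = carrier G"
    using assms(1) by (auto simp: fg_group_def fg_subgroup_def)
  have "generate H (h ` S) = h ` carrier G" using generate_img[OF S(2)] S(3) by simp
  then show "fg_subgroup (h ` carrier G) H" unfolding fg_subgroup_def using S by (intro exI[of _ "h ` S"]) auto
  obtain K where K: "subgroup K G" "fidx G K (carrier G)" "comm_group (G\<lparr>carrier := K\<rparr>)"
    using assms(2) unfolding virtually_abelian_def G.finite_index_subgroup_iff by blast
  have Kc: "K \<subseteq> carrier G" using subgroup.subset[OF K(1)] .
  have hK: "subgroup (h ` K) H" by (rule subgroup_img_is_subgroup[OF K(1)])
  have "commuting H (h ` K)"
    unfolding commuting_def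
  proof (intro ballI)
    fix x y assume "x \<in> h ` K" "y \<in> h ` K"
    then obtain a b where ab: "a \<in> K" "b \<in> K" "x = h a" "y = h b" by blast
    have "a \<otimes> b = b \<otimes> a" using comm_groupE(4)[OF K(3), of a b] ab by simp
    then show "x \<otimes>\<^bsub>H\<^esub> y = y \<otimes>\<^bsub>H\<^esub> x" using ab Kc hom_mult by (metis subsetD)
  qed
  moreover have "fidx H (h ` K) (h ` carrier G)"
  proof -
    obtain F where F: "finite F" "F \<subseteq> carrier G" "\<forall>v\<in>carrier G. \<exists>f\<in>F. v \<otimes> inv f \<in> K"
      using G.fidx_transversal[OF K(1) subset_refl K(2)] by blast
    show ?thesis
    proof (rule H.fidx_by_transversal[OF hK, of _ "h ` F"])
      fix v assume "v \<in> h ` carrier G"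
      then obtain a where a: "a \<in> carrier G" "v = h a" by blast
      obtain f where f: "f \<in> F" "a \<otimes> inv f \<in> K" using F a by blast
      have "v \<otimes>\<^bsub>H\<^esub> inv\<^bsub>H\<^esub> (h f) = h (a \<otimes> inv f)" using a f F(2) by (simp add: subset_iff)
      then show "\<exists>f\<in>h ` F. v \<otimes>\<^bsub>H\<^esub> inv\<^bsub>H\<^esub> f \<in> h ` K" using f by auto
    qed (use F in auto)
  qed
  ultimately show "\<exists>K. subgroup K H \<and> K \<subseteq> h ` carrier G \<and> commuting H K \<and> fidx H K (h ` carrier G)"
    using hK Kc by blast
qed

section \<open>The two implications\<close>

context amalgam
begin

text \<open>\<open>L\<close> is the kernel of \<Omega>: an element acting on \<open>N\<close> as the
  inner automorphism of \<open>m\<close> differs from \<open>\<nu> m\<close> by an element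
  centralizing \<open>N\<close>, so the kernel is the product of \<open>N\<close> with its
  centralizer.\<close>

lemma property_LR_if_finite:
  assumes A: "fg_group A" "virtually_abelian A" and B: "fg_group B" "virtually_abelian B"
    and fin: "finite (\<Omega> ` carrier P)"
  shows "property_LR P"
proof -
  obtain KA where KA: "subgroup KA P" "KA \<subseteq> \<iota>A ` carrier A" "commuting P KA" "fidx P KA (\<iota>A ` carrier A)"
    using iA.image_virtually_abelian(3)[OF A] by blast
  obtain KB where KB: "subgroup KB P" "KB \<subseteq> \<iota>B ` carrier B" "commuting P KB" "fidx P KB (\<iota>B ` carrier B)"
    using iB.image_virtually_abelian(3)[OF B] by blast
  define L where "L = kernel P (Out N) \<Omega>"
  have L: "L \<lhd> P" unfolding L_def by (rule \<Omega>.normal_kernel)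
  have NL: "\<nu> ` carrier N \<subseteq> L"
  proof
    fix x assume "x \<in> \<nu> ` carrier N"
    then obtain m where m: "m \<in> carrier N" "x = \<nu> m" by blast
    have "\<Theta> (\<nu> m) n = m \<otimes>\<^bsub>N\<^esub> n \<otimes>\<^bsub>N\<^esub> inv\<^bsub>N\<^esub> m" if "n \<in> carrier N" for n
      using \<Theta>_A[of "\<phi> m"] eA.conj_aut_image[OF m(1)] m(1) that by (simp add: \<nu>_def)
    then have "\<Omega> x = \<one>\<^bsub>Out N\<^esub>" using \<Omega>_trivial_iff[of x] m by auto
    then show "x \<in> L" using m by (simp add: L_def kernel_def)
  qed
  have Lfin: "fidx P L (carrier P)"
  proof (rule P.fidx_by_map[OF normal_imp_subgroup[OF L] subset_refl fin])
    fix x y assume "x \<in> carrier P" "y \<in> carrier P" "\<Omega> x = \<Omega> y"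
    then show "x \<otimes>\<^bsub>P\<^esub> inv\<^bsub>P\<^esub> y \<in> L" by (simp add: L_def kernel_def)
  qed
  have split: "\<exists>n\<in>\<nu> ` carrier N. \<exists>z\<in>carrier P. (\<forall>m\<in>\<nu> ` carrier N. z \<otimes>\<^bsub>P\<^esub> m = m \<otimes>\<^bsub>P\<^esub> z) \<and> l = n \<otimes>\<^bsub>P\<^esub> z"
    if l: "l \<in> L" for l
  proof -
    have lc: "l \<in> carrier P" "\<Omega> l = \<one>\<^bsub>Out N\<^esub>" using l by (auto simp: L_def kernel_def)
    obtain m where m: "m \<in> carrier N" "\<forall>n\<in>carrier N. \<Theta> l n = m \<otimes>\<^bsub>N\<^esub> n \<otimes>\<^bsub>N\<^esub> inv\<^bsub>N\<^esub> m"
      using iffD1[OF \<Omega>_trivial_iff[OF lc(1)] lc(2)] by (elim bexE)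
    define z where "z = inv\<^bsub>P\<^esub> (\<nu> m) \<otimes>\<^bsub>P\<^esub> l"
    have z: "z \<in> carrier P" "l = \<nu> m \<otimes>\<^bsub>P\<^esub> z" using lc m by (simp_all add: z_def)
    have "z \<otimes>\<^bsub>P\<^esub> \<nu> n = \<nu> n \<otimes>\<^bsub>P\<^esub> z" if n: "n \<in> carrier N" for n
    proof -
      have "l \<otimes>\<^bsub>P\<^esub> \<nu> n = (l \<otimes>\<^bsub>P\<^esub> \<nu> n \<otimes>\<^bsub>P\<^esub> inv\<^bsub>P\<^esub> l) \<otimes>\<^bsub>P\<^esub> l" using lc n by (simp add: P.m_assoc)
      also have "l \<otimes>\<^bsub>P\<^esub> \<nu> n \<otimes>\<^bsub>P\<^esub> inv\<^bsub>P\<^esub> l = \<nu> m \<otimes>\<^bsub>P\<^esub> \<nu> n \<otimes>\<^bsub>P\<^esub> inv\<^bsub>P\<^esub> (\<nu> m)"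
        using \<nu>_conj[OF lc(1) n] m n by simp
      finally have "l \<otimes>\<^bsub>P\<^esub> \<nu> n = \<nu> m \<otimes>\<^bsub>P\<^esub> \<nu> n \<otimes>\<^bsub>P\<^esub> inv\<^bsub>P\<^esub> (\<nu> m) \<otimes>\<^bsub>P\<^esub> l" .
      then show ?thesis using m n lc by (simp add: z_def P.m_assoc)
    qed
    then show ?thesis using z m(1) by blast
  qed
  have NA: "\<nu> ` carrier N \<subseteq> \<iota>A ` carrier A" by (auto simp: \<nu>_def)
  have NB: "\<nu> ` carrier N \<subseteq> \<iota>B ` carrier B" by (auto simp: \<nu>_def \<iota>_glue)
  show ?thesis
    by (rule P.property_LR_of_glue[OF iA.image_virtually_abelian(1,2)[OF A] KA iB.image_virtually_abelian(1,2)[OF B] KB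
      \<nu>_image_normal NA NB P_generated glues_P L NL Lfin split])
qed

lemma finite_if_property_LR:
  assumes A: "fg_group A" "virtually_abelian A" and LR: "property_LR P"
  shows "finite (\<Omega> ` carrier P)"
proof -
  obtain KA where KA: "subgroup KA P" "KA \<subseteq> \<iota>A ` carrier A" "commuting P KA" "fidx P KA (\<iota>A ` carrier A)"
    using iA.image_virtually_abelian(3)[OF A] by blast
  note iAf = iA.image_virtually_abelian(1,2)[OF A]
  obtain MA where MA: "P.lattice_in MA (\<iota>A ` carrier A)"
    using P.lattice_in_exists[OF iAf KA KA(1,4)] by blast
  have NA: "\<nu> ` carrier N \<subseteq> \<iota>A ` carrier A" by (auto simp: \<nu>_def)
  \<comment> \<open>(LR) speaks of finitely generated subgroups; \<open>N\<close> qualifies because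
    it lies in the image of \<open>A\<close>, which is finitely generated and virtually
    abelian.\<close>
  have "fg_subgroup (\<nu> ` carrier N) P" by (rule P.lattice_restrict(6)[OF MA \<nu>.img_is_subgroup NA])
  then have "virtual_retract (\<nu> ` carrier N) P" using LR by (simp add: property_LR_def)
  then obtain K \<rho> where K: "subgroup K P" "fidx P K (carrier P)" "\<nu> ` carrier N \<subseteq> K"
    and \<rho>: "\<rho> \<in> hom (P\<lparr>carrier := K\<rparr>) (P\<lparr>carrier := \<nu> ` carrier N\<rparr>)" "\<forall>h\<in>\<nu> ` carrier N. \<rho> h = h"
    unfolding virtual_retract_def P.finite_index_subgroup_iff by (elim conjE exE bexE) (rule that)
  have \<rho>m: "\<rho> (x \<otimes>\<^bsub>P\<^esub> y) = \<rho> x \<otimes>\<^bsub>P\<^esub> \<rho> y" if "x \<in> K" "y \<in> K" for x y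
    using \<rho>(1) that by (simp add: hom_def)
  have \<rho>c: "\<rho> x \<in> \<nu> ` carrier N" if "x \<in> K" for x using \<rho>(1) that by (auto simp: hom_def)
  have triv: "\<Omega> k = \<one>\<^bsub>Out N\<^esub>" if k: "k \<in> K" for k
  proof -
    have kc: "k \<in> carrier P" using subgroup.mem_carrier[OF K(1) k] .
    obtain m where m: "m \<in> carrier N" "\<rho> k = \<nu> m" using \<rho>c[OF k] by blast
    \<comment> \<open>Injectivity of \<nu> returns the computation from the amalgam to
      \<open>N\<close> itself, where \<open>Out N\<close> is defined.\<close>
    have "\<Theta> k n = m \<otimes>\<^bsub>N\<^esub> n \<otimes>\<^bsub>N\<^esub> inv\<^bsub>N\<^esub> m" if n: "n \<in> carrier N" for n
    proof (rule inj_onD[OF \<nu>_inj])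
      have t: "\<Theta> k n \<in> carrier N" by (rule \<Theta>_closed[OF kc n])
      \<comment> \<open>Applying the retraction to this equation fixes the two elements of
        \<open>N\<close> and replaces \<open>k\<close> by \<open>\<nu> m\<close>, so
        \<open>k\<close> acts on \<open>N\<close> as \<open>m\<close> does.\<close>
      have "\<nu> (\<Theta> k n) \<otimes>\<^bsub>P\<^esub> k = k \<otimes>\<^bsub>P\<^esub> \<nu> n" using \<nu>_conj[OF kc n] kc n by (simp add: P.m_assoc)
      then have "\<rho> (\<nu> (\<Theta> k n)) \<otimes>\<^bsub>P\<^esub> \<rho> k = \<rho> k \<otimes>\<^bsub>P\<^esub> \<rho> (\<nu> n)"
        using \<rho>m[of "\<nu> (\<Theta> k n)" k] \<rho>m[of k "\<nu> n"] k n t K(3) by (simp add: image_subset_iff)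
      then have "\<nu> (\<Theta> k n) \<otimes>\<^bsub>P\<^esub> \<nu> m = \<nu> m \<otimes>\<^bsub>P\<^esub> \<nu> n" using \<rho>(2) t n m(2) by simp
      then have "\<nu> (\<Theta> k n) = \<nu> m \<otimes>\<^bsub>P\<^esub> \<nu> n \<otimes>\<^bsub>P\<^esub> inv\<^bsub>P\<^esub> (\<nu> m)"
        using P.inv_solve_right[of "\<nu> (\<Theta> k n)" "\<nu> m \<otimes>\<^bsub>P\<^esub> \<nu> n" "\<nu> m"] t n m(1) by simp
      then show "\<nu> (\<Theta> k n) = \<nu> (m \<otimes>\<^bsub>N\<^esub> n \<otimes>\<^bsub>N\<^esub> inv\<^bsub>N\<^esub> m)" using m n by simp
    qed (use \<Theta>_closed[OF kc n] m n in auto)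
    then show ?thesis using \<Omega>_trivial_iff[OF kc] m(1) by blast
  qed
  obtain F where F: "finite F" "F \<subseteq> carrier P" "\<forall>v\<in>carrier P. \<exists>f\<in>F. v \<otimes>\<^bsub>P\<^esub> inv\<^bsub>P\<^esub> f \<in> K"
    using P.fidx_transversal[OF K(1) subset_refl K(2)] by blast
  have "\<Omega> ` carrier P \<subseteq> \<Omega> ` F"
  proof
    fix y assume "y \<in> \<Omega> ` carrier P"
    then obtain g where g: "g \<in> carrier P" "y = \<Omega> g" by blast
    obtain f where f: "f \<in> F" "g \<otimes>\<^bsub>P\<^esub> inv\<^bsub>P\<^esub> f \<in> K" using F g by blast
    have fc: "f \<in> carrier P" using f F by blast
    have "g = (g \<otimes>\<^bsub>P\<^esub> inv\<^bsub>P\<^esub> f) \<otimes>\<^bsub>P\<^esub> f" using g fc by (simp add: P.m_assoc)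
    then have "\<Omega> g = \<Omega> (g \<otimes>\<^bsub>P\<^esub> inv\<^bsub>P\<^esub> f) \<otimes>\<^bsub>Out N\<^esub> \<Omega> f"
      using \<Omega>.hom_mult[of "g \<otimes>\<^bsub>P\<^esub> inv\<^bsub>P\<^esub> f" f] g(1) fc by (metis P.inv_closed P.m_closed)
    also have "\<dots> = \<Omega> f" using triv[OF f(2)] \<Omega>.hom_closed[OF fc] by (simp only: \<Omega>.H.l_one)
    finally show "y \<in> \<Omega> ` F" using g f by blast
  qed
  then show ?thesis using F(1) by (rule finite_surj[rotated])
qed

end

theorem corollary1p1:
  fixes A :: "('a, 'm) monoid_scheme"
    and B :: "('b, 'l) monoid_scheme"
    and N :: "('n, 'k) monoid_scheme"
    and \<phi> :: "'n \<Rightarrow> 'a" and \<psi> :: "'n \<Rightarrow> 'b"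
  assumes "fg_group A" and "virtually_abelian A"
    and "fg_group B" and "virtually_abelian B"
    and "group N"
    and "\<phi> \<in> mon N A" and "\<phi> ` carrier N \<lhd> A"
    and "\<psi> \<in> mon N B" and "\<psi> ` carrier N \<lhd> B"
  shows "(property_LR (amalg_product N A B \<phi> \<psi>) \<longleftrightarrow>
            finite (generate (Out N) (natural_image_Out N A \<phi> \<union> natural_image_Out N B \<psi>)))
       \<and> (comm_group A \<or> comm_group B \<longrightarrow>
            finite (generate (Out N) (natural_image_Out N A \<phi> \<union> natural_image_Out N B \<psi>)) \<and>
            property_LR (amalg_product N A B \<phi> \<psi>))"
proof -
  have gA: "group A" and gB: "group B" using assms(1,3) by (auto simp: fg_group_def)
  interpret AB: amalgam A B N \<phi> \<psi>
    by (rule amalgam.intro[OF gA gB assms(5) amalgam_axioms.intro[OF assms(6-9)]])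
  \<comment> \<open>Exchanging the factors covers the case of an abelian \<open>B\<close>; the union
    of the natural images is the same in either order.\<close>
  interpret BA: amalgam B A N \<psi> \<phi>
    by (rule amalgam.intro[OF gB gA assms(5) amalgam_axioms.intro[OF assms(8,9,6,7)]])
  have iff: "property_LR (amalg_product N A B \<phi> \<psi>) \<longleftrightarrow>
      finite (generate (Out N) (natural_image_Out N A \<phi> \<union> natural_image_Out N B \<psi>))"
    unfolding AB.\<Omega>_image using AB.property_LR_if_finite AB.finite_if_property_LR assms(1-4) by blast
  have "finite (generate (Out N) (natural_image_Out N A \<phi> \<union> natural_image_Out N B \<psi>))"
    if "comm_group A \<or> comm_group B"
    using that AB.finite_natural_images_comm BA.finite_natural_images_comm assms(1-4)
    by (auto simp: Un_commute)
  then show ?thesis using iff by blast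
qed

end
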